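(* Let $M^3$ be a hypersurface of Euclidean 4-space $\mathbb E^4$ which is Casorati ideal for the inequality $\rho\le\delta_C(2)$, i.e. $\rho=\delta_C(2)$ at every point of $M^3$. Then $M^3$ is rigid.
   Context: An isometric immersion of a Riemannian $n$-manifold into Euclidean $m$-space $\mathbb E^m$ is called rigid if the isometric immersion is unique up to isometries of $\mathbb E^m$. For a hypersurface $M^3$ of $\mathbb E^4$ with induced metric, let $h_{ij}$ be the components of its (scalar) second fundamental form in an orthonormal tangent frame $e_1,e_2,e_3$. The Casorati curvature is $\mathcal C=\frac13\sum_{i,j=1}^3h_{ij}^2$. For a plane $L\subset T_xM$ with orthonormal basis $e_1,e_2$, $\mathcal C(L)=\frac12\sum_{i,j=1}^2h_{ij}^2$. The normalized $\delta$-Casorati curvature is $$[\delta_C(2)]_x=\tfrac12\,\mathcal C_x+\tfrac23\inf\{\mathcal C(L)\mid L\text{ a 2-dimensional subspace of }T_xM\}.$$ The normalized scalar curvature is $\rho=\frac13\sum_{i<j}K(e_i\wedge e_j)$, where $K$ is the sectional curvature of $M$. The inequality $\rho\le\delta_C(2)$ holds for every hypersurface of $\mathbb E^4$; hypersurfaces attaining equality are called Casorati ideal for it.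
   Formalization: The hypersurface is assumed connected and not totally geodesic: pieces of a hyperplane satisfy ρ = δ_C(2) = 0 but can be rolled onto a cylinder, and disconnected hypersurfaces are never rigid. *)

theory Defs
  imports "HOL-Analysis.Analysis"
begin

subsection \<open>Smooth maps and manifolds\<close>

text \<open>
  \<open>smooth_on S f\<close> is meant for open \<open>S\<close>: all iterated directional derivatives of \<open>f\<close>
  exist and are continuous on \<open>S\<close>.
\<close>

primrec higher_differentiable_on ::
    "'a::real_normed_vector set \<Rightarrow> ('a \<Rightarrow> 'b::real_normed_vector) \<Rightarrow> nat \<Rightarrow> bool" where
  "higher_differentiable_on S f 0 \<longleftrightarrow> continuous_on S f"
| "higher_differentiable_on S f (Suc k) \<longleftrightarrow>
     (\<forall>u\<in>S. f differentiable (at u)) \<and>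
     (\<forall>v. higher_differentiable_on S (\<lambda>u. frechet_derivative f (at u) v) k)"

definition smooth_on :: "'a::real_normed_vector set \<Rightarrow> ('a \<Rightarrow> 'b::real_normed_vector) \<Rightarrow> bool" where
  "smooth_on S f \<longleftrightarrow> (\<forall>k. higher_differentiable_on S f k)"

text \<open>
  A chart is a pair of its domain and its coordinate map. The manifold is the whole type \<open>'a\<close>,
  whose Hausdorff and second countability properties come from its type class.
\<close>

type_synonym ('a, 'n) chart = "'a set \<times> ('a \<Rightarrow> real ^ 'n)"

definition chart :: "('a::topological_space, 'n::finite) chart \<Rightarrow> bool" where
  "chart c \<longleftrightarrow> open (fst c) \<and> open (snd c ` fst c) \<and>
     homeomorphism (fst c) (snd c ` fst c) (snd c) (inv_into (fst c) (snd c))"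

definition smooth_atlas ::
    "('a::{t2_space, second_countable_topology}, 'n::finite) chart set \<Rightarrow> bool" where
  "smooth_atlas A \<longleftrightarrow>
     (\<Union>c\<in>A. fst c) = UNIV \<and> (\<forall>c\<in>A. chart c) \<and>
     (\<forall>c\<in>A. \<forall>d\<in>A. smooth_on (snd c ` (fst c \<inter> fst d)) (snd d \<circ> inv_into (fst c) (snd c)))"

definition in_chart :: "('a \<Rightarrow> 'b) \<Rightarrow> ('a, 'n) chart \<Rightarrow> real ^ 'n \<Rightarrow> 'b" where
  "in_chart f c = f \<circ> inv_into (fst c) (snd c)"


subsection \<open>Isometric immersions and rigidity\<close>

definition smooth_immersion ::
    "('a::{t2_space, second_countable_topology}, 'n::finite) chart set
       \<Rightarrow> ('a \<Rightarrow> real ^ 'm::finite) \<Rightarrow> bool" where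
  "smooth_immersion A f \<longleftrightarrow>
     (\<forall>c\<in>A. smooth_on (snd c ` fst c) (in_chart f c) \<and>
       (\<forall>u\<in>snd c ` fst c. inj (frechet_derivative (in_chart f c) (at u))))"

definition partial :: "'n::finite \<Rightarrow> (real ^ 'n \<Rightarrow> 'b::real_normed_vector) \<Rightarrow> real ^ 'n \<Rightarrow> 'b" where
  "partial i F u = frechet_derivative F (at u) (axis i 1)"

definition first_fundamental_form ::
    "(real ^ 'n::finite \<Rightarrow> real ^ 'm::finite) \<Rightarrow> real ^ 'n \<Rightarrow> real ^ 'n ^ 'n" where
  "first_fundamental_form F u = (\<chi> i j. partial i F u \<bullet> partial j F u)"

text \<open>
  A Riemannian metric is given by its matrix of components in each chart, as a function of the
  coordinates.
\<close>

type_synonym ('a, 'n) metric = "('a, 'n) chart \<Rightarrow> real ^ 'n \<Rightarrow> real ^ 'n ^ 'n"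

definition induced_metric :: "('a \<Rightarrow> real ^ 'm::finite) \<Rightarrow> ('a, 'n::finite) metric" where
  "induced_metric f c = first_fundamental_form (in_chart f c)"

definition isometric_immersion ::
    "('a::{t2_space, second_countable_topology}, 'n::finite) chart set
       \<Rightarrow> ('a, 'n) metric \<Rightarrow> ('a \<Rightarrow> real ^ 'm::finite) \<Rightarrow> bool" where
  "isometric_immersion A G f \<longleftrightarrow>
     smooth_immersion A f \<and> (\<forall>c\<in>A. \<forall>u\<in>snd c ` fst c. induced_metric f c u = G c u)"

definition euclidean_isometry :: "(real ^ 'm::finite \<Rightarrow> real ^ 'm) \<Rightarrow> bool" where
  "euclidean_isometry T \<longleftrightarrow> surj T \<and> (\<forall>p q. dist (T p) (T q) = dist p q)"

definition rigid ::
    "('a::{t2_space, second_countable_topology}, 'n::finite) chart set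
       \<Rightarrow> ('a, 'n) metric \<Rightarrow> ('a \<Rightarrow> real ^ 'm::finite) \<Rightarrow> bool" where
  "rigid A G f \<longleftrightarrow>
     isometric_immersion A G f \<and>
     (\<forall>f' :: 'a \<Rightarrow> real ^ 'm. isometric_immersion A G f' \<longrightarrow>
        (\<exists>T. euclidean_isometry T \<and> f' = T \<circ> f))"


subsection \<open>Intrinsic curvature of a metric in coordinates\<close>

text \<open>
  Below, \<open>g\<close> is a metric on an open set of coordinates, and tangent vectors at \<open>u\<close> are written in
  the coordinate basis.
\<close>

definition metric_inner :: "(real ^ 'n::finite \<Rightarrow> real ^ 'n ^ 'n) \<Rightarrow> real ^ 'n \<Rightarrow> real ^ 'n \<Rightarrow> real ^ 'n \<Rightarrow> real" where
  "metric_inner g u v w = (\<Sum>i\<in>UNIV. \<Sum>j\<in>UNIV. g u $ i $ j * v $ i * w $ j)"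

text \<open>\<open>christoffel g k i j u\<close> is \<open>\<Gamma>\<^sup>k\<^sub>i\<^sub>j\<close>.\<close>

definition christoffel ::
    "(real ^ 'n::finite \<Rightarrow> real ^ 'n ^ 'n) \<Rightarrow> 'n \<Rightarrow> 'n \<Rightarrow> 'n \<Rightarrow> real ^ 'n \<Rightarrow> real" where
  "christoffel g k i j u =
     (1/2) * (\<Sum>l\<in>UNIV. matrix_inv (g u) $ k $ l *
        (partial i (\<lambda>u. g u $ j $ l) u + partial j (\<lambda>u. g u $ i $ l) u
          - partial l (\<lambda>u. g u $ i $ j) u))"

text \<open>
  \<open>riemann_component g l k i j u\<close> is the \<open>\<partial>\<^sub>l\<close>-component of \<open>R(\<partial>\<^sub>i, \<partial>\<^sub>j) \<partial>\<^sub>k\<close>, where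
  \<open>R(X, Y) = \<nabla>\<^sub>X \<nabla>\<^sub>Y - \<nabla>\<^sub>Y \<nabla>\<^sub>X - \<nabla>\<^bsub>[X, Y]\<^esub>\<close>.
\<close>

definition riemann_component ::
    "(real ^ 'n::finite \<Rightarrow> real ^ 'n ^ 'n) \<Rightarrow> 'n \<Rightarrow> 'n \<Rightarrow> 'n \<Rightarrow> 'n \<Rightarrow> real ^ 'n \<Rightarrow> real" where
  "riemann_component g l k i j u =
     partial i (christoffel g l j k) u - partial j (christoffel g l i k) u
     + (\<Sum>m\<in>UNIV. christoffel g m j k u * christoffel g l i m u
                - christoffel g m i k u * christoffel g l j m u)"

definition riemann ::
    "(real ^ 'n::finite \<Rightarrow> real ^ 'n ^ 'n) \<Rightarrow> real ^ 'n \<Rightarrow> real ^ 'n \<Rightarrow> real ^ 'n \<Rightarrow> real ^ 'n \<Rightarrow> real ^ 'n" where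
  "riemann g u x y z =
     (\<chi> l. \<Sum>i\<in>UNIV. \<Sum>j\<in>UNIV. \<Sum>k\<in>UNIV. riemann_component g l k i j u * x $ i * y $ j * z $ k)"

definition sectional_curvature ::
    "(real ^ 'n::finite \<Rightarrow> real ^ 'n ^ 'n) \<Rightarrow> real ^ 'n \<Rightarrow> real ^ 'n \<Rightarrow> real ^ 'n \<Rightarrow> real" where
  "sectional_curvature g u x y =
     metric_inner g u (riemann g u x y y) x /
     (metric_inner g u x x * metric_inner g u y y - (metric_inner g u x y)\<^sup>2)"

text \<open>
  The vectors \<open>e 1, \<dots>, e k\<close> form an orthonormal basis of the subspace \<open>L\<close> of the tangent space
  at \<open>u\<close>.
\<close>

definition orthonormal_frame ::
    "(real ^ 'n::finite \<Rightarrow> real ^ 'n ^ 'n) \<Rightarrow> real ^ 'n \<Rightarrow> nat \<Rightarrow> (real ^ 'n) set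
       \<Rightarrow> (nat \<Rightarrow> real ^ 'n) \<Rightarrow> bool" where
  "orthonormal_frame g u k L e \<longleftrightarrow>
     (\<forall>i\<in>{1..k}. \<forall>j\<in>{1..k}. metric_inner g u (e i) (e j) = (if i = j then 1 else 0)) \<and>
     span (e ` {1..k}) = L"

text \<open>The choice of the frame is immaterial here and in \<open>casorati\<close>.\<close>

definition normalized_scalar_curvature ::
    "(real ^ 3 \<Rightarrow> real ^ 3 ^ 3) \<Rightarrow> real ^ 3 \<Rightarrow> real" where
  "normalized_scalar_curvature g u =
     (let e = (SOME e. orthonormal_frame g u 3 UNIV e)
      in (1/3) * (\<Sum>j\<in>{1..3}. \<Sum>i\<in>{1..<j}. sectional_curvature g u (e i) (e j)))"


subsection \<open>Second fundamental form and Casorati curvatures of a hypersurface\<close>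

text \<open>
  The unit normal, hence the scalar second fundamental form, is determined only up to a sign
  at each point. Every use of it below is invariant under this sign.
\<close>

definition unit_normal :: "(real ^ 3 \<Rightarrow> real ^ 4) \<Rightarrow> real ^ 3 \<Rightarrow> real ^ 4" where
  "unit_normal F u = (SOME N. norm N = 1 \<and> (\<forall>v. N \<bullet> frechet_derivative F (at u) v = 0))"

definition second_fundamental_form ::
    "(real ^ 3 \<Rightarrow> real ^ 4) \<Rightarrow> real ^ 3 \<Rightarrow> real ^ 3 \<Rightarrow> real ^ 3 \<Rightarrow> real" where
  "second_fundamental_form F u v w =
     frechet_derivative (\<lambda>u'. frechet_derivative F (at u') w) (at u) v \<bullet> unit_normal F u"

text \<open>
  For a \<open>k\<close>-dimensional subspace \<open>L\<close> of the tangent space this is \<open>\<C>(L)\<close>; the case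
  \<open>k = 3\<close>, \<open>L = UNIV\<close> is the Casorati curvature \<open>\<C>\<close> itself.
\<close>

definition casorati :: "(real ^ 3 \<Rightarrow> real ^ 4) \<Rightarrow> real ^ 3 \<Rightarrow> nat \<Rightarrow> (real ^ 3) set \<Rightarrow> real" where
  "casorati F u k L =
     (let e = (SOME e. orthonormal_frame (first_fundamental_form F) u k L e)
      in (1 / real k) * (\<Sum>i\<in>{1..k}. \<Sum>j\<in>{1..k}. (second_fundamental_form F u (e i) (e j))\<^sup>2))"

definition delta_casorati_2 :: "(real ^ 3 \<Rightarrow> real ^ 4) \<Rightarrow> real ^ 3 \<Rightarrow> real" where
  "delta_casorati_2 F u =
     (1/2) * casorati F u 3 UNIV + (2/3) * (INF L\<in>{L. subspace L \<and> dim L = 2}. casorati F u 2 L)"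

definition casorati_ideal ::
    "('a::{t2_space, second_countable_topology}, 3) chart set \<Rightarrow> ('a \<Rightarrow> real ^ 4) \<Rightarrow> bool" where
  "casorati_ideal A f \<longleftrightarrow>
     (\<forall>c\<in>A. \<forall>u\<in>snd c ` fst c.
        normalized_scalar_curvature (induced_metric f c) u = delta_casorati_2 (in_chart f c) u)"

text \<open>
  Totally geodesic hypersurfaces satisfy the equality trivially (both sides vanish) but are not
  rigid: the hyperplane \<open>(x, y, z) \<mapsto> (x, y, z, 0)\<close> and the cylinder
  \<open>(x, y, z) \<mapsto> (cos x, sin x, y, z)\<close> induce the same flat metric. They have to be excluded in a
  rigidity theorem.
\<close>

definition totally_geodesic ::
    "('a::{t2_space, second_countable_topology}, 3) chart set \<Rightarrow> ('a \<Rightarrow> real ^ 4) \<Rightarrow> bool" where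
  "totally_geodesic A f \<longleftrightarrow>
     (\<forall>c\<in>A. \<forall>u\<in>snd c ` fst c. \<forall>v w. second_fundamental_form (in_chart f c) u v w = 0)"

end

theory Submission
  imports Defs
begin

text \<open>
  Equality in \<open>\<rho> \<le> \<delta>\<^sub>C(2)\<close> means that the principal curvatures are \<open>l, l, 2 l\<close>.
  Where \<open>l \<noteq> 0\<close> the second fundamental form has rank three, so by the Gauss equation the metric
  determines it up to sign and the hypersurface is locally unique up to isometries (Beez-Killing).

  It remains to see that \<open>l\<close> has no zeros. The Codazzi equation shows that \<open>l\<close> varies only along
  the simple principal direction \<open>e\<close>, say \<open>D l = m \<langle>e, \<cdot>\<rangle>\<close>, and that the vector
  \<open>l\<^sup>2 dF(e) + m N\<close> of the ambient space is constant: the hypersurface is rotational and this is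
  its axis. Hence \<open>l\<^sup>4 + \<bar>D l\<bar>\<^sup>2\<close> is locally constant and positive where
  \<open>l \<noteq> 0\<close>. At a zero of \<open>l\<close> the Codazzi equation forces \<open>D l = 0\<close> as well, so a
  continuity argument excludes zeros in a connected patch unless \<open>l\<close> vanishes identically there,
  that is, unless the patch lies in a hyperplane.
\<close>

subsection \<open>Calculus of smooth maps\<close>

text \<open>The obstacle is that the simple principal direction \<open>e\<close> need not extend
  continuously to a zero of \<open>l\<close>, so neither \<open>e\<close> nor the axis vector can be
  differentiated there. Quantities that must survive at zeros are therefore built without
  \<open>e\<close>: a quarter of the trace of the shape operator equals \<open>l\<close>, because
  \<open>l + l + 2 l = 4 l\<close>, and the squared length of the axis vector is rewritten as
  \<open>l^4\<close> plus the squared gradient of \<open>l\<close>. At a zero, the second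
  fundamental form and \<open>l\<close> are compared only through two-sided pointwise bounds. A
  second obstacle is that the sign of \<open>l\<close> depends on the orientation of the chart. The
  passage to the manifold therefore speaks of points with a neighbourhood mapped into a hyperplane.
  The same notion glues the local congruences: two Euclidean isometries that agree on a set
  contained in no hyperplane coincide, so the isometry cannot change from one chart to the
  next.\<close>

definition dir_deriv ::
    "'a::real_normed_vector \<Rightarrow> ('a \<Rightarrow> 'b::real_normed_vector) \<Rightarrow> 'a \<Rightarrow> 'b" where
  "dir_deriv v f u = frechet_derivative f (at u) v"

lemma dir_deriv_eqI: "(f has_derivative f') (at u) \<Longrightarrow> dir_deriv v f u = f' v"
  by (metis dir_deriv_def frechet_derivative_at)

lemma has_derivative_dir_deriv:
  "f differentiable (at u) \<Longrightarrow> (f has_derivative (\<lambda>v. dir_deriv v f u)) (at u)"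
  unfolding dir_deriv_def by (simp add: frechet_derivative_works)

lemma linear_dir_deriv:
  assumes "f differentiable (at u)"
  shows "linear (\<lambda>v. dir_deriv v f u)"
  using has_derivative_dir_deriv[OF assms] by (rule has_derivative_linear)

text \<open>With the direction as first argument, \<open>dir_deriv v f\<close> is again a function
  of the point, so derivatives iterate as operators. From here on the recursion is unfolded only in
  this form.\<close>

lemma higher_differentiable_on_Suc_dir_deriv:
  "higher_differentiable_on S f (Suc k) \<longleftrightarrow>
     (\<forall>u\<in>S. f differentiable (at u)) \<and> (\<forall>v. higher_differentiable_on S (dir_deriv v f) k)"
  by (simp add: dir_deriv_def[abs_def])

declare higher_differentiable_on.simps(2) [simp del]

text \<open>\<open>frechet_derivative\<close> is a choice among all derivatives at a point.
  Functions that agree near \<open>u\<close> have the same derivatives there, hence the same choice,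
  differentiable or not.\<close>

lemma dir_deriv_cong:
  assumes "open S" "u \<in> S" "\<And>x. x \<in> S \<Longrightarrow> f x = g x"
  shows "dir_deriv v f u = dir_deriv v g u"
proof -
  have "(f has_derivative f') (at u) \<longleftrightarrow> (g has_derivative f') (at u)" for f'
    using assms has_derivative_transform_within_open[of f f' u UNIV S g]
      has_derivative_transform_within_open[of g f' u UNIV S f] by auto
  then show ?thesis by (simp add: dir_deriv_def frechet_derivative_def)
qed

lemma differentiable_cong_open:
  assumes "open S" "u \<in> S" "\<And>x. x \<in> S \<Longrightarrow> f x = g x" "f differentiable (at u)"
  shows "g differentiable (at u)"
  using assms has_derivative_transform_within_open[of f _ u UNIV S g]
  unfolding differentiable_def by blast

lemma higher_differentiable_on_cong:
  assumes "open S" "\<And>x. x \<in> S \<Longrightarrow> f x = g x" "higher_differentiable_on S f k"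
  shows "higher_differentiable_on S g k"
  using assms(2,3)
proof (induction k arbitrary: f g)
  case 0
  then show ?case by (simp cong: continuous_on_cong)
next
  case (Suc k)
  have "g differentiable (at u)" if "u \<in> S" for u
    using differentiable_cong_open[OF assms(1) that, of f g] Suc.prems that
    by (auto simp: higher_differentiable_on_Suc_dir_deriv)
  moreover have "higher_differentiable_on S (dir_deriv v g) k" for v
  proof (rule Suc.IH[of "dir_deriv v f"])
    show "dir_deriv v f x = dir_deriv v g x" if "x \<in> S" for x
      by (rule dir_deriv_cong[OF assms(1) that]) (rule Suc.prems)
  qed (use Suc.prems in \<open>simp add: higher_differentiable_on_Suc_dir_deriv\<close>)
  ultimately show ?case by (simp add: higher_differentiable_on_Suc_dir_deriv)
qed

lemma higher_differentiable_on_Suc_imp: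
  "higher_differentiable_on S f (Suc k) \<Longrightarrow> higher_differentiable_on S f k"
proof (induction k arbitrary: f)
  case 0
  then show ?case
    unfolding higher_differentiable_on_Suc_dir_deriv
    by (auto intro!: continuous_at_imp_continuous_on differentiable_imp_continuous_within)
next
  case (Suc k)
  from Suc.prems have "f differentiable at u" if "u \<in> S" for u
    using that by (simp only: higher_differentiable_on_Suc_dir_deriv[of S f "Suc k"])
  moreover from Suc.prems have "higher_differentiable_on S (dir_deriv v f) (Suc k)" for v
    by (simp only: higher_differentiable_on_Suc_dir_deriv[of S f "Suc k"])
  then have "higher_differentiable_on S (dir_deriv v f) k" for v
    by (rule Suc.IH)
  ultimately show ?case unfolding higher_differentiable_on_Suc_dir_deriv[of S f k] by blast
qed

lemma smooth_on_imp_higher: "smooth_on S f \<Longrightarrow> higher_differentiable_on S f k"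
  by (simp add: smooth_on_def)

lemma smooth_on_differentiable: "smooth_on S f \<Longrightarrow> u \<in> S \<Longrightarrow> f differentiable (at u)"
  using smooth_on_imp_higher[of S f "Suc 0"]
  by (auto simp only: higher_differentiable_on_Suc_dir_deriv[of S f 0])

lemma smooth_on_continuous: "smooth_on S f \<Longrightarrow> continuous_on S f"
  using smooth_on_imp_higher[of S f 0] by simp

lemma smooth_on_dir_deriv:
  assumes "smooth_on S f"
  shows "smooth_on S (dir_deriv v f)"
  unfolding smooth_on_def
proof
  show "higher_differentiable_on S (dir_deriv v f) k" for k
    using smooth_on_imp_higher[OF assms, of "Suc k"]
    by (simp only: higher_differentiable_on_Suc_dir_deriv[of S f k])
qed

lemma smooth_on_has_derivative:
  "smooth_on S f \<Longrightarrow> u \<in> S \<Longrightarrow> (f has_derivative (\<lambda>v. dir_deriv v f u)) (at u)"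
  by (simp add: has_derivative_dir_deriv smooth_on_differentiable)

lemma smooth_on_cong:
  "open S \<Longrightarrow> (\<And>x. x \<in> S \<Longrightarrow> f x = g x) \<Longrightarrow> smooth_on S f \<Longrightarrow> smooth_on S g"
  unfolding smooth_on_def by (metis higher_differentiable_on_cong)

lemma higher_differentiable_on_subset:
  "higher_differentiable_on S f k \<Longrightarrow> T \<subseteq> S \<Longrightarrow> higher_differentiable_on T f k"
proof (induction k arbitrary: f)
  case 0
  then show ?case using continuous_on_subset by auto
next
  case (Suc k)
  then show ?case by (auto simp: higher_differentiable_on_Suc_dir_deriv)
qed

lemma smooth_on_subset: "smooth_on S f \<Longrightarrow> T \<subseteq> S \<Longrightarrow> smooth_on T f"
  by (auto simp: smooth_on_def intro: higher_differentiable_on_subset[of S f _ T])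

section \<open>Stability of smoothness under algebraic operations\<close>

lemma higher_differentiable_on_const: "higher_differentiable_on S (\<lambda>_. c) k"
proof (induction k arbitrary: c)
  case (Suc k)
  have "dir_deriv v (\<lambda>_. c) = (\<lambda>_. 0)" for v :: 'a
    by (auto intro!: dir_deriv_eqI)
  then show ?case using Suc by (simp add: higher_differentiable_on_Suc_dir_deriv)
qed simp

lemma smooth_on_const [simp]: "smooth_on S (\<lambda>_. c)"
  by (simp add: smooth_on_def higher_differentiable_on_const)

lemma dir_deriv_linear:
  assumes "bounded_linear L" "f differentiable (at u)"
  shows "dir_deriv v (\<lambda>x. L (f x)) u = L (dir_deriv v f u)"
  by (rule dir_deriv_eqI)
    (rule bounded_linear.has_derivative[OF assms(1) has_derivative_dir_deriv[OF assms(2)]])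

lemma higher_differentiable_on_linear:
  assumes "open S" "bounded_linear L" "higher_differentiable_on S f k"
  shows "higher_differentiable_on S (\<lambda>x. L (f x)) k"
  using assms(3)
proof (induction k arbitrary: f)
  case 0
  then show ?case by (simp add: bounded_linear.continuous_on[OF assms(2)])
next
  case (Suc k)
  have *: "higher_differentiable_on S (dir_deriv v (\<lambda>x. L (f x))) k" for v
  proof (rule higher_differentiable_on_cong[OF assms(1)])
    show "higher_differentiable_on S (\<lambda>x. L (dir_deriv v f x)) k"
      using Suc by (simp add: higher_differentiable_on_Suc_dir_deriv)
    show "L (dir_deriv v f x) = dir_deriv v (\<lambda>x. L (f x)) x" if "x \<in> S" for x
      using Suc.prems that dir_deriv_linear[OF assms(2), of f]
      by (auto simp: higher_differentiable_on_Suc_dir_deriv)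
  qed
  have "(\<lambda>x. L (f x)) differentiable at u" if "u \<in> S" for u
    using Suc.prems that bounded_linear.has_derivative[OF assms(2)]
    unfolding higher_differentiable_on_Suc_dir_deriv differentiable_def by blast
  with * show ?case by (simp add: higher_differentiable_on_Suc_dir_deriv)
qed

lemma smooth_on_linear:
  "open S \<Longrightarrow> bounded_linear L \<Longrightarrow> smooth_on S f \<Longrightarrow> smooth_on S (\<lambda>x. L (f x))"
  by (simp add: smooth_on_def higher_differentiable_on_linear)

lemma dir_deriv_add:
  assumes "f differentiable (at u)" "g differentiable (at u)"
  shows "dir_deriv v (\<lambda>x. f x + g x) u = dir_deriv v f u + dir_deriv v g u"
  by (rule dir_deriv_eqI) (intro has_derivative_add has_derivative_dir_deriv assms)

lemma higher_differentiable_on_add: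
  assumes "open S" "higher_differentiable_on S f k" "higher_differentiable_on S g k"
  shows "higher_differentiable_on S (\<lambda>x. f x + g x) k"
  using assms(2,3)
proof (induction k arbitrary: f g)
  case 0
  then show ?case by (simp add: continuous_on_add)
next
  case (Suc k)
  have "higher_differentiable_on S (dir_deriv v (\<lambda>x. f x + g x)) k" for v
    by (rule higher_differentiable_on_cong[OF assms(1), of "\<lambda>x. dir_deriv v f x + dir_deriv v g x"])
      (use Suc in \<open>auto simp: higher_differentiable_on_Suc_dir_deriv dir_deriv_add\<close>)
  then show ?case
    using Suc.prems by (auto simp: higher_differentiable_on_Suc_dir_deriv)
qed

lemma smooth_on_add:
  "open S \<Longrightarrow> smooth_on S f \<Longrightarrow> smooth_on S g \<Longrightarrow> smooth_on S (\<lambda>x. f x + g x)"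
  by (simp add: smooth_on_def higher_differentiable_on_add)

lemma dir_deriv_bilinear:
  assumes "bounded_bilinear pr" "f differentiable (at u)" "g differentiable (at u)"
  shows "dir_deriv v (\<lambda>x. pr (f x) (g x)) u = pr (f u) (dir_deriv v g u) + pr (dir_deriv v f u) (g u)"
  by (rule dir_deriv_eqI)
    (rule bounded_bilinear.FDERIV[OF assms(1) has_derivative_dir_deriv[OF assms(2)]
      has_derivative_dir_deriv[OF assms(3)]])

text \<open>By the Leibniz rule the derivative is a sum of two products of the same kind, one order
  lower, so the induction runs over all \<open>f\<close> and \<open>g\<close>. Multiplication,
  scaling and the inner product are covered at once.\<close>

lemma higher_differentiable_on_bilinear:
  assumes "open S" "bounded_bilinear pr"
    "higher_differentiable_on S f k" "higher_differentiable_on S g k"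
  shows "higher_differentiable_on S (\<lambda>x. pr (f x) (g x)) k"
  using assms(3,4)
proof (induction k arbitrary: f g)
  case 0
  then show ?case by (simp add: bounded_bilinear.continuous_on[OF assms(2)])
next
  case (Suc k)
  note lower = Suc.prems[THEN higher_differentiable_on_Suc_imp]
  have *: "higher_differentiable_on S (dir_deriv v (\<lambda>x. pr (f x) (g x))) k" for v
  proof (rule higher_differentiable_on_cong[OF assms(1)])
    show "higher_differentiable_on S
        (\<lambda>x. pr (f x) (dir_deriv v g x) + pr (dir_deriv v f x) (g x)) k"
      using Suc.prems lower
      by (intro higher_differentiable_on_add[OF assms(1)] Suc.IH)
        (auto simp: higher_differentiable_on_Suc_dir_deriv)
    show "pr (f x) (dir_deriv v g x) + pr (dir_deriv v f x) (g x)
        = dir_deriv v (\<lambda>x. pr (f x) (g x)) x" if "x \<in> S" for x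
      using Suc.prems that
      by (auto simp: higher_differentiable_on_Suc_dir_deriv dir_deriv_bilinear[OF assms(2)])
  qed
  have "(\<lambda>x. pr (f x) (g x)) differentiable at u" if "u \<in> S" for u
    using Suc.prems that bounded_bilinear.FDERIV[OF assms(2)]
    unfolding higher_differentiable_on_Suc_dir_deriv differentiable_def by blast
  with * show ?case by (simp add: higher_differentiable_on_Suc_dir_deriv)
qed

lemma smooth_on_bilinear:
  "open S \<Longrightarrow> bounded_bilinear pr \<Longrightarrow> smooth_on S f \<Longrightarrow> smooth_on S g
    \<Longrightarrow> smooth_on S (\<lambda>x. pr (f x) (g x))"
  by (simp add: smooth_on_def higher_differentiable_on_bilinear)

lemmas smooth_on_mult = smooth_on_bilinear[OF _ bounded_bilinear_mult]
lemmas smooth_on_scaleR = smooth_on_bilinear[OF _ bounded_bilinear_scaleR]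
lemmas smooth_on_inner = smooth_on_bilinear[OF _ bounded_bilinear_inner]
lemmas dir_deriv_mult = dir_deriv_bilinear[OF bounded_bilinear_mult]
lemmas dir_deriv_scaleR = dir_deriv_bilinear[OF bounded_bilinear_scaleR]
lemmas dir_deriv_inner = dir_deriv_bilinear[OF bounded_bilinear_inner]

lemma smooth_on_minus: "open S \<Longrightarrow> smooth_on S f \<Longrightarrow> smooth_on S (\<lambda>x. - f x)"
  by (rule smooth_on_linear[OF _ bounded_linear_minus[OF bounded_linear_ident]])

lemma smooth_on_diff:
  "open S \<Longrightarrow> smooth_on S f \<Longrightarrow> smooth_on S g \<Longrightarrow> smooth_on S (\<lambda>x. f x - g x)"
  using smooth_on_add[of S f "\<lambda>x. - g x"] smooth_on_minus[of S g] by simp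

lemma smooth_on_sum:
  assumes "open S" "\<And>i. i \<in> I \<Longrightarrow> smooth_on S (f i)"
  shows "smooth_on S (\<lambda>x. \<Sum>i\<in>I. f i x)"
  using assms(2) by (induction I rule: infinite_finite_induct) (auto intro: smooth_on_add assms(1))

lemma smooth_on_prod:
  fixes f :: "'i \<Rightarrow> 'a::real_normed_vector \<Rightarrow> real"
  assumes "open S" "\<And>i. i \<in> I \<Longrightarrow> smooth_on S (f i)"
  shows "smooth_on S (\<lambda>x. \<Prod>i\<in>I. f i x)"
  using assms(2) by (induction I rule: infinite_finite_induct) (auto intro: smooth_on_mult assms(1))

lemma smooth_on_component: "open S \<Longrightarrow> smooth_on S f \<Longrightarrow> smooth_on S (\<lambda>x. f x $ i)"
  by (rule smooth_on_linear[OF _ bounded_linear_vec_nth])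

lemma smooth_on_vec:
  fixes f :: "'n::finite \<Rightarrow> 'a::real_normed_vector \<Rightarrow> real"
  assumes "open S" "\<And>i. smooth_on S (f i)"
  shows "smooth_on S (\<lambda>x. \<chi> i. f i x)"
proof (rule smooth_on_cong[OF assms(1)])
  show "smooth_on S (\<lambda>x. \<Sum>i\<in>UNIV. f i x *\<^sub>R axis i 1)"
    by (intro smooth_on_sum smooth_on_scaleR assms smooth_on_const)
  show "(\<Sum>i\<in>UNIV. f i x *\<^sub>R axis i 1) = (\<chi> i. f i x)" for x
    by (simp add: vec_eq_iff axis_def if_distrib sum.If_cases cong: if_cong)
qed

lemma dir_deriv_comp_real:
  assumes "(\<phi> has_real_derivative d) (at (f u))" "f differentiable (at u)"
  shows "dir_deriv v (\<lambda>x. \<phi> (f x)) u = d * dir_deriv v f u"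
  by (rule dir_deriv_eqI)
    (rule DERIV_compose_FDERIV[OF assms(1) has_derivative_dir_deriv[OF assms(2)],
        unfolded mult.commute[of _ d]])

text \<open>The derivative \<open>- f' / f^2\<close> contains \<open>inverse f\<close> again, to
  which the induction hypothesis applies; only \<open>f'\<close> costs an order of
  differentiability.\<close>

lemma higher_differentiable_on_inverse:
  fixes f :: "'a::real_normed_vector \<Rightarrow> real"
  assumes "open S" "\<And>x. x \<in> S \<Longrightarrow> f x \<noteq> 0" "higher_differentiable_on S f k"
  shows "higher_differentiable_on S (\<lambda>x. inverse (f x)) k"
  using assms(3)
proof (induction k)
  case 0
  then show ?case using assms(2) by (simp add: continuous_on_inverse)
next
  case (Suc k)
  note lower = Suc.prems[THEN higher_differentiable_on_Suc_imp]
  have *: "higher_differentiable_on S (dir_deriv v (\<lambda>x. inverse (f x))) k" for v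
  proof (rule higher_differentiable_on_cong[OF assms(1)])
    show "higher_differentiable_on S (\<lambda>x. (-1) * (inverse (f x) * inverse (f x)) * dir_deriv v f x) k"
      using Suc.prems
      by (intro higher_differentiable_on_bilinear[OF assms(1) bounded_bilinear_mult]
          higher_differentiable_on_const Suc.IH lower)
        (auto simp: higher_differentiable_on_Suc_dir_deriv)
    show "(-1) * (inverse (f x) * inverse (f x)) * dir_deriv v f x
        = dir_deriv v (\<lambda>x. inverse (f x)) x" if "x \<in> S" for x
      using Suc.prems that assms(2)[OF that] dir_deriv_comp_real[OF DERIV_inverse, of f x v]
      by (auto simp: higher_differentiable_on_Suc_dir_deriv power2_eq_square)
  qed
  have "(\<lambda>x. inverse (f x)) differentiable at u" if "u \<in> S" for u
    using Suc.prems that assms(2)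
    by (auto simp: higher_differentiable_on_Suc_dir_deriv intro: differentiable_inverse)
  with * show ?case by (simp add: higher_differentiable_on_Suc_dir_deriv)
qed

lemma smooth_on_inverse:
  fixes f :: "'a::real_normed_vector \<Rightarrow> real"
  shows "open S \<Longrightarrow> (\<And>x. x \<in> S \<Longrightarrow> f x \<noteq> 0) \<Longrightarrow> smooth_on S f \<Longrightarrow> smooth_on S (\<lambda>x. inverse (f x))"
  by (simp add: smooth_on_def higher_differentiable_on_inverse)

lemma smooth_on_divide:
  fixes f g :: "'a::real_normed_vector \<Rightarrow> real"
  shows "open S \<Longrightarrow> smooth_on S f \<Longrightarrow> smooth_on S g \<Longrightarrow> (\<And>x. x \<in> S \<Longrightarrow> g x \<noteq> 0)
    \<Longrightarrow> smooth_on S (\<lambda>x. f x / g x)"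
  unfolding divide_inverse by (intro smooth_on_mult smooth_on_inverse)

lemma smooth_on_sqrt:
  fixes f :: "'a::real_normed_vector \<Rightarrow> real"
  assumes "open S" "\<And>x. x \<in> S \<Longrightarrow> f x > 0" "smooth_on S f"
  shows "smooth_on S (\<lambda>x. sqrt (f x))"
proof -
  have d: "(sqrt has_real_derivative inverse (sqrt (f x)) / 2) (at (f x))" if "x \<in> S" for x
    using assms(2)[OF that] by (rule DERIV_real_sqrt)
  have "higher_differentiable_on S (\<lambda>x. sqrt (f x)) k" for k
  proof (induction k)
    case 0
    then show ?case using assms(3) by (simp add: smooth_on_continuous continuous_on_real_sqrt)
  next
    case (Suc k)
    have *: "higher_differentiable_on S (dir_deriv v (\<lambda>x. sqrt (f x))) k" for v
    proof (rule higher_differentiable_on_cong[OF assms(1)])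
      show "higher_differentiable_on S (\<lambda>x. (1/2) * inverse (sqrt (f x)) * dir_deriv v f x) k"
        using assms(2)
        by (intro higher_differentiable_on_bilinear[OF assms(1) bounded_bilinear_mult]
            higher_differentiable_on_const higher_differentiable_on_inverse assms Suc.IH
            smooth_on_imp_higher smooth_on_dir_deriv) force
      show "(1/2) * inverse (sqrt (f x)) * dir_deriv v f x = dir_deriv v (\<lambda>x. sqrt (f x)) x"
        if "x \<in> S" for x
        using dir_deriv_comp_real[OF d[OF that] smooth_on_differentiable[OF assms(3) that]] by simp
    qed
    have "(\<lambda>x. sqrt (f x)) differentiable at u" if "u \<in> S" for u
      using DERIV_compose_FDERIV[OF d[OF that] smooth_on_has_derivative[OF assms(3) that]]
      unfolding differentiable_def by blast
    with * show ?case by (simp add: higher_differentiable_on_Suc_dir_deriv)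
  qed
  then show ?thesis by (simp add: smooth_on_def)
qed

lemma smooth_on_det:
  fixes M :: "'a::real_normed_vector \<Rightarrow> real ^ 'n ^ 'n::finite"
  assumes "open S" "\<And>i j. smooth_on S (\<lambda>x. M x $ i $ j)"
  shows "smooth_on S (\<lambda>x. det (M x))"
  unfolding det_def
  by (intro smooth_on_sum smooth_on_mult smooth_on_prod assms smooth_on_const)

lemma matrix_mul_matrix_inv:
  fixes A :: "real ^ 'n ^ 'n::finite"
  assumes "invertible A"
  shows "A ** matrix_inv A = mat 1" "matrix_inv A ** A = mat 1"
  using someI_ex[OF assms[unfolded invertible_def]] unfolding matrix_inv_def by auto

text \<open>Cramer's rule: an entry of the inverse is a quotient of two determinants, the numerator
  being that of \<open>C x\<close>, where column \<open>i\<close> is replaced by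
  \<open>axis j 1\<close>.\<close>

lemma smooth_on_matrix_inv:
  fixes M :: "'a::real_normed_vector \<Rightarrow> real ^ 'n ^ 'n::finite"
  assumes "open S" "\<And>i j. smooth_on S (\<lambda>x. M x $ i $ j)" "\<And>x. x \<in> S \<Longrightarrow> det (M x) \<noteq> 0"
  shows "smooth_on S (\<lambda>x. matrix_inv (M x) $ i $ j)"
proof (rule smooth_on_cong[OF assms(1)])
  define C where "C x = (\<chi> k l. if l = i then axis j 1 $ k else M x $ k $ l)" for x
  show "smooth_on S (\<lambda>x. det (C x) / det (M x))"
    unfolding C_def
  proof (intro smooth_on_divide smooth_on_det assms)
    show "smooth_on S (\<lambda>x. (\<chi> k l. if l = i then axis j 1 $ k else M x $ k $ l) $ r $ c)" for r c
      using assms(2) by (cases "c = i") auto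
  qed
  fix x assume x: "x \<in> S"
  have "M x *v (matrix_inv (M x) *v axis j 1) = axis j 1"
    using assms(3)[OF x]
    by (simp add: invertible_det_nz matrix_vector_mul_assoc matrix_mul_matrix_inv)
  then have "matrix_inv (M x) *v axis j 1
      = (\<chi> k. det (\<chi> r c. if c = k then axis j 1 $ r else M x $ r $ c) / det (M x))"
    by (simp only: cramer[OF assms(3)[OF x]])
  from arg_cong[OF this, of "\<lambda>y. y $ i"]
  show "det (C x) / det (M x) = matrix_inv (M x) $ i $ j"
    by (simp add: C_def matrix_vector_mult_basis column_def)
qed

section \<open>Symmetry of mixed derivatives\<close>

lemma dir_deriv_increment:
  fixes f :: "'a::real_normed_vector \<Rightarrow> real"
  assumes "0 < t" "\<And>s. 0 \<le> s \<Longrightarrow> s \<le> t \<Longrightarrow> f differentiable (at (u + s *\<^sub>R x))"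
  obtains s where "0 < s" "s < t" "f (u + t *\<^sub>R x) - f u = t * dir_deriv x f (u + s *\<^sub>R x)"
proof -
  have d: "((\<lambda>s. f (u + s *\<^sub>R x)) has_real_derivative dir_deriv x f (u + s *\<^sub>R x)) (at s)"
    if "0 \<le> s" "s \<le> t" for s
  proof -
    have "((\<lambda>s. f (u + s *\<^sub>R x)) has_derivative (\<lambda>h. dir_deriv (h *\<^sub>R x) f (u + s *\<^sub>R x))) (at s)"
      by (rule has_derivative_compose[of "\<lambda>s. u + s *\<^sub>R x" "\<lambda>h. h *\<^sub>R x" s UNIV f])
        (auto intro!: derivative_eq_intros has_derivative_dir_deriv assms(2) that)
    then show ?thesis
      by (simp add: has_field_derivative_def mult.commute
          linear_cmul[OF linear_dir_deriv[OF assms(2)[OF that]]] mult_commute_abs)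
  qed
  have "\<exists>s>0. s < t \<and> f (u + t *\<^sub>R x) - f (u + 0 *\<^sub>R x) = (t - 0) * dir_deriv x f (u + s *\<^sub>R x)"
    by (rule MVT2[OF assms(1) d])
  then show thesis using that by auto
qed

text \<open>The second difference of \<open>f\<close> over the parallelogram with sides
  \<open>t x\<close> and \<open>t y\<close> is symmetric in \<open>x\<close> and \<open>y\<close>.
  Two applications of the mean value theorem turn it into \<open>t^2\<close> times either mixed
  derivative at a nearby point, and continuity identifies both values at \<open>u\<close>.\<close>

lemma dir_deriv_commute_real:
  fixes f :: "'a::real_normed_vector \<Rightarrow> real"
  assumes S: "open S" "u \<in> S" and f: "smooth_on S f"
  shows "dir_deriv x (dir_deriv y f) u = dir_deriv y (dir_deriv x f) u"
proof -
  have second: "\<exists>a b. 0 < a \<and> a < t \<and> 0 < b \<and> b < t \<and>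
      f (u + t *\<^sub>R x + t *\<^sub>R y) - f (u + t *\<^sub>R x) - f (u + t *\<^sub>R y) + f u
        = t * (t * dir_deriv y (dir_deriv x f) (u + a *\<^sub>R x + b *\<^sub>R y))"
    if t: "0 < t" and in_S: "\<And>a b. 0 \<le> a \<Longrightarrow> a \<le> t \<Longrightarrow> 0 \<le> b \<Longrightarrow> b \<le> t \<Longrightarrow> u + a *\<^sub>R x + b *\<^sub>R y \<in> S"
    for t x y
  proof -
    have shift: "dir_deriv x (\<lambda>z. f (z + t *\<^sub>R y) - f z) z = dir_deriv x f (z + t *\<^sub>R y) - dir_deriv x f z \<and>
        (\<lambda>z. f (z + t *\<^sub>R y) - f z) differentiable (at z)"
      if "z \<in> S" "z + t *\<^sub>R y \<in> S" for z
    proof -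
      have "((\<lambda>z. f (z + t *\<^sub>R y)) has_derivative (\<lambda>v. dir_deriv v f (z + t *\<^sub>R y))) (at z)"
        by (rule has_derivative_compose[of "\<lambda>z. z + t *\<^sub>R y" "\<lambda>v. v" z UNIV f])
          (auto intro!: derivative_eq_intros smooth_on_has_derivative[OF f] that)
      from has_derivative_diff[OF this smooth_on_has_derivative[OF f that(1)]]
      show ?thesis
        by (auto simp: differentiable_def intro: dir_deriv_eqI)
    qed
    obtain a where a: "0 < a" "a < t"
      "f (u + t *\<^sub>R x + t *\<^sub>R y) - f (u + t *\<^sub>R x) - (f (u + t *\<^sub>R y) - f u)
        = t * dir_deriv x (\<lambda>z. f (z + t *\<^sub>R y) - f z) (u + a *\<^sub>R x)"
      by (rule dir_deriv_increment[OF t, of "\<lambda>z. f (z + t *\<^sub>R y) - f z" u x])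
        (use shift in_S[of _ 0] in_S[of _ t] t in auto)
    have "dir_deriv x f differentiable (at (u + a *\<^sub>R x + s *\<^sub>R y))" if "0 \<le> s" "s \<le> t" for s
      using that a in_S[of a s] smooth_on_differentiable[OF smooth_on_dir_deriv[OF f]] by simp
    then obtain b where "0 < b" "b < t"
      "dir_deriv x f (u + a *\<^sub>R x + t *\<^sub>R y) - dir_deriv x f (u + a *\<^sub>R x)
        = t * dir_deriv y (dir_deriv x f) (u + a *\<^sub>R x + b *\<^sub>R y)"
      using dir_deriv_increment[OF t, of "dir_deriv x f" "u + a *\<^sub>R x" y] by blast
    then show ?thesis
      using a shift[of "u + a *\<^sub>R x"] in_S[of a 0] in_S[of a t] t
      by (intro exI[of _ a] exI[of _ b]) auto
  qed
  obtain r where r: "0 < r" "ball u r \<subseteq> S" using S open_contains_ball by blast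
  let ?G = "dir_deriv x (dir_deriv y f)" and ?H = "dir_deriv y (dir_deriv x f)"
  have near: "\<exists>p q. dist p u \<le> e \<and> dist q u \<le> e \<and> ?G p = ?H q" if e: "0 < e" "e < r" for e
  proof -
    \<comment> \<open>The scaling keeps the whole parallelogram within distance \<open>e\<close> of
      \<open>u\<close>; the summand 1 covers the case that both directions vanish.\<close>
    define t where "t = e / (norm x + norm y + 1)"
    have pos: "norm x + norm y + 1 > 0" by (smt (verit) norm_ge_zero)
    have t: "t > 0" using pos e by (simp add: t_def)
    have tn: "t * (norm x + norm y) \<le> e"
      using pos e t by (simp add: t_def field_simps)
    have d: "dist (u + a *\<^sub>R x + b *\<^sub>R y) u \<le> e" if "0 \<le> a" "a \<le> t" "0 \<le> b" "b \<le> t" for a b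
    proof -
      have "dist (u + a *\<^sub>R x + b *\<^sub>R y) u \<le> a * norm x + b * norm y"
        using norm_triangle_ineq[of "a *\<^sub>R x" "b *\<^sub>R y"] that
        by (simp add: dist_norm algebra_simps)
      also have "\<dots> \<le> t * norm x + t * norm y"
        using that by (intro add_mono mult_right_mono) auto
      finally show ?thesis using tn by (simp add: algebra_simps)
    qed
    have in_S: "u + a *\<^sub>R x + b *\<^sub>R y \<in> S" if "0 \<le> a" "a \<le> t" "0 \<le> b" "b \<le> t" for a b
      using d[OF that] e r by (auto simp: dist_commute)
    have in_S': "u + a *\<^sub>R y + b *\<^sub>R x \<in> S" if "0 \<le> a" "a \<le> t" "0 \<le> b" "b \<le> t" for a b
      using in_S[of b a] that by (simp add: algebra_simps)
    obtain a b where ab: "0 < a" "a < t" "0 < b" "b < t"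
      "f (u + t *\<^sub>R x + t *\<^sub>R y) - f (u + t *\<^sub>R x) - f (u + t *\<^sub>R y) + f u
        = t * (t * ?H (u + a *\<^sub>R x + b *\<^sub>R y))"
      using second[of t x y] t in_S by blast
    obtain a' b' where ab': "0 < a'" "a' < t" "0 < b'" "b' < t"
      "f (u + t *\<^sub>R y + t *\<^sub>R x) - f (u + t *\<^sub>R y) - f (u + t *\<^sub>R x) + f u
        = t * (t * ?G (u + a' *\<^sub>R y + b' *\<^sub>R x))"
      using second[of t y x] t in_S' by blast
    have "?G (u + b' *\<^sub>R x + a' *\<^sub>R y) = ?H (u + a *\<^sub>R x + b *\<^sub>R y)"
      using ab(5) ab'(5) t by (simp add: algebra_simps)
    then show ?thesis
      using d[of a b] d[of b' a'] ab ab' less_imp_le by blast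
  qed
  show ?thesis
  proof (rule ccontr)
    assume ne: "?G u \<noteq> ?H u"
    define \<epsilon> where "\<epsilon> = dist (?G u) (?H u) / 2"
    have \<epsilon>: "\<epsilon> > 0" using ne by (simp add: \<epsilon>_def)
    have "isCont ?G u" "isCont ?H u"
      using S smooth_on_continuous[OF smooth_on_dir_deriv[OF smooth_on_dir_deriv[OF f]]]
        continuous_on_eq_continuous_at by blast+
    then have "\<exists>d>0. \<forall>p. dist p u < d \<longrightarrow> dist (?G p) (?G u) < \<epsilon>"
      "\<exists>d>0. \<forall>p. dist p u < d \<longrightarrow> dist (?H p) (?H u) < \<epsilon>"
      using \<epsilon> unfolding continuous_at_eps_delta by blast+
    then obtain d1 d2 where d: "d1 > 0" "\<And>p. dist p u < d1 \<Longrightarrow> dist (?G p) (?G u) < \<epsilon>"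
      "d2 > 0" "\<And>p. dist p u < d2 \<Longrightarrow> dist (?H p) (?H u) < \<epsilon>"
      by blast
    define e where "e = min (r/2) (min (d1/2) (d2/2))"
    have e: "0 < e" "e < r" "e < d1" "e < d2" using d r by (auto simp: e_def)
    obtain p q where "dist p u \<le> e" "dist q u \<le> e" "?G p = ?H q"
      using near[OF e(1,2)] by blast
    with e have "dist (?G p) (?G u) < \<epsilon>" "dist (?H q) (?H u) < \<epsilon>"
      using d(2)[of p] d(4)[of q] by linarith+
    then show False
      using \<open>?G p = ?H q\<close> dist_triangle[of "?G u" "?H u" "?G p"] unfolding \<epsilon>_def
      by (simp add: dist_commute)
  qed
qed

lemma dir_deriv_commute:
  fixes f :: "'a::real_normed_vector \<Rightarrow> 'b::real_inner"
  assumes S: "open S" "u \<in> S" and f: "smooth_on S f"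
  shows "dir_deriv x (dir_deriv y f) u = dir_deriv y (dir_deriv x f) u"
proof (rule vector_eq_rdot[THEN iffD1], intro allI)
  fix w
  let ?f = "\<lambda>z. f z \<bullet> w"
  have bl: "bounded_linear (\<lambda>z::'b. z \<bullet> w)" by (rule bounded_linear_inner_left)
  have one: "dir_deriv v (\<lambda>z. g z \<bullet> w) z = dir_deriv v g z \<bullet> w" if "smooth_on S g" "z \<in> S" for v g z
    by (rule dir_deriv_linear[OF bl smooth_on_differentiable[OF that]])
  have two: "dir_deriv v (dir_deriv v' ?f) u = dir_deriv v (dir_deriv v' f) u \<bullet> w" for v v'
    using dir_deriv_cong[OF S, of "dir_deriv v' ?f" "\<lambda>z. dir_deriv v' f z \<bullet> w" v]
      one[OF f] one[OF smooth_on_dir_deriv[OF f] S(2)] by simp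
  show "dir_deriv x (dir_deriv y f) u \<bullet> w = dir_deriv y (dir_deriv x f) u \<bullet> w"
    using dir_deriv_commute_real[OF S smooth_on_linear[OF S(1) bl f], of x y] by (simp add: two)
qed

subsection \<open>Immersed hypersurface patches\<close>

lemma range_eq_orthogonal_complement:
  fixes L :: "real ^ 3 \<Rightarrow> real ^ 4"
  assumes "linear L" "inj L" "n \<noteq> 0" "\<And>v. n \<bullet> L v = 0"
  shows "range L = {w. n \<bullet> w = 0}"
proof (rule subspace_dim_equal)
  show "subspace (range L)" using assms(1) by (rule linear_subspace_image) simp
  show "subspace {w. n \<bullet> w = 0}" by (rule subspace_hyperplane)
  show "range L \<subseteq> {w. n \<bullet> w = 0}" using assms(4) by auto
  have "dim (range L) = dim (UNIV :: (real ^ 3) set)"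
    using assms by (intro dim_image_eq) auto
  then show "dim (range L) \<ge> dim {w. n \<bullet> w = 0}"
    using dim_hyperplane[OF assms(3)] by simp
qed

text \<open>The difference \<open>w - w'\<close> is orthogonal to \<open>n\<close>, so by the
  dimension count it has the form \<open>L v\<close>, and then it is orthogonal to itself. Ambient
  vectors are compared below by this criterion, through their tangential and normal parts.\<close>

lemma hyperplane_ext:
  fixes L :: "real ^ 3 \<Rightarrow> real ^ 4"
  assumes "linear L" "inj L" "norm n = 1" "\<And>v. n \<bullet> L v = 0"
    and "\<And>v. w \<bullet> L v = w' \<bullet> L v" "w \<bullet> n = w' \<bullet> n"
  shows "w = w'"
proof -
  have "n \<bullet> (w - w') = 0" using assms(6) by (simp add: inner_diff_right inner_commute)
  moreover have "n \<noteq> 0" using assms(3) by auto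
  ultimately obtain v where v: "w - w' = L v"
    using range_eq_orthogonal_complement[OF assms(1,2) _ assms(4)] by blast
  have "(w - w') \<bullet> L v = 0" using assms(5) by (simp add: inner_diff_left)
  then show ?thesis using v by simp
qed

lemma unit_normal_exists:
  fixes L :: "real ^ 3 \<Rightarrow> real ^ 4"
  assumes "linear L"
  shows "\<exists>n. norm n = 1 \<and> (\<forall>v. n \<bullet> L v = 0)"
proof -
  have "dim (range L) \<le> dim (UNIV :: (real ^ 3) set)" using assms by (rule dim_image_le)
  then have "dim (range L) < DIM(real ^ 4)" by simp
  then obtain n where n: "n \<noteq> 0" "\<And>y. y \<in> span (range L) \<Longrightarrow> orthogonal n y"
    using orthogonal_to_subspace_exists by blast
  have "norm (n /\<^sub>R norm n) = 1" "(n /\<^sub>R norm n) \<bullet> L v = 0" for v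
    using n(1) n(2)[of "L v"] by (auto simp: orthogonal_def span_base)
  then show ?thesis by blast
qed

text \<open>Testing \<open>i = 4\<close> first gives the matrix the form of one replaced row among
  fixed rows, in which the determinant is linear in that row.\<close>

definition rows4 :: "real ^ 4 \<Rightarrow> real ^ 4 \<Rightarrow> real ^ 4 \<Rightarrow> real ^ 4 \<Rightarrow> real ^ 4 ^ 4" where
  "rows4 a b c d = (\<chi> i. if i = 4 then d else if i = 1 then a else if i = 2 then b else c)"

lemma rows4_nth [simp]:
  "rows4 a b c d $ 1 = a" "rows4 a b c d $ 2 = b" "rows4 a b c d $ 3 = c" "rows4 a b c d $ 4 = d"
  by (simp_all add: rows4_def)

text \<open>The triple cross product of four-space. Being polynomial in its arguments, it yields a
  normal field that inherits smoothness from the tangent vectors.\<close>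

definition cross4 :: "real ^ 4 \<Rightarrow> real ^ 4 \<Rightarrow> real ^ 4 \<Rightarrow> real ^ 4" where
  "cross4 a b c = (\<chi> j. det (rows4 a b c (axis j 1)))"

lemma cross4_inner: "cross4 a b c \<bullet> d = det (rows4 a b c d)"
proof -
  let ?c = "\<lambda>i::4. if i = 1 then a else if i = 2 then b else c"
  have "det (rows4 a b c d) = det (\<chi> i. if i = 4 then (\<Sum>j\<in>UNIV. d $ j *s axis j 1) else ?c i)"
    unfolding rows4_def basis_expansion ..
  also have "\<dots> = (\<Sum>j\<in>UNIV. d $ j * det (\<chi> i. if i = 4 then axis j 1 else ?c i))"
    by (simp add: det_linear_row_sum det_row_mul)
  finally show ?thesis
    by (simp add: cross4_def inner_vec_def rows4_def mult.commute)
qed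

text \<open>A kernel vector of the matrix is orthogonal to \<open>n\<close> and to a spanning set of
  the range of \<open>L\<close>, so it vanishes by \<open>hyperplane_ext\<close>.\<close>

lemma det_rows4_nonzero:
  fixes L :: "real ^ 3 \<Rightarrow> real ^ 4"
  assumes "linear L" "inj L" "norm n = 1" "\<And>v. n \<bullet> L v = 0"
  shows "det (rows4 (L (axis 1 1)) (L (axis 2 1)) (L (axis 3 1)) n) \<noteq> 0"
proof -
  let ?M = "rows4 (L (axis 1 1)) (L (axis 2 1)) (L (axis 3 1)) n"
  have "x = 0" if "?M *v x = 0" for x
  proof (rule hyperplane_ext[OF assms])
    have "(?M *v x) $ i = 0" for i using that by simp
    then have e: "?M $ i \<bullet> x = 0" for i by (simp add: matrix_vector_mul_component)
    from e[of 4] show "x \<bullet> n = 0 \<bullet> n" by (simp add: inner_commute)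
    have a: "x \<bullet> L (axis i 1) = 0" for i
      using e[of 1] e[of 2] e[of 3] exhaust_3[of i] by (auto simp: inner_commute)
    show "x \<bullet> L v = 0 \<bullet> L v" for v
    proof -
      have "L v = L (\<Sum>i\<in>UNIV. v $ i *\<^sub>R axis i 1)"
        using basis_expansion[of v] by (simp add: scalar_mult_eq_scaleR)
      also have "\<dots> = (\<Sum>i\<in>UNIV. v $ i *\<^sub>R L (axis i 1))"
        using assms(1) by (simp add: linear_sum linear_cmul)
      finally show ?thesis by (simp add: inner_sum_right a)
    qed
  qed
  then show ?thesis
    by (metis invertible_det_nz invertible_left_inverse matrix_left_invertible_ker)
qed

lemma linear_expand_axis:
  fixes L :: "real ^ 'n::finite \<Rightarrow> 'b::real_vector"
  assumes "linear L"
  shows "L v = (\<Sum>i\<in>UNIV. v $ i *\<^sub>R L (axis i 1))"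
proof -
  have "L v = L (\<Sum>i\<in>UNIV. v $ i *\<^sub>R axis i 1)"
    using basis_expansion[of v] by (simp add: scalar_mult_eq_scaleR)
  also have "\<dots> = (\<Sum>i\<in>UNIV. v $ i *\<^sub>R L (axis i 1))"
    using assms by (simp add: linear_sum linear_cmul)
  finally show ?thesis .
qed

section \<open>Unit normal and second fundamental form of a patch\<close>

locale hypersurface_patch =
  fixes S :: "(real ^ 3) set" and F :: "real ^ 3 \<Rightarrow> real ^ 4"
  assumes open_S: "open S"
    and smooth_F: "smooth_on S F"
    and inj_F: "u \<in> S \<Longrightarrow> inj (\<lambda>v. dir_deriv v F u)"
begin

text \<open>\<open>unit_normal\<close> is chosen separately at each point and may jump between the
  two sides. The normalised cross product fixes the side coherently over the patch and can be
  differentiated.\<close>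

definition normal :: "real ^ 3 \<Rightarrow> real ^ 4" where
  "normal u = (let n = cross4 (dir_deriv (axis 1 1) F u) (dir_deriv (axis 2 1) F u)
      (dir_deriv (axis 3 1) F u) in inverse (sqrt (n \<bullet> n)) *\<^sub>R n)"

definition sff :: "real ^ 3 \<Rightarrow> real ^ 3 \<Rightarrow> real ^ 3 \<Rightarrow> real" where
  "sff u x y = dir_deriv x (dir_deriv y F) u \<bullet> normal u"

abbreviation met :: "real ^ 3 \<Rightarrow> real ^ 3 \<Rightarrow> real ^ 3 \<Rightarrow> real" where
  "met u x y \<equiv> dir_deriv x F u \<bullet> dir_deriv y F u"

lemma smooth_dF: "smooth_on S (dir_deriv x F)"
  by (rule smooth_on_dir_deriv[OF smooth_F])

lemma smooth_ddF: "smooth_on S (dir_deriv x (dir_deriv y F))"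
  by (rule smooth_on_dir_deriv[OF smooth_dF])

lemma linear_dF: "u \<in> S \<Longrightarrow> linear (\<lambda>v. dir_deriv v F u)"
  by (rule linear_dir_deriv[OF smooth_on_differentiable[OF smooth_F]])

lemma cross_nonzero:
  assumes "u \<in> S"
  shows "cross4 (dir_deriv (axis 1 1) F u) (dir_deriv (axis 2 1) F u) (dir_deriv (axis 3 1) F u) \<noteq> 0"
proof -
  obtain n where n: "norm n = 1" "\<And>v. n \<bullet> dir_deriv v F u = 0"
    using unit_normal_exists[OF linear_dF[OF assms]] by blast
  show ?thesis
    using det_rows4_nonzero[OF linear_dF[OF assms] inj_F[OF assms] n]
    by (auto simp flip: cross4_inner)
qed

lemma smooth_normal: "smooth_on S normal"
proof -
  have s: "smooth_on S (\<lambda>u. cross4 (dir_deriv (axis 1 1) F u) (dir_deriv (axis 2 1) F u)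
      (dir_deriv (axis 3 1) F u))"
    unfolding cross4_def
  proof (intro smooth_on_vec smooth_on_det open_S)
    fix i j k :: 4
    show "smooth_on S (\<lambda>x. rows4 (dir_deriv (axis 1 1) F x) (dir_deriv (axis 2 1) F x)
        (dir_deriv (axis 3 1) F x) (axis i 1) $ j $ k)"
      using exhaust_4[of j] by (auto intro: smooth_on_component[OF open_S smooth_dF])
  qed
  show ?thesis
    unfolding normal_def[abs_def] Let_def
    by (intro smooth_on_scaleR smooth_on_inverse smooth_on_sqrt smooth_on_inner s open_S)
      (auto simp: cross_nonzero)
qed

lemma normal_orthogonal:
  assumes "u \<in> S"
  shows "normal u \<bullet> dir_deriv v F u = 0" "dir_deriv v F u \<bullet> normal u = 0"
proof -
  have eq: "det (rows4 a b c a) = 0" "det (rows4 a b c b) = 0" "det (rows4 a b c c) = 0" for a b c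
    by (rule det_identical_rows[of 1 4] det_identical_rows[of 2 4] det_identical_rows[of 3 4];
        simp add: row_def)+
  have "normal u \<bullet> dir_deriv (axis i 1) F u = 0" for i
    using exhaust_3[of i] by (auto simp: normal_def Let_def cross4_inner eq)
  then show "normal u \<bullet> dir_deriv v F u = 0"
    by (subst linear_expand_axis[OF linear_dF[OF assms]]) (simp add: inner_sum_right)
  then show "dir_deriv v F u \<bullet> normal u = 0" by (simp add: inner_commute)
qed

lemma norm_normal: "u \<in> S \<Longrightarrow> norm (normal u) = 1"
  using cross_nonzero[of u] by (simp add: normal_def Let_def flip: norm_eq_sqrt_inner)

lemma normal_normal: "u \<in> S \<Longrightarrow> normal u \<bullet> normal u = 1"
  using norm_normal[of u] by (simp add: norm_eq_1)

lemma tangent_range: "u \<in> S \<Longrightarrow> range (\<lambda>v. dir_deriv v F u) = {w. normal u \<bullet> w = 0}"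
  using norm_normal[of u]
  by (intro range_eq_orthogonal_complement linear_dF inj_F normal_orthogonal) auto

lemma tangentE:
  assumes "u \<in> S" "normal u \<bullet> w = 0"
  obtains v where "w = dir_deriv v F u"
  using tangent_range[OF assms(1)] assms(2) by blast

lemma frame_ext:
  assumes "u \<in> S" "\<And>v. w \<bullet> dir_deriv v F u = w' \<bullet> dir_deriv v F u" "w \<bullet> normal u = w' \<bullet> normal u"
  shows "w = w'"
  using assms by (intro hyperplane_ext[OF linear_dF inj_F norm_normal normal_orthogonal(1)]) auto

lemma frame_ext_axis:
  assumes "u \<in> S" "\<And>i. w \<bullet> dir_deriv (axis i 1) F u = w' \<bullet> dir_deriv (axis i 1) F u"
    "w \<bullet> normal u = w' \<bullet> normal u"
  shows "w = w'"
proof (rule frame_ext[OF assms(1) _ assms(3)])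
  show "w \<bullet> dir_deriv v F u = w' \<bullet> dir_deriv v F u" for v
    by (subst (1 2) linear_expand_axis[OF linear_dF[OF assms(1)]])
      (simp add: inner_sum_right assms(2))
qed

lemma dF_eq_0_iff: "u \<in> S \<Longrightarrow> dir_deriv x F u = 0 \<longleftrightarrow> x = 0"
  using inj_F[of u] linear_dF[of u] by (metis linear_injective_0 linear_0)

lemma ddF_commute: "u \<in> S \<Longrightarrow> dir_deriv x (dir_deriv y F) u = dir_deriv y (dir_deriv x F) u"
  by (rule dir_deriv_commute[OF open_S _ smooth_F])

lemma sff_commute: "u \<in> S \<Longrightarrow> sff u x y = sff u y x"
  by (simp add: sff_def ddF_commute)

lemma linear_ddF: "u \<in> S \<Longrightarrow> linear (\<lambda>x. dir_deriv x (dir_deriv y F) u)"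
  by (rule linear_dir_deriv[OF smooth_on_differentiable[OF smooth_dF]])

lemma linear_sff: "u \<in> S \<Longrightarrow> linear (\<lambda>x. sff u x y)" "u \<in> S \<Longrightarrow> linear (\<lambda>y. sff u x y)"
proof -
  assume u: "u \<in> S"
  show *: "linear (\<lambda>x. sff u x y)" for y
    unfolding sff_def
    by (intro linearI)
      (simp_all add: linear_add[OF linear_ddF[OF u]] linear_cmul[OF linear_ddF[OF u]] inner_add_left)
  show "linear (\<lambda>y. sff u x y)"
    using *[of x] by (simp add: sff_commute[OF u, of x])
qed

text \<open>The Weingarten formula, obtained by differentiating the identities that the normal is
  orthogonal to \<open>dir_deriv y F\<close> and has length one.\<close>

lemma normal_deriv_inner:
  assumes "u \<in> S"
  shows "dir_deriv x normal u \<bullet> dir_deriv y F u = - sff u x y"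
    and "dir_deriv x normal u \<bullet> normal u = 0"
proof -
  note d = smooth_on_differentiable[OF smooth_normal assms] smooth_on_differentiable[OF smooth_dF assms]
  have "dir_deriv x (\<lambda>u. normal u \<bullet> dir_deriv y F u) u = dir_deriv x (\<lambda>u. 0) u"
    by (rule dir_deriv_cong[OF open_S assms]) (rule normal_orthogonal)
  then show "dir_deriv x normal u \<bullet> dir_deriv y F u = - sff u x y"
    by (simp add: dir_deriv_inner d sff_def inner_commute dir_deriv_eqI[OF has_derivative_const])
  have "dir_deriv x (\<lambda>u. normal u \<bullet> normal u) u = dir_deriv x (\<lambda>u. 1) u"
    by (rule dir_deriv_cong[OF open_S assms]) (rule normal_normal)
  then show "dir_deriv x normal u \<bullet> normal u = 0"
    by (simp add: dir_deriv_inner d inner_commute dir_deriv_eqI[OF has_derivative_const])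
qed

lemma unit_normal_eq:
  assumes "u \<in> S"
  obtains s where "s = 1 \<or> s = -1" "unit_normal F u = s *\<^sub>R normal u"
proof -
  let ?n = "unit_normal F u"
  have n: "norm ?n = 1" "\<And>v. ?n \<bullet> dir_deriv v F u = 0"
    using someI_ex[OF unit_normal_exists[OF linear_dF[OF assms]]]
    unfolding unit_normal_def dir_deriv_def by auto
  define s where "s = ?n \<bullet> normal u"
  have eq: "?n = s *\<^sub>R normal u"
    by (rule frame_ext[OF assms]) (simp_all add: n s_def normal_orthogonal normal_normal assms)
  with n(1) norm_normal[OF assms] have "s = 1 \<or> s = -1" by auto
  with eq show thesis using that by blast
qed

text \<open>The sign \<open>s\<close> depends on the point without any regularity. This is harmless,
  since the Casorati curvatures contain only squares and vanishing is unaffected by sign.\<close>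

lemma second_fundamental_form_eq:
  assumes "u \<in> S"
  obtains s where "s = 1 \<or> s = -1" "\<And>x y. second_fundamental_form F u x y = s * sff u x y"
proof -
  obtain s where "s = 1 \<or> s = -1" "unit_normal F u = s *\<^sub>R normal u"
    using unit_normal_eq[OF assms] .
  then show thesis
    using that[of s] by (simp add: second_fundamental_form_def sff_def dir_deriv_def[abs_def])
qed

section \<open>Induced metric, Christoffel symbols and the Gauss equation\<close>

lemma partial_eq: "partial i f u = dir_deriv (axis i 1) f u"
  by (simp add: partial_def dir_deriv_def)

lemma fff_nth: "first_fundamental_form F u $ i $ j = met u (axis i 1) (axis j 1)"
  by (simp add: first_fundamental_form_def partial_eq)

lemma metric_inner_fff:
  assumes "u \<in> S"
  shows "metric_inner (first_fundamental_form F) u x y = met u x y"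
  unfolding linear_expand_axis[OF linear_dF[OF assms], of x]
    linear_expand_axis[OF linear_dF[OF assms], of y]
  by (simp add: metric_inner_def fff_nth inner_sum_left inner_sum_right sum_distrib_left mult_ac)
    (rule sum.swap)

text \<open>For the Gram matrix \<open>g\<close> of the coordinate tangent vectors,
  \<open>x \<bullet> (g *v x)\<close> is the squared length of the image of \<open>x\<close>, so
  injectivity of the differential makes the kernel trivial.\<close>

lemma det_fff_nonzero:
  assumes "u \<in> S"
  shows "det (first_fundamental_form F u) \<noteq> 0"
proof -
  have "x = 0" if "first_fundamental_form F u *v x = 0" for x
  proof -
    have "met u x x = x \<bullet> (first_fundamental_form F u *v x)"
      unfolding metric_inner_fff[OF assms, symmetric] metric_inner_def
      by (simp add: inner_vec_def matrix_vector_mult_def sum_distrib_left algebra_simps)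
    then show ?thesis using that dF_eq_0_iff[OF assms, of x] by simp
  qed
  then show ?thesis
    by (metis invertible_det_nz invertible_left_inverse matrix_left_invertible_ker)
qed

text \<open>The Christoffel symbols read off from outside: the components of the tangential part of
  the second derivatives of \<open>F\<close>. In this form smoothness is immediate and derivatives
  are easy to compute.\<close>

definition chris :: "3 \<Rightarrow> 3 \<Rightarrow> 3 \<Rightarrow> real ^ 3 \<Rightarrow> real" where
  "chris k i j u = (\<Sum>l\<in>UNIV. matrix_inv (first_fundamental_form F u) $ k $ l *
     (dir_deriv (axis i 1) (dir_deriv (axis j 1) F) u \<bullet> dir_deriv (axis l 1) F u))"

lemma smooth_chris: "smooth_on S (chris k i j)"
  unfolding chris_def[abs_def]
  by (intro smooth_on_sum smooth_on_mult smooth_on_matrix_inv smooth_on_inner smooth_ddF smooth_dF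
      open_S det_fff_nonzero) (simp add: fff_nth smooth_on_inner open_S smooth_dF)

text \<open>The product rule turns the three derivatives of the metric into six inner products. By
  symmetry of second derivatives four of them cancel and the other two are equal, which absorbs the
  factor 1/2.\<close>

lemma christoffel_eq:
  assumes "u \<in> S"
  shows "christoffel (first_fundamental_form F) k i j u = chris k i j u"
proof -
  have d: "dir_deriv x F differentiable at u" for x
    by (rule smooth_on_differentiable[OF smooth_dF assms])
  have "partial i (\<lambda>u. first_fundamental_form F u $ j $ l) u
      + partial j (\<lambda>u. first_fundamental_form F u $ i $ l) u
      - partial l (\<lambda>u. first_fundamental_form F u $ i $ j) u
      = 2 * (dir_deriv (axis i 1) (dir_deriv (axis j 1) F) u \<bullet> dir_deriv (axis l 1) F u)" for l
    unfolding partial_eq fff_nth dir_deriv_inner[OF d d]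
    using ddF_commute[OF assms, of "axis i 1" "axis j 1"] ddF_commute[OF assms, of "axis i 1" "axis l 1"]
      ddF_commute[OF assms, of "axis j 1" "axis l 1"]
    by (simp add: inner_commute)
  then show ?thesis
    unfolding christoffel_def chris_def by (simp add: sum_distrib_left mult_ac)
qed

lemma chris_lower:
  assumes "u \<in> S"
  shows "(\<Sum>k\<in>UNIV. chris k i j u * met u (axis k 1) (axis m 1))
    = dir_deriv (axis i 1) (dir_deriv (axis j 1) F) u \<bullet> dir_deriv (axis m 1) F u"
proof -
  let ?g = "first_fundamental_form F u"
  define b where "b = (\<chi> l. dir_deriv (axis i 1) (dir_deriv (axis j 1) F) u \<bullet> dir_deriv (axis l 1) F u)"
  have "?g *v (matrix_inv ?g *v b) = b"
    using det_fff_nonzero[OF assms]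
    by (simp add: matrix_vector_mul_assoc matrix_mul_matrix_inv invertible_det_nz)
  moreover have "matrix_inv ?g *v b = (\<chi> k. chris k i j u)"
    by (simp add: vec_eq_iff matrix_vector_mult_def chris_def b_def)
  ultimately have "(?g *v (\<chi> k. chris k i j u)) $ m = b $ m" by simp
  then show ?thesis
    by (simp add: matrix_vector_mult_def fff_nth b_def inner_commute mult.commute)
qed

lemma gauss_formula:
  assumes "u \<in> S"
  shows "dir_deriv (axis i 1) (dir_deriv (axis j 1) F) u
    = (\<Sum>k\<in>UNIV. chris k i j u *\<^sub>R dir_deriv (axis k 1) F u) + sff u (axis i 1) (axis j 1) *\<^sub>R normal u"
  by (rule frame_ext_axis[OF assms])
    (simp_all add: inner_add_left inner_sum_left chris_lower[OF assms] normal_orthogonal[OF assms]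
      normal_normal[OF assms] sff_def)

text \<open>This is \<open>chris_lower\<close> differentiated in direction \<open>i\<close>. Both
  sides then contain an inner product with the mixed derivative of \<open>F\<close> in directions
  \<open>i\<close> and \<open>p\<close>: once with the tangential part of the second derivative in
  \<open>j\<close> and \<open>k\<close>, once with all of it. The difference is the product of the
  two normal components.\<close>

lemma chris_deriv:
  assumes "u \<in> S"
  shows "(\<Sum>l\<in>UNIV. dir_deriv (axis i 1) (chris l j k) u * met u (axis l 1) (axis p 1))
      + (\<Sum>m\<in>UNIV. chris m j k u * (dir_deriv (axis i 1) (dir_deriv (axis m 1) F) u \<bullet> dir_deriv (axis p 1) F u))
    = dir_deriv (axis i 1) (dir_deriv (axis j 1) (dir_deriv (axis k 1) F)) u \<bullet> dir_deriv (axis p 1) F u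
      + sff u (axis j 1) (axis k 1) * sff u (axis i 1) (axis p 1)" (is "?L1 + ?L2 = ?R")
proof -
  let ?e = "\<lambda>i. axis i 1 :: real ^ 3"
  have d: "dir_deriv x F differentiable at u" "dir_deriv x (dir_deriv y F) differentiable at u"
    "chris a b c differentiable at u" for x y a b c
    using smooth_on_differentiable[OF smooth_dF assms] smooth_on_differentiable[OF smooth_ddF assms]
      smooth_on_differentiable[OF smooth_chris assms] by auto
  have sumd: "dir_deriv v (\<lambda>u. \<Sum>l\<in>UNIV. f l u) u = (\<Sum>l\<in>UNIV. dir_deriv v (f l) u)"
    if "\<And>l. f l differentiable (at u)" for v and f :: "3 \<Rightarrow> real ^ 3 \<Rightarrow> real"
    by (rule dir_deriv_eqI) (intro has_derivative_sum has_derivative_dir_deriv that)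
  have "dir_deriv (?e i) (\<lambda>u. \<Sum>l\<in>UNIV. chris l j k u * met u (?e l) (?e p)) u
      = dir_deriv (?e i) (\<lambda>u. dir_deriv (?e j) (dir_deriv (?e k) F) u \<bullet> dir_deriv (?e p) F u) u"
    by (rule dir_deriv_cong[OF open_S assms]) (rule chris_lower)
  then have "?L1 + ?L2 + (\<Sum>l\<in>UNIV. chris l j k u *\<^sub>R dir_deriv (?e l) F u)
        \<bullet> dir_deriv (?e i) (dir_deriv (?e p) F) u
      = dir_deriv (?e i) (dir_deriv (?e j) (dir_deriv (?e k) F)) u \<bullet> dir_deriv (?e p) F u
        + dir_deriv (?e j) (dir_deriv (?e k) F) u \<bullet> dir_deriv (?e i) (dir_deriv (?e p) F) u"
    by (simp add: sumd d dir_deriv_mult dir_deriv_inner sum.distrib distrib_left inner_sum_left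
        algebra_simps)
  moreover have "(\<Sum>l\<in>UNIV. chris l j k u *\<^sub>R dir_deriv (?e l) F u)
      = dir_deriv (?e j) (dir_deriv (?e k) F) u - sff u (?e j) (?e k) *\<^sub>R normal u"
    using gauss_formula[OF assms, of j k] by simp
  moreover have "normal u \<bullet> dir_deriv (?e i) (dir_deriv (?e p) F) u = sff u (?e i) (?e p)"
    by (simp add: sff_def inner_commute)
  ultimately show ?thesis by (simp add: inner_diff_left)
qed

text \<open>Antisymmetrising \<open>chris_deriv\<close> in \<open>i\<close> and \<open>j\<close>
  removes the third derivatives of \<open>F\<close>. After lowering the index, the quadratic terms
  of the curvature tensor are exactly the second sum in that identity.\<close>

lemma riemann_component_lower:
  assumes "u \<in> S"
  shows "(\<Sum>l\<in>UNIV. riemann_component (first_fundamental_form F) l k i j u * met u (axis l 1) (axis p 1))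
    = sff u (axis j 1) (axis k 1) * sff u (axis i 1) (axis p 1)
      - sff u (axis i 1) (axis k 1) * sff u (axis j 1) (axis p 1)"
proof -
  let ?e = "\<lambda>i. axis i 1 :: real ^ 3"
  have p: "partial a (christoffel (first_fundamental_form F) l b c) u = dir_deriv (?e a) (chris l b c) u"
    for a b c l
    unfolding partial_eq by (rule dir_deriv_cong[OF open_S assms]) (rule christoffel_eq)
  have quad: "(\<Sum>l\<in>UNIV. (\<Sum>m\<in>UNIV. chris m b c u * chris l a m u) * met u (?e l) (?e p))
      = (\<Sum>m\<in>UNIV. chris m b c u * (dir_deriv (?e a) (dir_deriv (?e m) F) u \<bullet> dir_deriv (?e p) F u))"
    for a b c
    unfolding chris_lower[OF assms, symmetric] sum_distrib_left sum_distrib_right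
    by (subst sum.swap) (simp add: mult.assoc)
  have comm: "dir_deriv (?e i) (dir_deriv (?e j) (dir_deriv (?e k) F)) u
      = dir_deriv (?e j) (dir_deriv (?e i) (dir_deriv (?e k) F)) u"
    by (rule dir_deriv_commute[OF open_S assms smooth_dF])
  have "(\<Sum>l\<in>UNIV. riemann_component (first_fundamental_form F) l k i j u * met u (?e l) (?e p))
    = ((\<Sum>l\<in>UNIV. dir_deriv (?e i) (chris l j k) u * met u (?e l) (?e p))
        + (\<Sum>l\<in>UNIV. (\<Sum>m\<in>UNIV. chris m j k u * chris l i m u) * met u (?e l) (?e p)))
      - ((\<Sum>l\<in>UNIV. dir_deriv (?e j) (chris l i k) u * met u (?e l) (?e p))
        + (\<Sum>l\<in>UNIV. (\<Sum>m\<in>UNIV. chris m i k u * chris l j m u) * met u (?e l) (?e p)))"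
    unfolding riemann_component_def p christoffel_eq[OF assms]
    by (simp add: sum_subtractf sum.distrib algebra_simps)
  then show ?thesis
    unfolding quad chris_deriv[OF assms] using comm by simp
qed

lemma sff_expand:
  assumes "u \<in> S"
  shows "sff u x y = (\<Sum>i\<in>UNIV. \<Sum>j\<in>UNIV. x $ i * y $ j * sff u (axis i 1) (axis j 1))"
  by (subst linear_expand_axis[OF linear_sff(1)[OF assms]],
      subst linear_expand_axis[OF linear_sff(2)[OF assms]])
    (simp add: sum_distrib_left mult.assoc)

lemma gauss_equation:
  assumes "u \<in> S"
  shows "metric_inner (first_fundamental_form F) u (riemann (first_fundamental_form F) u x y z) w
    = sff u y z * sff u x w - sff u x z * sff u y w"
proof -
  let ?e = "\<lambda>i. axis i 1 :: real ^ 3"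
  let ?R = "\<lambda>l k i j. riemann_component (first_fundamental_form F) l k i j u"
  have swap4: "(\<Sum>l\<in>UNIV. \<Sum>i\<in>UNIV. \<Sum>j\<in>UNIV. \<Sum>k\<in>UNIV. f l i j k)
      = (\<Sum>i\<in>UNIV. \<Sum>j\<in>UNIV. \<Sum>k\<in>UNIV. \<Sum>l\<in>UNIV. f l i j k)" for f :: "3 \<Rightarrow> 3 \<Rightarrow> 3 \<Rightarrow> 3 \<Rightarrow> real"
    by (subst sum.swap, rule sum.cong[OF refl], subst sum.swap, rule sum.cong[OF refl], rule sum.swap)
  have "metric_inner (first_fundamental_form F) u (riemann (first_fundamental_form F) u x y z) w
      = (\<Sum>p\<in>UNIV. w $ p * (\<Sum>l\<in>UNIV. \<Sum>i\<in>UNIV. \<Sum>j\<in>UNIV. \<Sum>k\<in>UNIV.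
          ?R l k i j * met u (?e l) (?e p) * (x $ i * y $ j * z $ k)))"
    unfolding metric_inner_def riemann_def fff_nth
    by (subst sum.swap) (simp add: sum_distrib_left sum_distrib_right mult_ac)
  also have "\<dots> = (\<Sum>p\<in>UNIV. w $ p * (\<Sum>i\<in>UNIV. \<Sum>j\<in>UNIV. \<Sum>k\<in>UNIV.
          (sff u (?e j) (?e k) * sff u (?e i) (?e p) - sff u (?e i) (?e k) * sff u (?e j) (?e p))
            * (x $ i * y $ j * z $ k)))"
  proof (rule sum.cong[OF refl], rule arg_cong2[OF refl, of _ _ "(*)"])
    show "(\<Sum>l\<in>UNIV. \<Sum>i\<in>UNIV. \<Sum>j\<in>UNIV. \<Sum>k\<in>UNIV.
          ?R l k i j * met u (?e l) (?e p) * (x $ i * y $ j * z $ k))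
        = (\<Sum>i\<in>UNIV. \<Sum>j\<in>UNIV. \<Sum>k\<in>UNIV.
          (sff u (?e j) (?e k) * sff u (?e i) (?e p) - sff u (?e i) (?e k) * sff u (?e j) (?e p))
            * (x $ i * y $ j * z $ k))" for p
      by (rule trans[OF swap4])
        (simp add: riemann_component_lower[OF assms, symmetric] sum_distrib_right)
  qed
  also have "\<dots> = (\<Sum>p\<in>UNIV. w $ p * (sff u y z * sff u x (?e p) - sff u x z * sff u y (?e p)))"
  proof (rule sum.cong[OF refl], rule arg_cong2[OF refl, of _ _ "(*)"])
    have ax: "sff u a (?e p) = (\<Sum>i\<in>UNIV. a $ i * sff u (?e i) (?e p))" for a p
      using linear_expand_axis[OF linear_sff(1)[OF assms, of "?e p"], of a] by simp
    show "(\<Sum>i\<in>UNIV. \<Sum>j\<in>UNIV. \<Sum>k\<in>UNIV.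
          (sff u (?e j) (?e k) * sff u (?e i) (?e p) - sff u (?e i) (?e k) * sff u (?e j) (?e p))
            * (x $ i * y $ j * z $ k)) = sff u y z * sff u x (?e p) - sff u x z * sff u y (?e p)" for p
      unfolding sff_expand[OF assms, of y z] sff_expand[OF assms, of x z] ax[of x] ax[of y]
      by (simp add: sum_3 algebra_simps)
  qed
  also have "\<dots> = sff u y z * sff u x w - sff u x z * sff u y w"
    unfolding linear_expand_axis[OF linear_sff(2)[OF assms, of x], of w]
      linear_expand_axis[OF linear_sff(2)[OF assms, of y], of w]
    by (simp add: sum_distrib_left sum_subtractf algebra_simps)
  finally show ?thesis .
qed

end

subsection \<open>The equality case of the Casorati inequality\<close>

lemma cross3_frame_expand:
  fixes x y :: "real ^ 3"
  assumes "norm x = 1" "norm y = 1" "x \<bullet> y = 0"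
  shows "v = (v \<bullet> x) *\<^sub>R x + (v \<bullet> y) *\<^sub>R y + (v \<bullet> cross3 x y) *\<^sub>R cross3 x y"
proof -
  let ?z = "cross3 x y"
  have xy: "x \<bullet> x = 1" "y \<bullet> y = 1" "y \<bullet> x = 0"
    using assms by (simp_all add: norm_eq_1 inner_commute)
  have "norm ?z ^ 2 = 1" using assms by (simp add: norm_cross)
  then have z: "?z \<bullet> ?z = 1" by (simp add: power2_norm_eq_inner)
  have zxy: "?z \<bullet> x = 0" "?z \<bullet> y = 0" "x \<bullet> ?z = 0" "y \<bullet> ?z = 0"
    by (simp_all add: dot_cross_self)
  define d where "d = v - ((v \<bullet> x) *\<^sub>R x + (v \<bullet> y) *\<^sub>R y + (v \<bullet> ?z) *\<^sub>R ?z)"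
  have d: "d \<bullet> x = 0" "d \<bullet> y = 0" "d \<bullet> ?z = 0"
    unfolding d_def by (simp_all add: inner_diff_left inner_add_left xy z zxy assms(3))
  \<comment> \<open>The double cross product of \<open>d\<close> with \<open>x\<close> and
    \<open>y\<close> is a combination of \<open>x\<close> and \<open>y\<close> with coefficients
    \<open>d \<bullet> y\<close> and \<open>d \<bullet> x\<close>, both zero. Thus \<open>d\<close>
    is parallel as well as orthogonal to the unit vector \<open>?z\<close>.\<close>
  have "cross3 d ?z = 0" by (simp add: Lagrange d)
  then have "d = 0" using d(3) norm_and_cross_eq_0[of d ?z] z by auto
  then show ?thesis by (simp add: d_def)
qed

lemma linear_functional_inner:
  fixes \<phi> :: "real ^ 'n::finite \<Rightarrow> real"
  assumes "linear \<phi>"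
  shows "\<phi> v = (\<chi> i. \<phi> (axis i 1)) \<bullet> v"
  by (subst linear_expand_axis[OF assms]) (simp add: inner_vec_def mult.commute)

text \<open>Parseval's identity in each slot. The point is to pass from the arbitrary frame in which
  the curvatures are computed to one adapted to a minimising plane.\<close>

lemma orthonormal_frame_invariants:
  fixes h :: "real ^ 3 \<Rightarrow> real ^ 3 \<Rightarrow> real" and x y :: "real ^ 3"
  assumes h: "\<And>x. linear (h x)" "\<And>x y. h x y = h y x"
    and xy: "norm x = 1" "norm y = 1" "x \<bullet> y = 0"
  defines "z \<equiv> cross3 x y"
  shows "(\<Sum>i\<in>UNIV. h (axis i 1) (axis i 1)) = h x x + h y y + h z z"
    and "(\<Sum>i\<in>UNIV. \<Sum>j\<in>UNIV. (h (axis i 1) (axis j 1))\<^sup>2)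
      = (h x x)\<^sup>2 + (h y y)\<^sup>2 + (h z z)\<^sup>2 + 2 * (h x y)\<^sup>2 + 2 * (h x z)\<^sup>2 + 2 * (h y z)\<^sup>2"
proof -
  let ?e = "\<lambda>i. axis i 1 :: real ^ 3"
  note expand = cross3_frame_expand[OF xy, folded z_def]
  define w where "w v = (\<chi> i. h v (?e i))" for v
  have w: "h v a = w v \<bullet> a" for v a
    unfolding w_def by (rule linear_functional_inner[OF h(1)])
  have parseval: "(\<Sum>i\<in>UNIV. (h v (?e i))\<^sup>2) = (h v x)\<^sup>2 + (h v y)\<^sup>2 + (h v z)\<^sup>2" for v
  proof -
    have "(\<Sum>i\<in>UNIV. (h v (?e i))\<^sup>2) = w v \<bullet> w v"
      by (simp add: inner_vec_def w_def power2_eq_square)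
    also have "\<dots> = w v \<bullet> ((w v \<bullet> x) *\<^sub>R x + (w v \<bullet> y) *\<^sub>R y + (w v \<bullet> z) *\<^sub>R z)"
      by (rule arg_cong[OF expand])
    finally show ?thesis by (simp add: inner_add_right w power2_eq_square)
  qed
  have "(\<Sum>i\<in>UNIV. \<Sum>j\<in>UNIV. (h (?e i) (?e j))\<^sup>2)
      = (\<Sum>i\<in>UNIV. (h x (?e i))\<^sup>2 + (h y (?e i))\<^sup>2 + (h z (?e i))\<^sup>2)"
    unfolding parseval by (rule sum.cong[OF refl]) (simp only: h(2)[of "?e _" x] h(2)[of "?e _" y] h(2)[of "?e _" z])
  also have "\<dots> = (h x x)\<^sup>2 + (h y y)\<^sup>2 + (h z z)\<^sup>2 + 2 * (h x y)\<^sup>2 + 2 * (h x z)\<^sup>2 + 2 * (h y z)\<^sup>2"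
    unfolding sum.distrib parseval h(2)[of y x] h(2)[of z x] h(2)[of z y] by simp
  finally show "(\<Sum>i\<in>UNIV. \<Sum>j\<in>UNIV. (h (?e i) (?e j))\<^sup>2)
      = (h x x)\<^sup>2 + (h y y)\<^sup>2 + (h z z)\<^sup>2 + 2 * (h x y)\<^sup>2 + 2 * (h x z)\<^sup>2 + 2 * (h y z)\<^sup>2" .
  have "h (?e i) (?e i) = x $ i * h x (?e i) + y $ i * h y (?e i) + z $ i * h z (?e i)" for i
  proof -
    have "h (?e i) (?e i) = h (?e i) ((?e i \<bullet> x) *\<^sub>R x + (?e i \<bullet> y) *\<^sub>R y + (?e i \<bullet> z) *\<^sub>R z)"
      by (rule arg_cong[OF expand])
    then show ?thesis
      by (simp only: linear_add[OF h(1)] linear_cmul[OF h(1)] inner_axis' h(2)[of "?e i" x]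
          h(2)[of "?e i" y] h(2)[of "?e i" z] real_scaleR_def inner_real_def mult_1)
  qed
  then have "(\<Sum>i\<in>UNIV. h (?e i) (?e i)) = w x \<bullet> x + w y \<bullet> y + w z \<bullet> z"
    by (simp add: sum.distrib inner_vec_def w_def mult.commute)
  then show "(\<Sum>i\<in>UNIV. h (?e i) (?e i)) = h x x + h y y + h z z"
    by (simp add: w)
qed

text \<open>Orthonormal pairs form a compact set. An attained minimum supplies a concrete plane in
  place of the infimum in the definition of \<open>delta_casorati_2\<close>.\<close>

lemma orthonormal_pair_minimum:
  fixes h :: "real ^ 3 \<Rightarrow> real ^ 3 \<Rightarrow> real"
  assumes h: "\<And>x. linear (h x)" "\<And>x y. h x y = h y x"
  obtains x y :: "real ^ 3" where "norm x = 1" "norm y = 1" "x \<bullet> y = 0"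
    "\<And>a b. norm a = 1 \<Longrightarrow> norm b = 1 \<Longrightarrow> a \<bullet> b = 0 \<Longrightarrow>
      (h x x)\<^sup>2 + 2 * (h x y)\<^sup>2 + (h y y)\<^sup>2 \<le> (h a a)\<^sup>2 + 2 * (h a b)\<^sup>2 + (h b b)\<^sup>2"
proof -
  define K :: "((real ^ 3) \<times> (real ^ 3)) set"
    where "K = (sphere 0 1 \<times> sphere 0 1) \<inter> {p. fst p \<bullet> snd p = 0}"
  have "closed {p :: (real ^ 3) \<times> (real ^ 3). fst p \<bullet> snd p = 0}"
    by (intro closed_Collect_eq continuous_intros)
  then have "compact K"
    unfolding K_def by (intro compact_Int_closed compact_Times compact_sphere)
  moreover have "(axis 1 1, axis 2 1) \<in> K"
    by (simp add: K_def inner_axis_axis)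
  moreover have "continuous_on UNIV (\<lambda>p. h (fst p) (snd p))"
  proof -
    have "h v a = (\<Sum>i\<in>UNIV. \<Sum>j\<in>UNIV. a $ i * v $ j * h (axis i 1) (axis j 1))" for v a
    proof -
      have "h v a = (\<Sum>i\<in>UNIV. a $ i *\<^sub>R h v (axis i 1))"
        by (rule linear_expand_axis[OF h(1)])
      also have "\<dots> = (\<Sum>i\<in>UNIV. a $ i *\<^sub>R (\<Sum>j\<in>UNIV. v $ j *\<^sub>R h (axis i 1) (axis j 1)))"
        by (simp only: h(2)[of v] linear_expand_axis[OF h(1), of _ v])
      finally show ?thesis by (simp add: sum_distrib_left mult.assoc)
    qed
    then have "(\<lambda>p. h (fst p) (snd p))
        = (\<lambda>p. \<Sum>i\<in>UNIV. \<Sum>j\<in>UNIV. snd p $ i * fst p $ j * h (axis i 1) (axis j 1))"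
      by blast
    then show ?thesis by (simp only:) (intro continuous_intros)
  qed
  then have c: "continuous_on K (\<lambda>p. h (f p) (g p))"
    if "continuous_on UNIV f" "continuous_on UNIV g" for f g
    using continuous_on_compose2[of UNIV "\<lambda>p. h (fst p) (snd p)" K "\<lambda>p. (f p, g p)"] that
    by (auto intro!: continuous_on_Pair intro: continuous_on_subset)
  have "continuous_on K (\<lambda>p. (h (fst p) (fst p))\<^sup>2 + 2 * (h (fst p) (snd p))\<^sup>2 + (h (snd p) (snd p))\<^sup>2)"
    by (intro continuous_intros c)
  ultimately obtain p where p: "p \<in> K" "\<And>q. q \<in> K \<Longrightarrow>
      (h (fst p) (fst p))\<^sup>2 + 2 * (h (fst p) (snd p))\<^sup>2 + (h (snd p) (snd p))\<^sup>2
      \<le> (h (fst q) (fst q))\<^sup>2 + 2 * (h (fst q) (snd q))\<^sup>2 + (h (snd q) (snd q))\<^sup>2"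
    using continuous_attains_inf[of K] by (metis (no_types, lifting) empty_iff)
  show thesis
    by (rule that[of "fst p" "snd p"]) (use p(1) p(2)[of "(_, _)"] in \<open>auto simp: K_def\<close>)
qed

text \<open>
  In an orthonormal frame \<open>x, y, z\<close> the defect \<open>6 (\<delta> - \<rho>)\<close>, computed with the plane
  spanned by \<open>x\<close> and \<open>y\<close>, is the sum of squares
  \<open>(h\<^sub>z\<^sub>z - h\<^sub>x\<^sub>x - h\<^sub>y\<^sub>y)\<^sup>2 + 2 (h\<^sub>x\<^sub>x - h\<^sub>y\<^sub>y)\<^sup>2 + 8 h\<^sub>x\<^sub>y\<^sup>2 + 4 h\<^sub>x\<^sub>z\<^sup>2 + 4 h\<^sub>y\<^sub>z\<^sup>2\<close>.
\<close>

lemma casorati_equality_form: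
  fixes h :: "real ^ 3 \<Rightarrow> real ^ 3 \<Rightarrow> real"
  assumes h: "\<And>x. linear (h x)" "\<And>x y. h x y = h y x"
    and xy: "norm x = 1" "norm y = 1" "x \<bullet> y = 0"
    and le: "2 * (\<Sum>i\<in>UNIV. \<Sum>j\<in>UNIV. (h (axis i 1) (axis j 1))\<^sup>2)
      + 2 * ((h x x)\<^sup>2 + 2 * (h x y)\<^sup>2 + (h y y)\<^sup>2) \<le> (\<Sum>i\<in>UNIV. h (axis i 1) (axis i 1))\<^sup>2"
  obtains l z where "norm z = 1" "\<And>a b. h a b = l * (a \<bullet> b + (z \<bullet> a) * (z \<bullet> b))"
proof -
  define z where "z = cross3 x y"
  note inv = orthonormal_frame_invariants[OF h xy, folded z_def]
  have "(h z z - h x x - h y y)\<^sup>2 + 2 * (h x x - h y y)\<^sup>2 + 8 * (h x y)\<^sup>2 + 4 * (h x z)\<^sup>2 + 4 * (h y z)\<^sup>2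
     \<le> 0"
    using le unfolding inv by (simp add: power2_eq_square algebra_simps)
  then have "(h z z - h x x - h y y)\<^sup>2 = 0" "(h x x - h y y)\<^sup>2 = 0" "(h x y)\<^sup>2 = 0" "(h x z)\<^sup>2 = 0"
    "(h y z)\<^sup>2 = 0"
    by (smt (verit) zero_le_power2)+
  moreover define l where "l = h x x"
  ultimately have eqs: "h x x = l" "h z z = 2 * l" "h y y = l" "h x y = 0" "h x z = 0" "h y z = 0"
    "h y x = 0" "h z x = 0" "h z y = 0"
    using h(2)[of y x] h(2)[of z x] h(2)[of z y] by auto
  have "norm z ^ 2 = 1" using xy by (simp add: z_def norm_cross)
  then have nz: "norm z = 1" using norm_ge_zero[of z] by (auto simp: power2_eq_1_iff)
  note expand = cross3_frame_expand[OF xy, folded z_def]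
  have he: "h v b = (b \<bullet> x) * h v x + (b \<bullet> y) * h v y + (b \<bullet> z) * h v z" for v b
    using arg_cong[OF expand[of b], of "h v"]
    by (simp only: linear_add[OF h(1)] linear_cmul[OF h(1)] real_scaleR_def)
  have hx: "h x b = l * (b \<bullet> x)" "h y b = l * (b \<bullet> y)" "h z b = 2 * l * (b \<bullet> z)" for b
    using he[of x b] he[of y b] he[of z b] by (simp_all add: eqs)
  have "h a b = l * (a \<bullet> b + (z \<bullet> a) * (z \<bullet> b))" for a b
  proof -
    have "h a b = (a \<bullet> x) * h x b + (a \<bullet> y) * h y b + (a \<bullet> z) * h z b"
      using he[of b a] by (simp only: h(2)[of b])
    moreover have "a \<bullet> b = (a \<bullet> x) * (x \<bullet> b) + (a \<bullet> y) * (y \<bullet> b) + (a \<bullet> z) * (z \<bullet> b)"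
      using arg_cong[OF expand[of a], of "\<lambda>v. v \<bullet> b"]
      by (simp only: inner_add_left inner_scaleR_left)
    ultimately show ?thesis
      by (simp only: hx inner_commute[of _ b] inner_commute[of z a]) (simp add: algebra_simps)
  qed
  then show thesis using that nz by blast
qed

section \<open>The pointwise shape of the second fundamental form\<close>

context hypersurface_patch
begin

abbreviation fff :: "real ^ 3 \<Rightarrow> real ^ 3 ^ 3" where
  "fff \<equiv> first_fundamental_form F"

text \<open>This makes the frames picked by \<open>SOME\<close> in the curvature definitions genuine
  ones. An orthonormal basis of the image of \<open>L\<close> is pulled back through the injective
  differential.\<close>

lemma orthonormal_frame_exists:
  assumes "u \<in> S" "subspace L" "dim L = k"
  shows "\<exists>e. orthonormal_frame fff u k L e"
proof -
  let ?D = "\<lambda>v. dir_deriv v F u"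
  note lin = linear_dF[OF assms(1)] and inj = inj_F[OF assms(1)]
  have "subspace (?D ` L)" using lin assms(2) by (rule linear_subspace_image)
  from orthonormal_basis_subspace[OF this] obtain B where B: "B \<subseteq> ?D ` L" "pairwise orthogonal B"
    "\<And>x. x \<in> B \<Longrightarrow> norm x = 1" "independent B" "card B = dim (?D ` L)" "span B = ?D ` L"
    by blast
  have "dim (?D ` L) = k"
    using dim_image_eq[OF lin inj_on_subset[OF inj subset_UNIV]] assms(3) by simp
  then have cB: "card B = k" using B(5) by simp
  have fB: "finite B" using B(4) by (rule independent_imp_finite)
  obtain b where b: "bij_betw b {1..k} B"
    using ex_bij_betw_nat_finite_1[OF fB] cB by auto
  have "\<forall>i\<in>{1..k}. \<exists>v. v \<in> L \<and> ?D v = b i"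
  proof
    fix i assume "i \<in> {1..k}"
    then have "b i \<in> ?D ` L" using bij_betwE[OF b] B(1) by blast
    then show "\<exists>v. v \<in> L \<and> ?D v = b i" by auto
  qed
  then obtain e where "\<forall>i\<in>{1..k}. e i \<in> L \<and> ?D (e i) = b i"
    by (rule bchoice[THEN exE])
  then have e: "e i \<in> L" "?D (e i) = b i" if "i \<in> {1..k}" for i
    using that by auto
  have "met u (e i) (e j) = (if i = j then 1 else 0)" if "i \<in> {1..k}" "j \<in> {1..k}" for i j
  proof -
    have *: "b i \<in> B" "b j \<in> B" "i \<noteq> j \<Longrightarrow> b i \<noteq> b j"
      using bij_betwE[OF b] inj_on_eq_iff[OF bij_betw_imp_inj_on[OF b] that] that by blast+
    then have "b i \<bullet> b i = 1" "i \<noteq> j \<Longrightarrow> b i \<bullet> b j = 0"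
      using B(2) B(3)[OF *(1)] unfolding pairwise_def orthogonal_def norm_eq_1 by blast+
    then show ?thesis
      unfolding e(2)[OF that(1)] e(2)[OF that(2)] by auto
  qed
  moreover have "span (e ` {1..k}) = L"
  proof -
    have "?D ` span (e ` {1..k}) = span (?D ` e ` {1..k})"
      using linear_span_image[OF lin] by simp
    also have "?D ` e ` {1..k} = B"
      using image_cong[OF refl e(2), of "{1..k}"] bij_betw_imp_surj_on[OF b] by (simp add: image_image)
    finally have "?D ` span (e ` {1..k}) = ?D ` L" using B(6) by simp
    then show ?thesis unfolding inj_image_eq_iff[OF inj] .
  qed
  ultimately show ?thesis
    unfolding orthonormal_frame_def metric_inner_fff[OF assms(1)] by blast
qed

lemma sectional_curvature_eq:
  assumes "u \<in> S" "met u x x = 1" "met u y y = 1" "met u x y = 0"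
  shows "sectional_curvature fff u x y = sff u x x * sff u y y - (sff u x y)\<^sup>2"
  unfolding sectional_curvature_def gauss_equation[OF assms(1)]
  unfolding metric_inner_fff[OF assms(1)] assms
  by (simp add: power2_eq_square sff_commute[OF assms(1), of y x])

lemma casorati_ideal_sff:
  assumes "u \<in> S" and ideal: "normalized_scalar_curvature fff u = delta_casorati_2 F u"
  obtains l e where "met u e e = 1" "\<And>x y. sff u x y = l * (met u x y + met u e x * met u e y)"
proof -
  note mi = metric_inner_fff[OF assms(1)]
  obtain s where s: "s = 1 \<or> s = -1" and sf: "\<And>x y. second_fundamental_form F u x y = s * sff u x y"
    using second_fundamental_form_eq[OF assms(1)] by metis
  have sf2: "(second_fundamental_form F u x y)\<^sup>2 = (sff u x y)\<^sup>2" for x y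
    using s by (auto simp: sf)
  have i3: "{1..3::nat} = {1, 2, 3}" and i2: "{1..2::nat} = {1, 2}" by auto
  have i4: "{1..<1::nat} = {}" "{1..<2::nat} = {1}" "{1..<3::nat} = {1, 2}" by auto
  define e where "e = (SOME e. orthonormal_frame fff u 3 UNIV e)"
  have "orthonormal_frame fff u 3 UNIV e"
    unfolding e_def by (rule someI_ex[OF orthonormal_frame_exists[OF assms(1)]]) auto
  then have e: "\<And>i j. i \<in> {1..3} \<Longrightarrow> j \<in> {1..3} \<Longrightarrow> met u (e i) (e j) = (if i = j then 1 else 0)"
    and span_e: "span (e ` {1..3}) = UNIV"
    unfolding orthonormal_frame_def mi by auto
  \<comment> \<open>\<open>E\<close> identifies Euclidean three-space isometrically with the tangent
    space, so that the results on bilinear forms apply to the pullback \<open>h\<close> of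
    \<open>sff\<close>.\<close>
  define E where "E a = a $ 1 *\<^sub>R e 1 + a $ 2 *\<^sub>R e 2 + a $ 3 *\<^sub>R e 3" for a :: "real ^ 3"
  have linE: "linear E"
    by (rule linearI) (simp_all add: E_def algebra_simps)
  note linD = linear_dF[OF assms(1)]
  have metE: "met u (E a) (E b) = a \<bullet> b" for a b
    using e[of 1 1] e[of 2 2] e[of 3 3] e[of 1 2] e[of 2 1] e[of 1 3] e[of 3 1] e[of 2 3] e[of 3 2]
    by (simp add: E_def linear_add[OF linD] linear_cmul[OF linD] inner_add_left inner_add_right
        inner_vec_def[of a b] sum_3)
  have Eax: "E (axis 1 1) = e 1" "E (axis 2 1) = e 2" "E (axis 3 1) = e 3"
    by (simp_all add: E_def axis_def)
  have surjE: "\<exists>a. x = E a" for x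
  proof -
    have "subspace (range E)" using linE by (rule linear_subspace_image) simp
    moreover have "e ` {1..3} \<subseteq> range E" unfolding i3 using Eax by (auto simp: image_iff) metis+
    ultimately have "span (e ` {1..3}) \<subseteq> range E" by (metis span_minimal)
    then show ?thesis using span_e by auto
  qed
  define h where "h a b = sff u (E a) (E b)" for a b
  have h1: "linear (h a)" for a
    unfolding h_def using linear_compose[OF linE linear_sff(2)[OF assms(1), of "E a"]]
    by (simp add: o_def)
  have h2: "h a b = h b a" for a b
    unfolding h_def by (rule sff_commute[OF assms(1)])
  define S2 where "S2 = (\<Sum>i\<in>UNIV. \<Sum>j\<in>UNIV. (h (axis i 1) (axis j 1))\<^sup>2)"
  define t where "t = (\<Sum>i\<in>UNIV. h (axis i 1) (axis i 1))"
  have C: "casorati F u 3 UNIV = (1/3) * S2"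
    unfolding casorati_def Let_def e_def[symmetric] i3 sf2 S2_def sum_3 h_def Eax by simp
  \<comment> \<open>By the Gauss equation the three sectional curvatures are the principal 2 by 2
    minors of \<open>h\<close>, and their sum is \<open>(t^2 - S2) / 2\<close>.\<close>
  have rho: "normalized_scalar_curvature fff u = (1/6) * (t\<^sup>2 - S2)"
  proof -
    have "normalized_scalar_curvature fff u = (1/3) * (sectional_curvature fff u (e 1) (e 2)
        + (sectional_curvature fff u (e 1) (e 3) + sectional_curvature fff u (e 2) (e 3)))"
      unfolding normalized_scalar_curvature_def Let_def e_def[symmetric] i3
      by (simp add: i4 del: One_nat_def)
    also have "\<dots> = (1/6) * (t\<^sup>2 - S2)"
      using e[of 1 1] e[of 2 2] e[of 3 3] e[of 1 2] e[of 1 3] e[of 2 3]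
      unfolding t_def S2_def sum_3 h_def Eax
      by (simp add: sectional_curvature_eq[OF assms(1)] sff_commute[OF assms(1), of "e 2" "e 1"]
          sff_commute[OF assms(1), of "e 3" "e 1"] sff_commute[OF assms(1), of "e 3" "e 2"]
          power2_eq_square algebra_simps del: One_nat_def)
    finally show ?thesis .
  qed
  obtain x y :: "real ^ 3" where xy: "norm x = 1" "norm y = 1" "x \<bullet> y = 0"
    and min: "\<And>a b. norm a = 1 \<Longrightarrow> norm b = 1 \<Longrightarrow> a \<bullet> b = 0 \<Longrightarrow>
      (h x x)\<^sup>2 + 2 * (h x y)\<^sup>2 + (h y y)\<^sup>2 \<le> (h a a)\<^sup>2 + 2 * (h a b)\<^sup>2 + (h b b)\<^sup>2"
    using orthonormal_pair_minimum[of h, OF h1 h2] by blast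
  let ?m = "(h x x)\<^sup>2 + 2 * (h x y)\<^sup>2 + (h y y)\<^sup>2"
  \<comment> \<open>A lower bound suffices: the frame chosen for any plane corresponds under
    \<open>E\<close> to an orthonormal pair, so it competes with the minimum.\<close>
  have "?m / 2 \<le> (INF L\<in>{L. subspace L \<and> dim L = 2}. casorati F u 2 L)"
  proof (rule cINF_greatest)
    have "span {axis 1 1, axis 2 1 :: real ^ 3} \<in> {L. subspace L \<and> dim L = 2}"
    proof -
      have "dim {axis 1 1, axis 2 1 :: real ^ 3} = card {axis 1 1, axis 2 1 :: real ^ 3}"
        by (intro dim_eq_card_independent independent_mono[OF independent_Basis])
          (auto simp: Basis_vec_def)
      also have "\<dots> = 2" by (simp add: axis_eq_axis)
      finally show ?thesis by simp
    qed
    then show "{L :: (real ^ 3) set. subspace L \<and> dim L = 2} \<noteq> {}" by blast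
    fix L :: "(real ^ 3) set" assume "L \<in> {L. subspace L \<and> dim L = 2}"
    then have L: "subspace L" "dim L = 2" by auto
    define f where "f = (SOME e. orthonormal_frame fff u 2 L e)"
    have "orthonormal_frame fff u 2 L f"
      unfolding f_def by (rule someI_ex[OF orthonormal_frame_exists[OF assms(1) L]])
    then have f: "met u (f 1) (f 1) = 1" "met u (f 2) (f 2) = 1" "met u (f 1) (f 2) = 0"
      unfolding orthonormal_frame_def mi by auto
    obtain a b where ab: "f 1 = E a" "f 2 = E b" using surjE by metis
    have "casorati F u 2 L = (1/2) * ((h a a)\<^sup>2 + 2 * (h a b)\<^sup>2 + (h b b)\<^sup>2)"
      unfolding casorati_def Let_def f_def[symmetric] i2 sf2 h_def ab[symmetric]
      by (simp add: sff_commute[OF assms(1), of "f 2" "f 1"] del: One_nat_def)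
    moreover have "norm a = 1" "norm b = 1" "a \<bullet> b = 0"
      using f unfolding ab metE by (simp_all add: norm_eq_1)
    ultimately show "?m / 2 \<le> casorati F u 2 L" using min[of a b] by simp
  qed
  \<comment> \<open>Equality reads \<open>(t^2 - S2) / 6 = S2 / 6 + (2/3) * INF\<close>. The infimum
    is at least \<open>?m / 2\<close>; multiply by 6.\<close>
  then have "2 * S2 + 2 * ?m \<le> t\<^sup>2"
    using ideal unfolding rho delta_casorati_2_def C by simp
  note le = this[unfolded S2_def t_def]
  obtain l z where z: "norm z = 1" "\<And>a b. h a b = l * (a \<bullet> b + (z \<bullet> a) * (z \<bullet> b))"
    by (rule casorati_equality_form[of h, OF h1 h2 xy le]) (rule that)
  show thesis
  proof (rule that[of "E z" l])
    show "met u (E z) (E z) = 1" using z(1) by (simp add: metE norm_eq_1)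
    fix x y
    obtain a b where ab: "x = E a" "y = E b" using surjE by metis
    show "sff u x y = l * (met u x y + met u (E z) x * met u (E z) y)"
      unfolding ab metE h_def[symmetric] z(2) ..
  qed
qed

end

subsection \<open>The first integral\<close>

text \<open>The orthogonal complement of two vectors in three-space is nonzero. Taking the same
  functional twice gives a vector in a single kernel.\<close>

lemma common_kernel:
  fixes \<phi> \<psi> :: "real ^ 3 \<Rightarrow> real"
  assumes "linear \<phi>" "linear \<psi>"
  obtains y where "y \<noteq> 0" "\<phi> y = 0" "\<psi> y = 0"
proof -
  define a b where "a = (\<chi> i. \<phi> (axis i 1))" "b = (\<chi> i. \<psi> (axis i 1))"
  have "dim {a, b} \<le> card {a, b}" by (rule dim_le_card') simp
  also have "\<dots> < DIM(real ^ 3)" by (simp add: card_insert_if)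
  finally obtain y where "y \<noteq> 0" "\<And>z. z \<in> span {a, b} \<Longrightarrow> orthogonal y z"
    using orthogonal_to_subspace_exists by blast
  then have "y \<noteq> 0" "y \<bullet> a = 0" "y \<bullet> b = 0"
    by (auto simp: orthogonal_def span_base)
  then show thesis
    using that[of y] linear_functional_inner[OF assms(1), of y] linear_functional_inner[OF assms(2), of y]
    by (simp add: a_b_def inner_commute)
qed

lemma dir_deriv_limit:
  fixes f :: "'a::real_normed_vector \<Rightarrow> real"
  assumes "f differentiable (at u)"
  shows "((\<lambda>t. (f (u + t *\<^sub>R z) - f u) / t) \<longlongrightarrow> dir_deriv z f u) (at 0)"
proof -
  have "((\<lambda>t. f (u + t *\<^sub>R z)) has_derivative (\<lambda>t. dir_deriv (t *\<^sub>R z) f u)) (at 0)"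
    by (rule has_derivative_compose[of "\<lambda>t. u + t *\<^sub>R z" "\<lambda>t. t *\<^sub>R z" 0 UNIV f])
      (auto intro!: derivative_eq_intros has_derivative_dir_deriv assms)
  then have "((\<lambda>t. f (u + t *\<^sub>R z)) has_real_derivative dir_deriv z f u) (at 0)"
    by (simp add: has_field_derivative_def mult_commute_abs linear_cmul[OF linear_dir_deriv[OF assms]])
  then show ?thesis by (simp add: DERIV_def)
qed

text \<open>A squeeze of difference quotients. It moves vanishing derivatives between
  \<open>lam\<close> and components of \<open>sff\<close> at zeros of \<open>lam\<close>, where no
  smooth principal direction links the two.\<close>

lemma dir_deriv_dominated:
  fixes f g k :: "'a::real_normed_vector \<Rightarrow> real"
  assumes S: "open S" "u \<in> S"
    and f: "f differentiable (at u)" and g: "g differentiable (at u)" and k: "continuous_on S k"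
    and le: "\<And>v. v \<in> S \<Longrightarrow> \<bar>f v\<bar> \<le> \<bar>g v\<bar> * k v"
    and g0: "g u = 0" "dir_deriv z g u = 0"
  shows "dir_deriv z f u = 0"
proof -
  have f0: "f u = 0" using le[OF S(2)] g0 by simp
  have lin: "((\<lambda>t. u + t *\<^sub>R z) \<longlongrightarrow> u) (at 0)"
    by (auto intro!: tendsto_eq_intros)
  have "isCont k u" using k S continuous_on_eq_continuous_at by blast
  then have "((\<lambda>t. k (u + t *\<^sub>R z)) \<longlongrightarrow> k u) (at 0)"
    using lin by (rule isCont_tendsto_compose)
  moreover have "((\<lambda>t. \<bar>(g (u + t *\<^sub>R z) - g u) / t\<bar>) \<longlongrightarrow> 0) (at 0)"
    using dir_deriv_limit[OF g, of z] unfolding g0(2) by (rule tendsto_rabs_zero)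
  ultimately have "((\<lambda>t. \<bar>(g (u + t *\<^sub>R z) - g u) / t\<bar> * k (u + t *\<^sub>R z)) \<longlongrightarrow> 0 * k u) (at 0)"
    by (rule tendsto_mult[rotated])
  then have lim: "((\<lambda>t. \<bar>(g (u + t *\<^sub>R z) - g u) / t\<bar> * k (u + t *\<^sub>R z)) \<longlongrightarrow> 0) (at 0)"
    by simp
  have "\<forall>\<^sub>F t in at 0. norm ((f (u + t *\<^sub>R z) - f u) / t)
      \<le> \<bar>(g (u + t *\<^sub>R z) - g u) / t\<bar> * k (u + t *\<^sub>R z)"
    using topological_tendstoD[OF lin S]
  proof eventually_elim
    case (elim t)
    then show ?case using le[OF elim] by (simp add: f0 g0 divide_right_mono)
  qed
  then have "((\<lambda>t. (f (u + t *\<^sub>R z) - f u) / t) \<longlongrightarrow> 0) (at 0)"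
    using lim by (rule Lim_null_comparison)
  then show ?thesis
    using tendsto_unique[OF _ dir_deriv_limit[OF f, of z]] by simp
qed

section \<open>Trace of the shape operator and the Codazzi equation\<close>

context hypersurface_patch
begin

lemma met_linear: "u \<in> S \<Longrightarrow> linear (\<lambda>y. met u x y)" "u \<in> S \<Longrightarrow> linear (\<lambda>x. met u x y)"
  by (auto intro!: linearI simp: linear_add[OF linear_dF] linear_cmul[OF linear_dF]
      inner_add_right inner_add_left)

lemma met_pos: "u \<in> S \<Longrightarrow> x \<noteq> 0 \<Longrightarrow> met u x x > 0"
  by (simp add: dF_eq_0_iff)

abbreviation ginv :: "real ^ 3 \<Rightarrow> 3 \<Rightarrow> 3 \<Rightarrow> real" where
  "ginv u i j \<equiv> matrix_inv (fff u) $ i $ j"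

lemma smooth_ginv: "smooth_on S (\<lambda>u. ginv u i j)"
  by (intro smooth_on_matrix_inv open_S det_fff_nonzero)
    (simp add: fff_nth smooth_on_inner open_S smooth_dF)

lemma ginv_met:
  assumes "u \<in> S"
  shows "(\<Sum>j\<in>UNIV. ginv u i j * met u x (axis j 1)) = x $ i"
proof -
  have "met u x (axis j 1) = (\<Sum>i\<in>UNIV. x $ i * met u (axis i 1) (axis j 1))" for j
    using linear_expand_axis[OF met_linear(2)[OF assms, of "axis j 1"], of x] by simp
  then have gx: "fff u *v x = (\<chi> j. met u x (axis j 1))"
    by (simp add: vec_eq_iff matrix_vector_mult_def fff_nth inner_commute mult.commute)
  have "matrix_inv (fff u) *v (fff u *v x) = x"
    using det_fff_nonzero[OF assms]
    by (simp add: matrix_vector_mul_assoc matrix_mul_matrix_inv invertible_det_nz)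
  then show ?thesis
    unfolding gx by (simp add: vec_eq_iff matrix_vector_mult_def)
qed

text \<open>The squared length of the covector dual to \<open>e\<close>. The same contraction later
  evaluates the squared gradient in \<open>energy\<close>.\<close>

lemma ginv_quadratic:
  assumes "u \<in> S"
  shows "(\<Sum>i\<in>UNIV. \<Sum>j\<in>UNIV. ginv u i j * (met u e (axis i 1) * met u e (axis j 1))) = met u e e"
proof -
  have "met u e e = (\<Sum>i\<in>UNIV. e $ i * met u e (axis i 1))"
    using linear_expand_axis[OF met_linear(1)[OF assms, of e], of e] by simp
  also have "\<dots> = (\<Sum>i\<in>UNIV. (\<Sum>j\<in>UNIV. ginv u i j * met u e (axis j 1)) * met u e (axis i 1))"
    by (simp only: ginv_met[OF assms])
  finally show ?thesis
    by (simp add: sum_distrib_right sum_distrib_left mult_ac)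
qed

lemma ginv_trace:
  assumes "u \<in> S"
  shows "(\<Sum>i\<in>UNIV. \<Sum>j\<in>UNIV. ginv u i j * met u (axis i 1) (axis j 1)) = 3"
proof -
  have "matrix_inv (fff u) ** fff u = mat 1"
    using det_fff_nonzero[OF assms] by (simp add: matrix_mul_matrix_inv invertible_det_nz)
  then have one: "(\<Sum>j\<in>UNIV. ginv u i j * met u (axis j 1) (axis i 1)) = 1" for i
    by (simp add: vec_eq_iff matrix_matrix_mult_def fff_nth mat_def)
  have swap: "(\<Sum>j\<in>UNIV. ginv u i j * met u (axis i 1) (axis j 1))
      = (\<Sum>j\<in>UNIV. ginv u i j * met u (axis j 1) (axis i 1))" for i
    by (rule sum.cong[OF refl]) (simp add: inner_commute)
  show ?thesis unfolding swap one by simp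
qed

text \<open>The factor 1/4 normalises the trace \<open>l + l + 2 l\<close>. A trace is smooth even
  where the principal directions are not determined.\<close>

definition lam :: "real ^ 3 \<Rightarrow> real" where
  "lam u = (1/4) * (\<Sum>i\<in>UNIV. \<Sum>j\<in>UNIV. ginv u i j * sff u (axis i 1) (axis j 1))"

lemma smooth_sff: "smooth_on S (\<lambda>u. sff u x y)"
  unfolding sff_def by (intro smooth_on_inner open_S smooth_ddF smooth_normal)

lemma smooth_lam: "smooth_on S lam"
  unfolding lam_def[abs_def]
  by (intro smooth_on_mult smooth_on_sum smooth_on_const open_S smooth_ginv smooth_sff)

lemma lam_eq:
  assumes "u \<in> S" "met u e e = 1"
    and "\<And>x y. sff u x y = l * (met u x y + met u e x * met u e y)"
  shows "lam u = l"
proof -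
  have "4 * lam u = (\<Sum>i\<in>UNIV. \<Sum>j\<in>UNIV. l * (ginv u i j * met u (axis i 1) (axis j 1))
      + l * (ginv u i j * (met u e (axis i 1) * met u e (axis j 1))))"
    unfolding lam_def assms(3) by (simp add: algebra_simps)
  also have "\<dots> = l * (\<Sum>i\<in>UNIV. \<Sum>j\<in>UNIV. ginv u i j * met u (axis i 1) (axis j 1))
      + l * (\<Sum>i\<in>UNIV. \<Sum>j\<in>UNIV. ginv u i j * (met u e (axis i 1) * met u e (axis j 1)))"
    by (simp only: sum.distrib sum_distrib_left)
  also have "\<dots> = 4 * l"
    unfolding ginv_trace[OF assms(1)] ginv_quadratic[OF assms(1)] assms(2) by simp
  finally show ?thesis by simp
qed

text \<open>
  The Codazzi equation for the shape operator \<open>l (I + e \<otimes> e)\<close>, where \<open>T = dF e\<close>.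
\<close>

lemma codazzi_consequences:
  assumes U: "open U" "U \<subseteq> S" and T: "smooth_on U T" and l: "smooth_on U l"
    and l0: "\<And>u. u \<in> U \<Longrightarrow> l u \<noteq> 0"
    and TT: "\<And>u. u \<in> U \<Longrightarrow> T u \<bullet> T u = 1" and TN: "\<And>u. u \<in> U \<Longrightarrow> T u \<bullet> normal u = 0"
    and dN: "\<And>u x. u \<in> U \<Longrightarrow> dir_deriv x normal u
        = - (l u *\<^sub>R (dir_deriv x F u + (T u \<bullet> dir_deriv x F u) *\<^sub>R T u))"
    and u: "u \<in> U"
  obtains m where "\<And>x. dir_deriv x l u = m * (T u \<bullet> dir_deriv x F u)"
    "\<And>x. dir_deriv x T u = (m / l u) *\<^sub>R (dir_deriv x F u - (T u \<bullet> dir_deriv x F u) *\<^sub>R T u)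
        + (2 * l u * (T u \<bullet> dir_deriv x F u)) *\<^sub>R normal u"
proof -
  have uS: "u \<in> S" using u U by blast
  define \<tau> where "\<tau> x = T u \<bullet> dir_deriv x F u" for x
  note dF = smooth_on_differentiable[OF smooth_dF uS] and dT = smooth_on_differentiable[OF T u]
    and dl = smooth_on_differentiable[OF l u] and dnorm = smooth_on_differentiable[OF smooth_normal uS]
  note linF = linear_dF[OF uS] and linT = linear_dir_deriv[OF dT] and linl = linear_dir_deriv[OF dl]
  have lin\<tau>: "linear \<tau>"
    by (rule linearI) (simp_all add: \<tau>_def linear_add[OF linF] linear_cmul[OF linF] inner_add_right)
  have TdT: "T u \<bullet> dir_deriv x T u = 0" for x
  proof -
    have "dir_deriv x (\<lambda>u. T u \<bullet> T u) u = dir_deriv x (\<lambda>u. 1) u"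
      by (rule dir_deriv_cong[OF U(1) u TT])
    then show ?thesis
      by (simp add: dir_deriv_inner dT inner_commute dir_deriv_eqI[OF has_derivative_const])
  qed
  have NdT: "dir_deriv x T u \<bullet> normal u = 2 * l u * \<tau> x" for x
  proof -
    have "dir_deriv x (\<lambda>u. T u \<bullet> normal u) u = dir_deriv x (\<lambda>u. 0) u"
      by (rule dir_deriv_cong[OF U(1) u TN])
    then have "T u \<bullet> dir_deriv x normal u + dir_deriv x T u \<bullet> normal u = 0"
      by (simp add: dir_deriv_inner dT dnorm dir_deriv_eqI[OF has_derivative_const])
    then show ?thesis
      by (simp add: dN[OF u] TT[OF u] \<tau>_def inner_add_right algebra_simps)
  qed
  have ddN: "dir_deriv y (dir_deriv x normal) u
      = - (l u *\<^sub>R (dir_deriv y (dir_deriv x F) u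
            + (T u \<bullet> dir_deriv y (dir_deriv x F) u + dir_deriv y T u \<bullet> dir_deriv x F u) *\<^sub>R T u
            + \<tau> x *\<^sub>R dir_deriv y T u)
          + dir_deriv y l u *\<^sub>R (dir_deriv x F u + \<tau> x *\<^sub>R T u))" for x y
  proof -
    have "dir_deriv y (dir_deriv x normal) u
        = dir_deriv y (\<lambda>u. - (l u *\<^sub>R (dir_deriv x F u + (T u \<bullet> dir_deriv x F u) *\<^sub>R T u))) u"
      by (rule dir_deriv_cong[OF U(1) u dN])
    also have "\<dots> = - (l u *\<^sub>R (dir_deriv y (dir_deriv x F) u
          + ((T u \<bullet> dir_deriv x F u) *\<^sub>R dir_deriv y T u
            + (T u \<bullet> dir_deriv y (dir_deriv x F) u + dir_deriv y T u \<bullet> dir_deriv x F u) *\<^sub>R T u))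
          + dir_deriv y l u *\<^sub>R (dir_deriv x F u + (T u \<bullet> dir_deriv x F u) *\<^sub>R T u))"
      by (rule dir_deriv_eqI)
        (auto intro!: derivative_eq_intros has_derivative_dir_deriv dF dT dl
          simp: algebra_simps)
    finally show ?thesis by (simp add: \<tau>_def algebra_simps)
  qed
  \<comment> \<open>Second derivatives of the normal commute; the terms with second derivatives of
    \<open>F\<close> are symmetric and drop out.\<close>
  have codazzi: "dir_deriv y l u *\<^sub>R (dir_deriv x F u + \<tau> x *\<^sub>R T u)
        + l u *\<^sub>R ((dir_deriv y T u \<bullet> dir_deriv x F u) *\<^sub>R T u + \<tau> x *\<^sub>R dir_deriv y T u)
      = dir_deriv x l u *\<^sub>R (dir_deriv y F u + \<tau> y *\<^sub>R T u)
        + l u *\<^sub>R ((dir_deriv x T u \<bullet> dir_deriv y F u) *\<^sub>R T u + \<tau> y *\<^sub>R dir_deriv x T u)" for x y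
  proof -
    have "dir_deriv y (dir_deriv x normal) u = dir_deriv x (dir_deriv y normal) u"
      by (rule dir_deriv_commute[OF open_S uS smooth_normal])
    then show ?thesis
      unfolding ddN ddF_commute[OF uS, of y x] by (simp add: algebra_simps)
  qed
  obtain e where e: "T u = dir_deriv e F u"
    using tangentE[OF uS] TN[OF u] by (metis inner_commute)
  define m where "m = dir_deriv e l u"
  have \<tau>e: "\<tau> e = 1" using TT[OF u] by (simp add: \<tau>_def e)
  \<comment> \<open>Codazzi for the pair \<open>e\<close>, \<open>x\<close> with \<open>x\<close>
    orthogonal to \<open>e\<close>. The component along \<open>T u\<close> gives the second
    identity, and what remains gives the first.\<close>
  have perp: "l u *\<^sub>R dir_deriv x T u = m *\<^sub>R dir_deriv x F u"
    "l u * (dir_deriv e T u \<bullet> dir_deriv x F u) = 2 * dir_deriv x l u" if x: "\<tau> x = 0" for x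
  proof -
    have c: "m *\<^sub>R dir_deriv x F u + l u *\<^sub>R ((dir_deriv e T u \<bullet> dir_deriv x F u) *\<^sub>R T u)
        = (2 * dir_deriv x l u) *\<^sub>R T u + l u *\<^sub>R dir_deriv x T u"
      using codazzi[of e x, unfolded e[symmetric] x \<tau>e m_def[symmetric]]
        TdT[of x, unfolded inner_commute[of "T u"]]
      by (simp add: mult.commute flip: scaleR_2)
    from arg_cong[OF this, of "\<lambda>w. T u \<bullet> w"]
    show *: "l u * (dir_deriv e T u \<bullet> dir_deriv x F u) = 2 * dir_deriv x l u"
      using x TdT[of x] by (simp add: inner_add_right TT[OF u] \<tau>_def)
    show "l u *\<^sub>R dir_deriv x T u = m *\<^sub>R dir_deriv x F u"
      using c unfolding * [symmetric] by simp
  qed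
  have l_perp: "dir_deriv x l u = 0" if x: "\<tau> x = 0" for x
  proof -
    \<comment> \<open>The eigenspace of \<open>l\<close> is two-dimensional, so there is a second
      direction \<open>y\<close> orthogonal to \<open>x\<close> and \<open>e\<close>. Codazzi for
      \<open>x\<close> and \<open>y\<close> then equates multiples of two orthogonal
      vectors.\<close>
    obtain y where y: "y \<noteq> 0" "\<tau> y = 0" "met u x y = 0"
      using common_kernel[OF lin\<tau> met_linear(1)[OF uS]] by metis
    have d: "l u * (dir_deriv a T u \<bullet> dir_deriv b F u) = m * met u a b" if "\<tau> a = 0" for a b
      using arg_cong[OF perp(1)[OF that], of "\<lambda>w. w \<bullet> dir_deriv b F u"] by simp
    have "dir_deriv x T u \<bullet> dir_deriv y F u = 0" "dir_deriv y T u \<bullet> dir_deriv x F u = 0"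
      using d[OF x, of y] d[OF y(2), of x] y(3) l0[OF u] by (simp_all add: inner_commute)
    then have "dir_deriv y l u *\<^sub>R dir_deriv x F u = dir_deriv x l u *\<^sub>R dir_deriv y F u"
      using codazzi[of y x] by (simp add: x y(2))
    from arg_cong[OF this, of "\<lambda>w. w \<bullet> dir_deriv y F u"]
    have "dir_deriv x l u * met u y y = 0" using y(3) by simp
    then show ?thesis using met_pos[OF uS y(1)] by auto
  qed
  have split: "\<tau> (x - \<tau> x *\<^sub>R e) = 0" for x
    by (simp add: linear_diff[OF lin\<tau>] linear_cmul[OF lin\<tau>] \<tau>e)
  have lx: "dir_deriv x l u = m * \<tau> x" for x
    using l_perp[OF split[of x]] by (simp add: linear_diff[OF linl] linear_cmul[OF linl] m_def)
  \<comment> \<open>The integral curves of \<open>e\<close> are geodesics: the tangential part of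
    the derivative of \<open>T\<close> along \<open>e\<close> is governed by the derivative of
    \<open>l\<close> across \<open>e\<close>, which has just been shown to vanish.\<close>
  have Te: "dir_deriv e T u = (2 * l u) *\<^sub>R normal u"
  proof (rule frame_ext[OF uS])
    show "dir_deriv e T u \<bullet> normal u = (2 * l u) *\<^sub>R normal u \<bullet> normal u"
      by (simp add: NdT \<tau>e normal_normal[OF uS])
    fix v
    have "dir_deriv e T u \<bullet> dir_deriv (v - \<tau> v *\<^sub>R e) F u = 0"
      using perp(2)[OF split[of v]] l_perp[OF split[of v]] l0[OF u] by simp
    then show "dir_deriv e T u \<bullet> dir_deriv v F u = (2 * l u) *\<^sub>R normal u \<bullet> dir_deriv v F u"
      using TdT[of e]
      by (simp add: linear_diff[OF linF] linear_cmul[OF linF] inner_diff_right normal_orthogonal[OF uS]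
          inner_commute flip: e)
  qed
  have "dir_deriv x T u = (m / l u) *\<^sub>R (dir_deriv x F u - \<tau> x *\<^sub>R T u) + (2 * l u * \<tau> x) *\<^sub>R normal u" for x
  proof -
    have "l u *\<^sub>R (dir_deriv x T u - \<tau> x *\<^sub>R dir_deriv e T u) = m *\<^sub>R (dir_deriv x F u - \<tau> x *\<^sub>R T u)"
      using perp(1)[OF split[of x]]
      by (simp add: linear_diff[OF linT] linear_cmul[OF linT] linear_diff[OF linF] linear_cmul[OF linF]
          flip: e)
    from arg_cong[OF this, of "\<lambda>w. inverse (l u) *\<^sub>R w"]
    have "dir_deriv x T u - \<tau> x *\<^sub>R dir_deriv e T u = (m / l u) *\<^sub>R (dir_deriv x F u - \<tau> x *\<^sub>R T u)"
      using l0[OF u] by (simp add: divide_inverse mult.commute)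
    then show ?thesis by (simp add: Te algebra_simps)
  qed
  with lx show thesis using that[of m] unfolding \<tau>_def by blast
qed

end

lemma dir_deriv_zero_constant:
  fixes f :: "'a::real_normed_vector \<Rightarrow> 'b::real_normed_vector"
  assumes "open V" "convex V" "smooth_on V f" "\<And>x u. u \<in> V \<Longrightarrow> dir_deriv x f u = 0"
    and "u \<in> V" "v \<in> V"
  shows "f u = f v"
proof -
  have "(f has_derivative (\<lambda>h. 0)) (at x within V)" if "x \<in> V" for x
    using smooth_on_has_derivative[OF assms(3) that] assms(4)[OF that]
    by (simp add: has_derivative_at_withinI)
  then show ?thesis
    using has_derivative_zero_constant[OF assms(2)] assms(5,6) by metis
qed

context hypersurface_patch
begin

text \<open>
  The vector \<open>W = l\<^sup>2 T + m N\<close> points along the axis of rotation. Its derivative is \<open>\<phi> N\<close>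
  for a one-form \<open>\<phi>\<close>, and symmetry of the second derivative forces \<open>\<phi> = 0\<close>
  because the second fundamental form is nondegenerate.
\<close>

lemma axis_constant:
  assumes U: "open U" "U \<subseteq> S" and T: "smooth_on U T" and l: "smooth_on U l"
    and l0: "\<And>u. u \<in> U \<Longrightarrow> l u \<noteq> 0"
    and TT: "\<And>u. u \<in> U \<Longrightarrow> T u \<bullet> T u = 1" and TN: "\<And>u. u \<in> U \<Longrightarrow> T u \<bullet> normal u = 0"
    and dN: "\<And>u x. u \<in> U \<Longrightarrow> dir_deriv x normal u
        = - (l u *\<^sub>R (dir_deriv x F u + (T u \<bullet> dir_deriv x F u) *\<^sub>R T u))"
    and x0: "\<And>u. u \<in> U \<Longrightarrow> T u \<bullet> dir_deriv x0 F u \<noteq> 0"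
  defines "m \<equiv> \<lambda>u. dir_deriv x0 l u / (T u \<bullet> dir_deriv x0 F u)"
  defines "W \<equiv> \<lambda>u. (l u * l u) *\<^sub>R T u + m u *\<^sub>R normal u"
  shows "smooth_on U W"
    and "\<And>u x. u \<in> U \<Longrightarrow> dir_deriv x l u = m u * (T u \<bullet> dir_deriv x F u)"
    and "\<And>u x. u \<in> U \<Longrightarrow> dir_deriv x W u = 0"
proof -
  note smFU = smooth_on_subset[OF smooth_dF U(2)] and smNU = smooth_on_subset[OF smooth_normal U(2)]
  have smm: "smooth_on U m"
    unfolding m_def by (intro smooth_on_divide smooth_on_inner U smooth_on_dir_deriv l T smFU x0)
  show smW: "smooth_on U W"
    unfolding W_def by (intro smooth_on_add smooth_on_scaleR smooth_on_mult U l T smm smNU)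
  have key: "dir_deriv x l u = m u * (T u \<bullet> dir_deriv x F u) \<and>
      dir_deriv x T u = (m u / l u) *\<^sub>R (dir_deriv x F u - (T u \<bullet> dir_deriv x F u) *\<^sub>R T u)
        + (2 * l u * (T u \<bullet> dir_deriv x F u)) *\<^sub>R normal u" if u: "u \<in> U" for u x
  proof -
    obtain m' where m': "\<And>x. dir_deriv x l u = m' * (T u \<bullet> dir_deriv x F u)"
      "\<And>x. dir_deriv x T u = (m' / l u) *\<^sub>R (dir_deriv x F u - (T u \<bullet> dir_deriv x F u) *\<^sub>R T u)
        + (2 * l u * (T u \<bullet> dir_deriv x F u)) *\<^sub>R normal u"
      by (rule codazzi_consequences[OF U T l l0 TT TN dN u]) (assumption | rule that)+
    \<comment> \<open>The Codazzi lemma produces its coefficient separately at each point.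
      Evaluating along the fixed direction \<open>x0\<close> identifies it with the smooth function
      \<open>m\<close>.\<close>
    have "m u = m'" using m'(1)[of x0] x0[OF u] by (simp add: m_def)
    then show ?thesis using m' by simp
  qed
  then show "\<And>u x. u \<in> U \<Longrightarrow> dir_deriv x l u = m u * (T u \<bullet> dir_deriv x F u)" by blast
  \<comment> \<open>The normal component of the derivative of \<open>W\<close>: the derivative of
    \<open>m\<close> together with \<open>l^2\<close> times the normal part \<open>2 l\<close> of
    the derivative of \<open>T\<close>. The tangential terms cancel.\<close>
  define \<phi> where "\<phi> x u = dir_deriv x m u + 2 * (l u * l u * l u) * (T u \<bullet> dir_deriv x F u)" for x u
  have sm\<phi>: "smooth_on U (\<phi> x)" for x
    unfolding \<phi>_def
    by (intro smooth_on_add smooth_on_mult smooth_on_inner U l T smFU smooth_on_dir_deriv smm smooth_on_const)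
  have dW: "dir_deriv x W u = \<phi> x u *\<^sub>R normal u" if u: "u \<in> U" for u x
  proof -
    note d = smooth_on_differentiable[OF l u] smooth_on_differentiable[OF T u]
      smooth_on_differentiable[OF smm u] smooth_on_differentiable[OF smNU u]
    have "dir_deriv x W u = (l u * l u) *\<^sub>R dir_deriv x T u
        + (l u * dir_deriv x l u + dir_deriv x l u * l u) *\<^sub>R T u
        + (m u *\<^sub>R dir_deriv x normal u + dir_deriv x m u *\<^sub>R normal u)"
      unfolding W_def
      by (rule dir_deriv_eqI) (auto intro!: derivative_eq_intros has_derivative_dir_deriv d)
    also have "\<dots> = \<phi> x u *\<^sub>R normal u"
      using l0[OF u]
      by (simp add: key[OF u] dN[OF u] \<phi>_def vec_eq_iff algebra_simps)
    finally show ?thesis .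
  qed
  show "dir_deriv x W u = 0" if u: "u \<in> U" for u x
  proof -
    have uS: "u \<in> S" using u U by blast
    have ddW: "dir_deriv y (dir_deriv x W) u = \<phi> x u *\<^sub>R dir_deriv y normal u + dir_deriv y (\<phi> x) u *\<^sub>R normal u"
      for x y
    proof -
      have "dir_deriv y (dir_deriv x W) u = dir_deriv y (\<lambda>u. \<phi> x u *\<^sub>R normal u) u"
        by (rule dir_deriv_cong[OF U(1) u dW])
      then show ?thesis
        by (simp add: dir_deriv_scaleR smooth_on_differentiable[OF sm\<phi> u] smooth_on_differentiable[OF smNU u])
    qed
    \<comment> \<open>The tangential part of the commuting second derivatives of \<open>W\<close>;
      derivatives of \<open>\<phi>\<close> occur only in the normal part.\<close>
    have sym: "\<phi> x u * sff u y z = \<phi> y u * sff u x z" for x y z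
    proof -
      have "dir_deriv y (dir_deriv x W) u \<bullet> dir_deriv z F u = dir_deriv x (dir_deriv y W) u \<bullet> dir_deriv z F u"
        by (simp add: dir_deriv_commute[OF U(1) u smW])
      then show ?thesis
        by (simp add: ddW inner_add_left normal_deriv_inner[OF uS] normal_orthogonal[OF uS])
    qed
    \<comment> \<open>With \<open>y = z\<close> the symmetry relation becomes
      \<open>\<phi> x u * sff u z z = 0\<close>, and \<open>sff\<close> is definite because
      \<open>l u\<close> is nonzero.\<close>
    obtain z where z: "z \<noteq> 0" "sff u x z = 0"
      using common_kernel[OF linear_sff(2)[OF uS] linear_sff(2)[OF uS]] by metis
    have "dir_deriv z normal u \<bullet> dir_deriv z F u
        = - (l u * (met u z z + (T u \<bullet> dir_deriv z F u) * (T u \<bullet> dir_deriv z F u)))"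
      by (simp add: dN[OF u] inner_add_left)
    then have "sff u z z = l u * (met u z z + (T u \<bullet> dir_deriv z F u) * (T u \<bullet> dir_deriv z F u))"
      by (simp add: normal_deriv_inner[OF uS])
    moreover have "met u z z + (T u \<bullet> dir_deriv z F u) * (T u \<bullet> dir_deriv z F u) > 0"
      using met_pos[OF uS z(1)] by (simp add: add_pos_nonneg)
    ultimately have "sff u z z \<noteq> 0" using l0[OF u] by auto
    then have "\<phi> x u = 0" using sym[of x z z] z(2) by simp
    then show ?thesis by (simp add: dW[OF u])
  qed
qed

end

section \<open>Zeros of the principal curvature\<close>

locale casorati_patch = hypersurface_patch +
  assumes sff_form: "u \<in> S \<Longrightarrow> \<exists>l e. met u e e = 1 \<and>
    (\<forall>x y. sff u x y = l * (met u x y + met u e x * met u e y))"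
begin

lemma sff_lam:
  assumes "u \<in> S"
  obtains e where "met u e e = 1" "\<And>x y. sff u x y = lam u * (met u x y + met u e x * met u e y)"
proof -
  obtain l e where le: "met u e e = 1" "\<And>x y. sff u x y = l * (met u x y + met u e x * met u e y)"
    using sff_form[OF assms] by metis
  have "lam u = l" by (rule lam_eq[OF assms le])
  then show thesis using that[of e] le by blast
qed

lemma normal_deriv_lam:
  assumes "u \<in> S" "met u e e = 1" "\<And>x y. sff u x y = lam u * (met u x y + met u e x * met u e y)"
  shows "dir_deriv x normal u = - (lam u *\<^sub>R (dir_deriv x F u + met u e x *\<^sub>R dir_deriv e F u))"
  by (rule frame_ext[OF assms(1)])
    (simp_all add: normal_deriv_inner[OF assms(1)] assms(3) inner_add_left normal_orthogonal[OF assms(1)])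

text \<open>Since \<open>e\<close> is a unit vector it disappears from the estimates. They compare
  \<open>sff\<close> with \<open>lam\<close> even where \<open>e\<close> varies
  discontinuously.\<close>

lemma sff_bounds:
  assumes "u \<in> S"
  shows "\<bar>sff u x y\<bar> \<le> \<bar>lam u\<bar> * (2 * norm (dir_deriv x F u) * norm (dir_deriv y F u))"
    and "\<bar>lam u\<bar> * met u x x \<le> \<bar>sff u x x\<bar>"
proof -
  obtain e where e: "met u e e = 1" "\<And>x y. sff u x y = lam u * (met u x y + met u e x * met u e y)"
    by (rule sff_lam[OF assms]) (rule that)
  have ne: "norm (dir_deriv e F u) = 1" using e(1) by (simp add: norm_eq_1)
  have b: "\<bar>met u e z\<bar> \<le> norm (dir_deriv z F u)" for z
    using Cauchy_Schwarz_ineq2[of "dir_deriv e F u" "dir_deriv z F u"] ne by simp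
  have "\<bar>met u x y + met u e x * met u e y\<bar> \<le> \<bar>met u x y\<bar> + \<bar>met u e x\<bar> * \<bar>met u e y\<bar>"
    using abs_triangle_ineq[of "met u x y" "met u e x * met u e y"] by (simp add: abs_mult)
  also have "\<dots> \<le> norm (dir_deriv x F u) * norm (dir_deriv y F u)
      + norm (dir_deriv x F u) * norm (dir_deriv y F u)"
    by (intro add_mono Cauchy_Schwarz_ineq2 mult_mono b) auto
  finally have "\<bar>met u x y + met u e x * met u e y\<bar> \<le> 2 * norm (dir_deriv x F u) * norm (dir_deriv y F u)"
    by simp
  then show "\<bar>sff u x y\<bar> \<le> \<bar>lam u\<bar> * (2 * norm (dir_deriv x F u) * norm (dir_deriv y F u))"
    unfolding e(2) abs_mult by (intro mult_left_mono) auto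
  have "met u x x \<le> \<bar>met u x x + met u e x * met u e x\<bar>" by simp
  then show "\<bar>lam u\<bar> * met u x x \<le> \<bar>sff u x x\<bar>"
    unfolding e(2) abs_mult by (intro mult_left_mono) auto
qed

text \<open>
  At a zero of \<open>lam\<close> the Codazzi equation makes \<open>D\<^sub>z h(x, y)\<close> totally symmetric. It vanishes
  for \<open>z\<close> in the kernel of \<open>D lam\<close>, hence \<open>D\<^sub>x h(z, z) = 0\<close> for all \<open>x\<close>, and \<open>\<bar>h(z, z)\<bar>\<close>
  dominates \<open>\<bar>lam\<bar>\<close>.
\<close>

lemma lam_zero_deriv:
  assumes u: "u \<in> S" and l0: "lam u = 0"
  shows "dir_deriv x lam u = 0"
proof -
  have dl: "lam differentiable at u" by (rule smooth_on_differentiable[OF smooth_lam u])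
  have dh: "(\<lambda>u. sff u x y) differentiable at u" for x y
    by (rule smooth_on_differentiable[OF smooth_sff u])
  have cF: "continuous_on S (dir_deriv y F)" for y
    by (rule smooth_on_continuous[OF smooth_dF])
  obtain z where z: "z \<noteq> 0" "dir_deriv z lam u = 0"
    using common_kernel[OF linear_dir_deriv[OF dl] linear_dir_deriv[OF dl]] by metis
  have Dz: "dir_deriv z (\<lambda>u. sff u x y) u = 0" for x y
    by (rule dir_deriv_dominated[OF open_S u dh dl, of "\<lambda>v. 2 * norm (dir_deriv x F v) * norm (dir_deriv y F v)"])
      (auto intro!: continuous_intros cF sff_bounds l0 z(2))
  \<comment> \<open>The shape operator vanishes at \<open>u\<close>, so differentiating
    \<open>sff\<close> leaves only the normal part of the third derivatives of \<open>F\<close>,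
    which are symmetric.\<close>
  have "sff u x y = 0" for x y using sff_bounds(1)[OF u, of x y] l0 by simp
  then have "dir_deriv x normal u = 0" for x
    by (intro frame_ext[OF u]) (simp_all add: normal_deriv_inner[OF u])
  then have Dsff: "dir_deriv a (\<lambda>u. sff u x y) u = dir_deriv a (dir_deriv x (dir_deriv y F)) u \<bullet> normal u"
    for a x y
    unfolding sff_def
    by (simp add: dir_deriv_inner smooth_on_differentiable[OF smooth_ddF u] smooth_on_differentiable[OF smooth_normal u])
  have "dir_deriv x (\<lambda>u. sff u z z) u = dir_deriv z (\<lambda>u. sff u x z) u"
    unfolding Dsff using dir_deriv_commute[OF open_S u smooth_dF, of x z z] by simp
  then have "dir_deriv x (\<lambda>u. sff u z z) u = 0" by (simp only: Dz)
  moreover have "sff u z z = 0" using sff_bounds(1)[OF u, of z z] l0 by simp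
  ultimately show ?thesis
  proof (intro dir_deriv_dominated[OF open_S u dl dh, of "\<lambda>v. inverse (met v z z)" z z])
    show "continuous_on S (\<lambda>v. inverse (met v z z))"
      using met_pos[OF _ z(1)] by (intro continuous_intros cF) force
    show "\<bar>lam v\<bar> \<le> \<bar>sff v z z\<bar> * inverse (met v z z)" if "v \<in> S" for v
      using sff_bounds(2)[OF that, of z] met_pos[OF that z(1)] by (simp add: field_simps)
  qed auto
qed

text \<open>The squared length of the axis vector, written with the inverse metric as
  \<open>lam^4\<close> plus the squared gradient. In this form it is defined and continuous also at
  zeros of \<open>lam\<close>.\<close>

definition energy :: "real ^ 3 \<Rightarrow> real" where
  "energy u = lam u ^ 4 + (\<Sum>i\<in>UNIV. \<Sum>j\<in>UNIV.
     ginv u i j * (dir_deriv (axis i 1) lam u * dir_deriv (axis j 1) lam u))"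

lemma continuous_energy: "continuous_on S energy"
  unfolding energy_def[abs_def]
  by (intro continuous_intros smooth_on_continuous[OF smooth_lam] smooth_on_continuous[OF smooth_ginv]
      smooth_on_continuous[OF smooth_on_dir_deriv[OF smooth_lam]])

lemma energy_zero: "u \<in> S \<Longrightarrow> lam u = 0 \<Longrightarrow> energy u = 0"
  by (simp add: energy_def lam_zero_deriv)

lemma energy_locally_constant:
  assumes p: "p \<in> S" and lp: "lam p \<noteq> 0"
  obtains r where "r > 0" "ball p r \<subseteq> S" "\<And>u. u \<in> ball p r \<Longrightarrow> energy u = energy p" "energy p > 0"
proof -
  obtain x0 where x0: "met p x0 x0 = 1" "\<And>x y. sff p x y = lam p * (met p x y + met p x0 x * met p x0 y)"
    by (rule sff_lam[OF p]) (rule that)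
  \<comment> \<open>\<open>Q u\<close> is the square of the component of \<open>x0\<close> along the
    principal direction. It is 1 at \<open>p\<close>, where \<open>x0\<close> is that direction,
    hence positive nearby.\<close>
  define Q where "Q u = sff u x0 x0 / lam u - met u x0 x0" for u
  have "open (S \<inter> lam -` (- {0}))"
    by (rule continuous_open_preimage[OF smooth_on_continuous[OF smooth_lam] open_S]) auto
  then have o1: "open {u \<in> S. lam u \<noteq> 0}" (is "open ?U1") by (simp add: vimage_def Int_def)
  note sub1 = smooth_on_subset[of S _ ?U1]
  have smQ: "smooth_on ?U1 Q"
    unfolding Q_def
    by (intro smooth_on_diff smooth_on_divide smooth_on_inner o1 sub1[OF smooth_sff] sub1[OF smooth_lam]
        sub1[OF smooth_dF]) auto
  define U where "U = {u \<in> S. lam u \<noteq> 0 \<and> Q u > 0}"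
  have "open (?U1 \<inter> Q -` {0<..})"
    by (rule continuous_open_preimage[OF smooth_on_continuous[OF smQ] o1]) auto
  moreover have "?U1 \<inter> Q -` {0<..} = U" by (auto simp: U_def)
  ultimately have oU: "open U" by simp
  have US: "U \<subseteq> S" by (auto simp: U_def)
  have pU: "p \<in> U" using p lp x0(1) by (simp add: U_def Q_def x0(2))
  note subU = smooth_on_subset[OF _ US]
  have lU: "lam u \<noteq> 0" and QU: "Q u > 0" if "u \<in> U" for u using that by (auto simp: U_def)
  \<comment> \<open>A smooth local choice of the principal direction. The bracket equals
    \<open>- met u e x0\<close> times the image of \<open>e\<close>, and division by
    \<open>sqrt (Q u)\<close> normalises it up to a sign that makes the product with
    \<open>dir_deriv x0 F u\<close> positive.\<close>
  define T where "T u = (- 1 / sqrt (Q u)) *\<^sub>R ((1 / lam u) *\<^sub>R dir_deriv x0 normal u + dir_deriv x0 F u)" for u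
  have smT: "smooth_on U T"
    unfolding T_def
  proof (intro smooth_on_scaleR smooth_on_divide smooth_on_add smooth_on_sqrt smooth_on_const oU)
    show "smooth_on U Q" using smQ by (rule smooth_on_subset) (auto simp: U_def)
  qed (auto intro: subU smooth_lam smooth_on_dir_deriv smooth_normal smooth_F simp: lU QU
      less_imp_neq[OF QU, symmetric])
  have T: "\<exists>e. met u e e = 1 \<and> T u = dir_deriv e F u \<and> T u \<bullet> dir_deriv x0 F u \<noteq> 0 \<and>
      (\<forall>x y. sff u x y = lam u * (met u x y + met u e x * met u e y))" if u: "u \<in> U" for u
  proof -
    have uS: "u \<in> S" and lu: "lam u \<noteq> 0" and Qu: "Q u > 0" using u by (auto simp: U_def)
    obtain e where e: "met u e e = 1" "\<And>x y. sff u x y = lam u * (met u x y + met u e x * met u e y)"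
      by (rule sff_lam[OF uS]) (rule that)
    define s where "s = met u e x0"
    have "Q u = s\<^sup>2" using lu by (simp add: Q_def e(2) s_def power2_eq_square)
    then have s0: "s \<noteq> 0" and sq: "sqrt (Q u) = \<bar>s\<bar>" using Qu by auto
    have T: "T u = (s / \<bar>s\<bar>) *\<^sub>R dir_deriv e F u"
      unfolding T_def sq normal_deriv_lam[OF uS e] s_def[symmetric] using lu by simp
    define e' where "e' = (s / \<bar>s\<bar>) *\<^sub>R e"
    have Te': "T u = dir_deriv e' F u"
      by (simp add: T e'_def linear_cmul[OF linear_dF[OF uS]])
    have c2: "(s / \<bar>s\<bar>) * (s / \<bar>s\<bar>) = 1" using s0 by (simp add: abs_if)
    have ee: "met u e' x * met u e' y = met u e x * met u e y" for x y
    proof -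
      have "met u e' x * met u e' y = ((s / \<bar>s\<bar>) * (s / \<bar>s\<bar>)) * (met u e x * met u e y)"
        by (simp only: Te'[symmetric] T inner_scaleR_left mult_ac)
      then show ?thesis by (simp only: c2 mult_1)
    qed
    have "met u e' e' = ((s / \<bar>s\<bar>) * (s / \<bar>s\<bar>)) * met u e e"
      by (simp only: Te'[symmetric] T inner_scaleR_left inner_scaleR_right mult.assoc)
    then have "met u e' e' = 1" by (simp only: c2 e(1) mult_1)
    moreover have "T u \<bullet> dir_deriv x0 F u \<noteq> 0"
      using s0 by (simp add: T flip: s_def)
    ultimately show ?thesis using Te' e(2) ee by metis
  qed
  have TT: "T u \<bullet> T u = 1" if "u \<in> U" for u using T[OF that] by auto
  have TN: "T u \<bullet> normal u = 0" if "u \<in> U" for u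
    using T[OF that] normal_orthogonal that US by auto
  have dN: "dir_deriv x normal u = - (lam u *\<^sub>R (dir_deriv x F u + (T u \<bullet> dir_deriv x F u) *\<^sub>R T u))"
    if "u \<in> U" for u x
    using T[OF that] normal_deriv_lam[of u] that US by auto
  have Tx0: "T u \<bullet> dir_deriv x0 F u \<noteq> 0" if "u \<in> U" for u using T[OF that] by blast
  define m where "m u = dir_deriv x0 lam u / (T u \<bullet> dir_deriv x0 F u)" for u
  define W where "W u = (lam u * lam u) *\<^sub>R T u + m u *\<^sub>R normal u" for u
  have ax: "smooth_on U W" "\<And>u x. u \<in> U \<Longrightarrow> dir_deriv x lam u = m u * (T u \<bullet> dir_deriv x F u)"
    "\<And>u x. u \<in> U \<Longrightarrow> dir_deriv x W u = 0"
    unfolding W_def[abs_def] m_def[abs_def]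
    by (rule axis_constant[OF oU US smT subU[OF smooth_lam] lU TT TN dN Tx0]; assumption)+
  have energy_W: "energy u = W u \<bullet> W u" "energy u > 0" if u: "u \<in> U" for u
  proof -
    have uS: "u \<in> S" using u US by blast
    obtain e where e: "met u e e = 1" "T u = dir_deriv e F u" using T[OF u] by blast
    have "energy u = lam u ^ 4 + m u * m u * (\<Sum>i\<in>UNIV. \<Sum>j\<in>UNIV.
        ginv u i j * (met u e (axis i 1) * met u e (axis j 1)))"
      unfolding energy_def ax(2)[OF u] e(2) by (simp add: sum_distrib_left mult_ac)
    then have E: "energy u = lam u ^ 4 + m u * m u"
      unfolding ginv_quadratic[OF uS] e(1) by simp
    then show "energy u = W u \<bullet> W u"
      unfolding W_def
      by (simp add: inner_add_left inner_add_right TT[OF u] TN[OF u] normal_normal[OF uS]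
          TN[OF u, unfolded inner_commute[of "T u"]] power4_eq_xxxx)
    have "lam u ^ 4 > 0" using lU[OF u] by (simp add: zero_less_power_eq)
    then show "energy u > 0" unfolding E by (simp add: add_pos_nonneg)
  qed
  obtain r where r: "r > 0" "ball p r \<subseteq> U" using oU pU open_contains_ball by blast
  have "W u = W p" if "u \<in> ball p r" for u
    by (rule dir_deriv_zero_constant[OF open_ball convex_ball smooth_on_subset[OF ax(1) r(2)] ax(3)])
      (use r that in auto)
  then have "energy u = energy p" if "u \<in> ball p r" for u
    using energy_W(1) that r pU by (metis subsetD)
  moreover have "ball p r \<subseteq> S" using r US by blast
  ultimately show thesis using that[of r] r energy_W(2)[OF pU] by blast
qed

text \<open>The level set of \<open>energy\<close> through \<open>p\<close> is closed by continuity.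
  It is also open: its value is positive, so \<open>lam\<close> has no zero on it and
  \<open>energy\<close> is locally constant there. By connectedness it is all of
  \<open>S\<close>.\<close>

lemma lam_zero_or_nonzero:
  assumes "connected S" "p \<in> S" "lam p \<noteq> 0" "u \<in> S"
  shows "lam u \<noteq> 0"
proof -
  define A where "A = {u \<in> S. energy u = energy p}"
  have Ep: "energy p > 0" by (rule energy_locally_constant[OF assms(2,3)])
  have "closedin (top_of_set S) A"
    unfolding A_def by (rule continuous_closedin_preimage_constant[OF continuous_energy])
  moreover have "openin (top_of_set S) A"
  proof (subst openin_contains_ball, intro conjI ballI)
    show "A \<subseteq> S" by (auto simp: A_def)
    fix v assume v: "v \<in> A"
    then have vS: "v \<in> S" and Ev: "energy v = energy p" by (auto simp: A_def)
    have "lam v \<noteq> 0" using energy_zero[OF vS] Ev Ep by auto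
    then obtain r where "r > 0" "ball v r \<subseteq> S" "\<And>u. u \<in> ball v r \<Longrightarrow> energy u = energy v"
      using energy_locally_constant[OF vS] by metis
    then show "\<exists>e>0. ball v e \<inter> S \<subseteq> A" using Ev by (auto simp: A_def)
  qed
  ultimately have "A = S"
    using assms(1,2) unfolding connected_clopen A_def by blast
  then have "energy u = energy p" using assms(4) by (auto simp: A_def)
  then show ?thesis using energy_zero[OF assms(4)] Ep by auto
qed

end

subsection \<open>Congruence of isometric patches\<close>

lemma riemann_cong:
  assumes "open S" "u \<in> S" "\<And>x. x \<in> S \<Longrightarrow> g x = g' x"
  shows "riemann g u = riemann g' u"
proof -
  have "partial i (\<lambda>u. g u $ j $ l) v = partial i (\<lambda>u. g' u $ j $ l) v" if "v \<in> S" for i j l v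
    unfolding partial_def dir_deriv_def[symmetric]
    by (rule dir_deriv_cong[OF assms(1) that]) (simp add: assms(3))
  then have chr: "christoffel g k i j v = christoffel g' k i j v" if "v \<in> S" for k i j v
    unfolding christoffel_def using assms(3)[OF that] that by simp
  have "partial a (christoffel g k i j) u = partial a (christoffel g' k i j) u" for a k i j
    unfolding partial_def dir_deriv_def[symmetric]
    by (rule dir_deriv_cong[OF assms(1,2)]) (rule chr)
  then have "riemann_component g l k i j u = riemann_component g' l k i j u" for l k i j
    unfolding riemann_component_def by (simp add: chr[OF assms(2)])
  then show ?thesis unfolding riemann_def by simp
qed

text \<open>The algebraic core of the Beez-Killing theorem: a symmetric 3 by 3 matrix whose 2 by 2
  minors are those of \<open>diag(l, l, 2 l)\<close>, with \<open>L = l^2\<close>, has vanishing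
  \<open>b\<close> and \<open>c\<close> and first entry \<open>l\<close> or
  \<open>-l\<close>.\<close>

lemma equal_minors:
  fixes a b c d e f L :: real
  assumes "a * d - b * b = L" "a * f - c * c = 2 * L" "d * f - e * e = 2 * L"
    and "a * e = b * c" "c * d = b * e" "b * f = c * e" and L: "L > 0"
  shows "b = 0" "c = 0" "a * a = L"
proof -
  \<comment> \<open>Multiplying the invertible minor by \<open>b\<close> lets the mixed relations
    turn both terms into the same product.\<close>
  have "b * (2 * L) = d * (b * f) - e * (b * e)"
    unfolding assms(3)[symmetric] by (simp add: algebra_simps)
  also have "\<dots> = 0" unfolding assms(6) assms(5)[symmetric] by simp
  finally show b: "b = 0" using L by simp
  have "c * (2 * L) = f * (c * d) - e * (c * e)"
    unfolding assms(3)[symmetric] by (simp add: algebra_simps)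
  also have "\<dots> = 0" unfolding assms(5) assms(6)[symmetric] by simp
  finally show c: "c = 0" using L by simp
  have ad: "a * d = L" and af: "a * f = 2 * L" using assms(1,2) b c by auto
  then have "a \<noteq> 0" "f \<noteq> 0" using L by auto
  then have "e = 0" using assms(4) b by simp
  then have "d * f = a * f" using assms(3) af by simp
  then have "d = a" using \<open>f \<noteq> 0\<close> by simp
  then show "a * a = L" using ad by simp
qed

context hypersurface_patch
begin

lemma decompose:
  assumes "u \<in> S"
  obtains x c where "w = dir_deriv x F u + c *\<^sub>R normal u"
proof -
  have "normal u \<bullet> (w - (w \<bullet> normal u) *\<^sub>R normal u) = 0"
    by (simp add: inner_diff_right normal_normal[OF assms] inner_commute)
  then obtain x where "w - (w \<bullet> normal u) *\<^sub>R normal u = dir_deriv x F u"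
    using tangentE[OF assms] by metis
  then show thesis using that[of x "w \<bullet> normal u"] by (simp add: algebra_simps)
qed

lemma orthonormal_triple_ext:
  assumes u: "u \<in> S" and "met u x x = 1" "met u y y = 1" "met u z z = 1"
    and "met u x y = 0" "met u x z = 0" "met u y z = 0"
    and \<phi>: "linear \<phi>" "\<phi> x = 0" "\<phi> y = 0" "\<phi> z = (0::real)"
  shows "\<phi> v = 0"
proof -
  define E where "E a = a $ 1 *\<^sub>R x + a $ 2 *\<^sub>R y + a $ 3 *\<^sub>R z" for a :: "real ^ 3"
  define w where "w = v - (met u x v *\<^sub>R x + met u y v *\<^sub>R y + met u z v *\<^sub>R z)"
  have "met u y x = 0" "met u z x = 0" "met u z y = 0"
    using assms(5-7) by (simp_all add: inner_commute)
  note sm = assms(2-7) this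
  note linF = linear_dF[OF u]
  note lins = linear_add[OF linF] linear_cmul[OF linF] linear_diff[OF linF]
  have linE: "linear (\<lambda>a. dir_deriv (E a) F u)"
    by (rule linearI) (simp_all add: E_def lins algebra_simps)
  have norm: "met u (E a) (E a) = a \<bullet> a" for a
    by (simp add: E_def lins inner_add_left inner_add_right sm inner_vec_def[of a a] sum_3)
  have injE: "inj (\<lambda>a. dir_deriv (E a) F u)"
    unfolding linear_injective_0[OF linE]
  proof (intro allI impI)
    show "a = 0" if "dir_deriv (E a) F u = 0" for a using norm[of a] that by simp
  qed
  have "dir_deriv w F u = 0"
  proof (rule hyperplane_ext[OF linE injE norm_normal[OF u]])
    show "normal u \<bullet> dir_deriv (E a) F u = 0" for a by (rule normal_orthogonal[OF u])
    show "dir_deriv w F u \<bullet> normal u = 0 \<bullet> normal u" by (simp add: normal_orthogonal[OF u])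
    have "dir_deriv w F u \<bullet> dir_deriv x F u = 0" "dir_deriv w F u \<bullet> dir_deriv y F u = 0"
      "dir_deriv w F u \<bullet> dir_deriv z F u = 0"
      by (simp_all add: w_def lins inner_add_left inner_diff_left sm inner_commute[of "dir_deriv v F u"])
    then show "dir_deriv w F u \<bullet> dir_deriv (E a) F u = 0 \<bullet> dir_deriv (E a) F u" for a
      by (simp add: E_def lins inner_add_right)
  qed
  then have "w = 0" by (simp add: dF_eq_0_iff[OF u])
  then have "v = met u x v *\<^sub>R x + met u y v *\<^sub>R y + met u z v *\<^sub>R z" by (simp add: w_def)
  then have "\<phi> v = \<phi> (met u x v *\<^sub>R x + met u y v *\<^sub>R y + met u z v *\<^sub>R z)" by (rule arg_cong)
  then show ?thesis by (simp add: linear_add[OF \<phi>(1)] linear_cmul[OF \<phi>(1)] \<phi>)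
qed

text \<open>The tangential part of the second derivatives of \<open>F\<close> is expressed by
  derivatives of the metric alone, hence it is shared by isometric patches.\<close>

lemma koszul:
  assumes "u \<in> S"
  shows "2 * (dir_deriv x (dir_deriv y F) u \<bullet> dir_deriv z F u)
    = dir_deriv x (\<lambda>u. met u y z) u + dir_deriv y (\<lambda>u. met u x z) u - dir_deriv z (\<lambda>u. met u x y) u"
proof -
  note d = smooth_on_differentiable[OF smooth_dF assms]
  show ?thesis
    unfolding dir_deriv_inner[OF d d]
    using ddF_commute[OF assms, of x y] ddF_commute[OF assms, of x z] ddF_commute[OF assms, of y z]
    by (simp add: inner_commute)
qed

lemma unit_perp_exists:
  fixes \<phi> \<psi> :: "real ^ 3 \<Rightarrow> real"
  assumes "u \<in> S" "linear \<phi>" "linear \<psi>"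
  obtains x where "met u x x = 1" "\<phi> x = 0" "\<psi> x = 0"
proof -
  obtain y where y: "y \<noteq> 0" "\<phi> y = 0" "\<psi> y = 0" using common_kernel[OF assms(2,3)] by metis
  define c where "c = inverse (sqrt (met u y y))"
  have "met u (c *\<^sub>R y) (c *\<^sub>R y) = c * c * met u y y"
    by (simp add: linear_cmul[OF linear_dF[OF assms(1)]])
  also have "\<dots> = 1" using met_pos[OF assms(1) y(1)] by (simp add: c_def field_simps)
  finally show thesis
    using that[of "c *\<^sub>R y"] y by (simp add: linear_cmul[OF assms(2)] linear_cmul[OF assms(3)])
qed

end

lemma sff_determined:
  assumes "casorati_patch S F" "hypersurface_patch S G"
    and same: "\<And>u. u \<in> S \<Longrightarrow> first_fundamental_form F u = first_fundamental_form G u"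
    and u: "u \<in> S" and l0: "hypersurface_patch.lam F u \<noteq> 0"
  obtains s where "s = 1 \<or> s = (-1::real)"
    "\<And>x y. hypersurface_patch.sff G u x y = s * hypersurface_patch.sff F u x y"
proof -
  interpret P: casorati_patch S F by fact
  interpret Q: hypersurface_patch S G by fact
  have gauss: "P.sff u y z * P.sff u x w - P.sff u x z * P.sff u y w
      = Q.sff u y z * Q.sff u x w - Q.sff u x z * Q.sff u y w" for x y z w
  proof -
    have "metric_inner P.fff u a b = metric_inner Q.fff u a b" for a b
      by (simp add: metric_inner_def same[OF u])
    then show ?thesis
      using P.gauss_equation[OF u, of x y z w] Q.gauss_equation[OF u, of x y z w]
        riemann_cong[OF P.open_S u same] by simp
  qed
  obtain e where e: "P.met u e e = 1"
    "\<And>x y. P.sff u x y = P.lam u * (P.met u x y + P.met u e x * P.met u e y)"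
    by (rule P.sff_lam[OF u]) (rule that)
  obtain x where x: "P.met u x x = 1" "P.met u e x = 0"
    using P.unit_perp_exists[OF u P.met_linear(1)[OF u, of e] P.met_linear(1)[OF u, of e]] by metis
  obtain y where y: "P.met u y y = 1" "P.met u e y = 0" "P.met u x y = 0"
    using P.unit_perp_exists[OF u P.met_linear(1)[OF u, of e] P.met_linear(1)[OF u, of x]] by metis
  have com: "P.met u x e = 0" "P.met u y e = 0" "P.met u y x = 0"
    using x y by (simp_all add: inner_commute)
  let ?l = "P.lam u"
  have h: "P.sff u x x = ?l" "P.sff u y y = ?l" "P.sff u e e = 2 * ?l" "P.sff u x y = 0" "P.sff u y x = 0"
    "P.sff u x e = 0" "P.sff u y e = 0" "P.sff u e x = 0" "P.sff u e y = 0"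
    by (simp_all add: e x y com)
  note qc = Q.sff_commute[OF u, of y x] Q.sff_commute[OF u, of e x] Q.sff_commute[OF u, of e y]
  \<comment> \<open>The Gauss equations in the principal frame \<open>x\<close>, \<open>y\<close>,
    \<open>e\<close> of \<open>F\<close>, arranged as the hypotheses of
    \<open>equal_minors\<close>.\<close>
  have minors: "Q.sff u x x * Q.sff u y y - Q.sff u x y * Q.sff u x y = ?l * ?l"
    "Q.sff u x x * Q.sff u e e - Q.sff u x e * Q.sff u x e = 2 * (?l * ?l)"
    "Q.sff u y y * Q.sff u e e - Q.sff u y e * Q.sff u y e = 2 * (?l * ?l)"
    "Q.sff u x x * Q.sff u y e = Q.sff u x y * Q.sff u x e"
    "Q.sff u x e * Q.sff u y y = Q.sff u x y * Q.sff u y e"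
    "Q.sff u x y * Q.sff u e e = Q.sff u x e * Q.sff u y e"
    using gauss[of x y y x] gauss[of x e e x] gauss[of y e e y] gauss[of x y e x] gauss[of x y y e]
      gauss[of x e e y] by (simp_all add: h qc algebra_simps)
  have "?l * ?l > 0" using l0 by (auto simp: zero_less_mult_iff linorder_neq_iff)
  note a = equal_minors[OF minors this]
  define s where "s = Q.sff u x x / ?l"
  have s2: "s * s = 1" using a(3) l0 by (simp add: s_def)
  then have s: "s = 1 \<or> s = -1" by (simp add: square_eq_1_iff)
  define \<phi> where "\<phi> v = Q.sff u x v - s * P.sff u x v" for v
  have lin: "linear \<phi>"
    unfolding \<phi>_def
    by (rule linearI) (simp_all add: linear_add[OF P.linear_sff(2)[OF u]] linear_cmul[OF P.linear_sff(2)[OF u]]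
        linear_add[OF Q.linear_sff(2)[OF u]] linear_cmul[OF Q.linear_sff(2)[OF u]] algebra_simps)
  have "\<phi> v = 0" for v
    by (rule P.orthonormal_triple_ext[OF u x(1) y(1) e(1) y(3) com(1,2) lin])
      (use l0 in \<open>simp_all add: \<phi>_def s_def a h\<close>)
  then have x_eq: "Q.sff u x v = s * P.sff u x v" "Q.sff u v x = s * P.sff u v x" for v
    using Q.sff_commute[OF u, of v x] P.sff_commute[OF u, of v x] by (simp_all add: \<phi>_def)
  have "Q.sff u v w = s * P.sff u v w" for v w
  proof -
    \<comment> \<open>A Gauss equation with \<open>x\<close> in two slots is linear in the entry for
      \<open>v\<close>, \<open>w\<close> with nonzero coefficient \<open>?l\<close> up to sign, so
      the row of \<open>x\<close> determines all other entries.\<close>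
    have "P.sff u v w * ?l = Q.sff u v w * (s * ?l) + (P.sff u x w * P.sff u v x
        - (s * s) * (P.sff u x w * P.sff u v x))"
      using gauss[of v w x x] by (simp add: x_eq h(1) algebra_simps)
    then have "P.sff u v w = s * Q.sff u v w" using l0 by (simp add: s2)
    then have "s * P.sff u v w = (s * s) * Q.sff u v w" by simp
    then show ?thesis by (simp add: s2)
  qed
  then show thesis using that s by blast
qed

text \<open>The linear map taking the tangent frame and normal of \<open>F\<close> to those of
  \<open>G\<close> is shown to be constant. This constant map is the rotational part of the
  isometry, possibly orientation reversing.\<close>

lemma congruent_patches:
  assumes F: "casorati_patch S F" and G: "hypersurface_patch S G" and S: "convex S"
    and same: "\<And>u. u \<in> S \<Longrightarrow> first_fundamental_form F u = first_fundamental_form G u"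
    and l0: "\<And>u. u \<in> S \<Longrightarrow> hypersurface_patch.lam F u \<noteq> 0"
    and u0: "u0 \<in> S"
  obtains T where "euclidean_isometry T" "\<And>u. u \<in> S \<Longrightarrow> G u = T (F u)"
proof -
  interpret P: casorati_patch S F by fact
  interpret Q: hypersurface_patch S G by fact
  let ?e = "\<lambda>i. axis i 1 :: real ^ 3"
  have met: "P.met u x y = Q.met u x y" if "u \<in> S" for u x y
    using P.metric_inner_fff[OF that, of x y] Q.metric_inner_fff[OF that, of x y] same[OF that]
    by (simp add: metric_inner_def)
  \<comment> \<open>The sign must not depend on the point. The ratio of one component is continuous
    with finitely many values on a connected set.\<close>
  have "\<exists>s. s \<in> {1, -1} \<and> (\<forall>u\<in>S. \<forall>x y. Q.sff u x y = s * P.sff u x y)"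
  proof -
    define \<sigma> where "\<sigma> u = Q.sff u (?e 1) (?e 1) / P.sff u (?e 1) (?e 1)" for u
    have nz: "P.sff u (?e 1) (?e 1) \<noteq> 0" if "u \<in> S" for u
    proof -
      have "?e 1 \<noteq> 0" by simp
      then have "\<bar>P.lam u\<bar> * P.met u (?e 1) (?e 1) > 0"
        using P.met_pos[OF that] l0[OF that] by (intro mult_pos_pos) auto
      then show ?thesis using P.sff_bounds(2)[OF that, of "?e 1"] by linarith
    qed
    have val: "\<sigma> u \<in> {1, -1} \<and> (\<forall>x y. Q.sff u x y = \<sigma> u * P.sff u x y)" if u: "u \<in> S" for u
    proof -
      obtain s where s: "s = 1 \<or> s = (-1::real)" "\<And>x y. Q.sff u x y = s * P.sff u x y"
        by (rule sff_determined[OF F G same u l0[OF u]]) (assumption | rule that)+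
      then have "\<sigma> u = s" using nz[OF u] by (simp add: \<sigma>_def)
      then show ?thesis using s by simp
    qed
    have "continuous_on S \<sigma>"
      unfolding \<sigma>_def using nz
      by (intro continuous_intros smooth_on_continuous[OF P.smooth_sff] smooth_on_continuous[OF Q.smooth_sff]) auto
    moreover have "finite (\<sigma> ` S)"
      by (rule finite_subset[of _ "{1, -1}"]) (use val in auto)
    ultimately have "\<sigma> constant_on S"
      using convex_connected[OF S] continuous_finite_range_constant by blast
    then obtain c where "\<And>u. u \<in> S \<Longrightarrow> \<sigma> u = c" by (auto simp: constant_on_def)
    then show ?thesis using val u0 by metis
  qed
  then obtain s where s: "s = 1 \<or> s = (-1::real)" and sff: "\<And>u x y. u \<in> S \<Longrightarrow> Q.sff u x y = s * P.sff u x y"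
    by auto
  have ss: "s * s = 1" using s by auto
  \<comment> \<open>Raising an index with the inverse metric extracts the tangential coordinates of
    \<open>w\<close>, so \<open>R\<close> is explicitly smooth in \<open>u\<close>.\<close>
  define R where "R u w = (\<Sum>i\<in>UNIV. \<Sum>j\<in>UNIV. (P.ginv u i j * (w \<bullet> dir_deriv (?e j) F u)) *\<^sub>R dir_deriv (?e i) G u)
      + (s * (w \<bullet> P.normal u)) *\<^sub>R Q.normal u" for u w
  have linR: "linear (R u)" for u
    by (rule linearI)
      (simp_all add: R_def inner_add_left algebra_simps sum.distrib scaleR_sum_right)
  have smR: "smooth_on S (\<lambda>u. R u w)" for w
    unfolding R_def
    by (intro smooth_on_add smooth_on_sum smooth_on_scaleR smooth_on_mult smooth_on_inner P.open_S
        smooth_on_const P.smooth_ginv P.smooth_dF Q.smooth_dF P.smooth_normal Q.smooth_normal)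
  have RN: "R u (P.normal u) = s *\<^sub>R Q.normal u" if "u \<in> S" for u
    by (simp add: R_def P.normal_orthogonal[OF that] P.normal_normal[OF that])
  have RF: "R u (dir_deriv x F u) = dir_deriv x G u" if u: "u \<in> S" for u x
  proof -
    have "R u (dir_deriv x F u) = (\<Sum>i\<in>UNIV. x $ i *\<^sub>R dir_deriv (?e i) G u)"
      by (simp add: R_def P.normal_orthogonal[OF u] P.ginv_met[OF u] flip: scaleR_sum_left)
    also have "\<dots> = dir_deriv x G u"
      by (rule linear_expand_axis[OF Q.linear_dF[OF u], symmetric])
    finally show ?thesis .
  qed
  have RR: "R u w \<bullet> R u w' = w \<bullet> w'" if u: "u \<in> S" for u w w'
  proof -
    obtain x c where w: "w = dir_deriv x F u + c *\<^sub>R P.normal u" using P.decompose[OF u] by metis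
    obtain y d where w': "w' = dir_deriv y F u + d *\<^sub>R P.normal u" using P.decompose[OF u] by metis
    show ?thesis
      unfolding w w' linear_add[OF linR] linear_cmul[OF linR] RF[OF u] RN[OF u]
      by (simp add: inner_add_left inner_add_right P.normal_orthogonal[OF u] Q.normal_orthogonal[OF u]
          P.normal_normal[OF u] Q.normal_normal[OF u] met[OF u] ss)
  qed
  have RG: "R u w \<bullet> dir_deriv y G u = w \<bullet> dir_deriv y F u" "R u w \<bullet> Q.normal u = s * (w \<bullet> P.normal u)"
    if u: "u \<in> S" for u w y
  proof -
    show "R u w \<bullet> dir_deriv y G u = w \<bullet> dir_deriv y F u"
      using RR[OF u, of w "dir_deriv y F u"] by (simp add: RF[OF u])
    have "w \<bullet> P.normal u = s * (R u w \<bullet> Q.normal u)"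
      using RR[OF u, of w "P.normal u"] by (simp add: RN[OF u])
    then have "s * (w \<bullet> P.normal u) = (s * s) * (R u w \<bullet> Q.normal u)" by simp
    then show "R u w \<bullet> Q.normal u = s * (w \<bullet> P.normal u)" by (simp add: ss)
  qed
  \<comment> \<open>Tangential parts agree by the Koszul identity, normal parts by proportionality
    of the second fundamental forms.\<close>
  have RFF: "R u (dir_deriv x (dir_deriv y F) u) = dir_deriv x (dir_deriv y G) u" if u: "u \<in> S" for u x y
  proof (rule Q.frame_ext[OF u])
    have "dir_deriv a (\<lambda>u. P.met u b c) u = dir_deriv a (\<lambda>u. Q.met u b c) u" for a b c
      by (rule dir_deriv_cong[OF P.open_S u met])
    then show "R u (dir_deriv x (dir_deriv y F) u) \<bullet> dir_deriv v G u
        = dir_deriv x (dir_deriv y G) u \<bullet> dir_deriv v G u" for v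
      using P.koszul[OF u, of x y v] Q.koszul[OF u, of x y v] by (simp add: RG[OF u])
    show "R u (dir_deriv x (dir_deriv y F) u) \<bullet> Q.normal u = dir_deriv x (dir_deriv y G) u \<bullet> Q.normal u"
      using sff[OF u, of x y] by (simp add: RG[OF u] P.sff_def Q.sff_def)
  qed
  have RdN: "R u (dir_deriv x P.normal u) = s *\<^sub>R dir_deriv x Q.normal u" if u: "u \<in> S" for u x
  proof (rule Q.frame_ext[OF u])
    show "R u (dir_deriv x P.normal u) \<bullet> dir_deriv v G u = s *\<^sub>R dir_deriv x Q.normal u \<bullet> dir_deriv v G u" for v
      using ss by (simp add: RG[OF u] P.normal_deriv_inner[OF u] Q.normal_deriv_inner[OF u] sff[OF u] flip: mult.assoc)
    show "R u (dir_deriv x P.normal u) \<bullet> Q.normal u = s *\<^sub>R dir_deriv x Q.normal u \<bullet> Q.normal u"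
      by (simp add: RG[OF u] P.normal_deriv_inner[OF u] Q.normal_deriv_inner[OF u])
  qed
  have dR: "dir_deriv y (\<lambda>u. R u w) u = 0" if u: "u \<in> S" for u w y
  proof (rule Q.frame_ext[OF u])
    note d = smooth_on_differentiable[OF smR u] smooth_on_differentiable[OF P.smooth_dF u]
      smooth_on_differentiable[OF Q.smooth_dF u] smooth_on_differentiable[OF P.smooth_normal u]
      smooth_on_differentiable[OF Q.smooth_normal u]
    have c0: "dir_deriv y (\<lambda>u. w) u = 0" for y and w :: "real ^ 4"
      by (rule dir_deriv_eqI) (rule has_derivative_const)
    have c1: "dir_deriv y (\<lambda>u. s) u = 0" for y by (rule dir_deriv_eqI) (rule has_derivative_const)
    \<comment> \<open>Differentiate \<open>RG\<close> with \<open>w\<close> fixed. Since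
      \<open>R\<close> also carries second derivatives of \<open>F\<close> to those of
      \<open>G\<close>, the derivative of \<open>R u w\<close> has no component along the tangent
      vectors of \<open>G\<close>.\<close>
    show "dir_deriv y (\<lambda>u. R u w) u \<bullet> dir_deriv v G u = 0 \<bullet> dir_deriv v G u" for v
    proof -
      have "dir_deriv y (\<lambda>u. R u w \<bullet> dir_deriv v G u) u = dir_deriv y (\<lambda>u. w \<bullet> dir_deriv v F u) u"
        by (rule dir_deriv_cong[OF P.open_S u RG(1)])
      then show ?thesis
        using RR[OF u, of w "dir_deriv y (dir_deriv v F) u"] by (simp add: dir_deriv_inner d c0 RFF[OF u])
    qed
    have "dir_deriv y (\<lambda>u. R u w \<bullet> Q.normal u) u = dir_deriv y (\<lambda>u. s * (w \<bullet> P.normal u)) u"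
      by (rule dir_deriv_cong[OF P.open_S u RG(2)])
    then have "R u w \<bullet> dir_deriv y Q.normal u + dir_deriv y (\<lambda>u. R u w) u \<bullet> Q.normal u
        = s * (w \<bullet> dir_deriv y P.normal u)"
      by (simp add: dir_deriv_inner dir_deriv_mult d c0 c1 differentiable_inner)
    moreover have "w \<bullet> dir_deriv y P.normal u = s * (R u w \<bullet> dir_deriv y Q.normal u)"
      using RR[OF u, of w "dir_deriv y P.normal u"] by (simp add: RdN[OF u])
    ultimately have "R u w \<bullet> dir_deriv y Q.normal u + dir_deriv y (\<lambda>u. R u w) u \<bullet> Q.normal u
        = (s * s) * (R u w \<bullet> dir_deriv y Q.normal u)" by simp
    then show "dir_deriv y (\<lambda>u. R u w) u \<bullet> Q.normal u = 0 \<bullet> Q.normal u" by (simp add: ss)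
  qed
  define R0 where "R0 = R u0"
  have R0: "R u w = R0 w" if "u \<in> S" for u w
    unfolding R0_def by (rule dir_deriv_zero_constant[OF P.open_S S smR dR that u0])
  have bl: "bounded_linear R0" unfolding R0_def by (rule linear_conv_bounded_linear[THEN iffD1, OF linR])
  \<comment> \<open>The translational part: once the rotation is fixed, \<open>G\<close> and the
    rotated \<open>F\<close> have equal differentials.\<close>
  define H where "H u = G u - R0 (F u)" for u
  have smH: "smooth_on S H"
    unfolding H_def by (intro smooth_on_diff smooth_on_linear[OF _ bl] P.open_S P.smooth_F Q.smooth_F)
  have dH: "dir_deriv x H u = 0" if u: "u \<in> S" for u x
  proof -
    have "dir_deriv x H u = dir_deriv x G u - R0 (dir_deriv x F u)"
      unfolding H_def
      by (rule dir_deriv_eqI) (intro has_derivative_diff bounded_linear.has_derivative[OF bl]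
          smooth_on_has_derivative[OF Q.smooth_F u] smooth_on_has_derivative[OF P.smooth_F u])
    then show ?thesis using RF[OF u, of x] R0[OF u] by simp
  qed
  define T where "T p = R0 p + H u0" for p
  have "orthogonal_transformation R0"
    unfolding orthogonal_transformation_def R0_def using linR RR[OF u0] by blast
  then have "surj R0" "\<And>p q. dist (R0 p) (R0 q) = dist p q"
    using orthogonal_transformation_surj orthogonal_transformation_isometry by blast+
  then have "euclidean_isometry T"
    unfolding euclidean_isometry_def T_def surj_def by (simp add: surj_def) (metis add.commute diff_add_cancel)
  moreover have "G u = T (F u)" if "u \<in> S" for u
    using dir_deriv_zero_constant[OF P.open_S S smH dH that u0] by (simp add: T_def H_def algebra_simps)
  ultimately show thesis using that by blast
qed

subsection \<open>Globalisation\<close>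

context casorati_patch
begin

lemma sff_zero_iff:
  assumes "u \<in> S"
  shows "(\<forall>x y. sff u x y = 0) \<longleftrightarrow> lam u = 0"
proof
  assume *: "\<forall>x y. sff u x y = 0"
  have "met u (axis 1 1) (axis 1 1) > 0" by (rule met_pos[OF assms]) simp
  moreover have "\<bar>lam u\<bar> * met u (axis 1 1) (axis 1 1) \<le> 0"
    using sff_bounds(2)[OF assms, of "axis 1 1"] * by simp
  ultimately show "lam u = 0"
    using mult_pos_pos[of "\<bar>lam u\<bar>" "met u (axis 1 1) (axis 1 1)"] by linarith
next
  assume "lam u = 0"
  then show "\<forall>x y. sff u x y = 0" using sff_bounds(1)[OF assms] by simp
qed

text \<open>One derivative of the equation of the hyperplane shows that \<open>n\<close> is normal
  to the patch, and the second derivative shows that the normal part of the second derivatives of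
  \<open>F\<close> vanishes.\<close>

lemma hyperplane_imp_lam_zero:
  assumes V: "open V" "V \<subseteq> S" "u \<in> V" and n: "n \<noteq> 0" "\<And>v. v \<in> V \<Longrightarrow> n \<bullet> F v = b"
  shows "lam u = 0"
proof -
  have z: "n \<bullet> dir_deriv x g v = 0" if "smooth_on S g" "v \<in> V" "\<And>v. v \<in> V \<Longrightarrow> n \<bullet> g v = c"
    for x v g c
  proof -
    have "n \<bullet> dir_deriv x g v = dir_deriv x (\<lambda>v. n \<bullet> g v) v"
      using that V by (intro dir_deriv_linear[OF bounded_linear_inner_right, symmetric]
          smooth_on_differentiable[OF that(1)]) auto
    also have "\<dots> = dir_deriv x (\<lambda>v. c) v" by (rule dir_deriv_cong[OF V(1) that(2,3)])
    also have "\<dots> = 0" by (rule dir_deriv_eqI) (rule has_derivative_const)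
    finally show ?thesis .
  qed
  have dF: "n \<bullet> dir_deriv x F v = 0" if "v \<in> V" for x v by (rule z[OF smooth_F that n(2)])
  have ddF: "n \<bullet> dir_deriv x (dir_deriv y F) u = 0" for x y by (rule z[OF smooth_dF V(3) dF])
  have uS: "u \<in> S" using V by blast
  have eq: "n = (n \<bullet> normal u) *\<^sub>R normal u"
    by (rule frame_ext[OF uS]) (simp_all add: dF V(3) normal_orthogonal[OF uS] normal_normal[OF uS])
  then have "n \<bullet> normal u \<noteq> 0" using n(1) by auto
  moreover have "(n \<bullet> normal u) * sff u x y = 0" for x y
  proof -
    have "(n \<bullet> normal u) * sff u x y = ((n \<bullet> normal u) *\<^sub>R normal u) \<bullet> dir_deriv x (dir_deriv y F) u"
      by (simp add: sff_def inner_commute)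
    also have "\<dots> = 0" unfolding eq[symmetric] by (rule ddF)
    finally show ?thesis .
  qed
  ultimately show ?thesis using sff_zero_iff[OF uS] by simp
qed

text \<open>One zero forces \<open>lam\<close> to vanish on the connected patch, so the normal is
  constant and its inner product with \<open>F\<close> has zero derivative.\<close>

lemma lam_zero_imp_hyperplane:
  assumes "convex S" "p \<in> S" "lam p = 0"
  obtains n b where "n \<noteq> 0" "\<And>v. v \<in> S \<Longrightarrow> n \<bullet> F v = b"
proof -
  have l0: "lam u = 0" if "u \<in> S" for u
    using lam_zero_or_nonzero[OF convex_connected[OF assms(1)] that _ assms(2)] assms(3) by blast
  have "dir_deriv x normal u = 0" if u: "u \<in> S" for u x
  proof -
    have "sff u x y = 0" for x y using sff_zero_iff[OF u] l0[OF u] by blast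
    then show ?thesis by (intro frame_ext[OF u]) (simp_all add: normal_deriv_inner[OF u])
  qed
  then have N: "normal u = normal p" if "u \<in> S" for u
    by (rule dir_deriv_zero_constant[OF open_S assms(1) smooth_normal _ that assms(2)])
  have "dir_deriv x (\<lambda>u. normal p \<bullet> F u) u = 0" if u: "u \<in> S" for u x
    using dir_deriv_linear[OF bounded_linear_inner_right smooth_on_differentiable[OF smooth_F u], of x "normal p"]
      normal_orthogonal(1)[OF u] N[OF u] by simp
  moreover have "smooth_on S (\<lambda>u. normal p \<bullet> F u)"
    by (intro smooth_on_inner open_S smooth_on_const smooth_F)
  ultimately have "normal p \<bullet> F v = normal p \<bullet> F p" if "v \<in> S" for v
    using dir_deriv_zero_constant[OF open_S assms(1) _ _ that assms(2)] by blast
  moreover have "normal p \<noteq> 0" using norm_normal[OF assms(2)] by auto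
  ultimately show thesis using that by blast
qed

end

section \<open>From charts to the manifold\<close>

lemma smooth_immersion_patch:
  assumes "smooth_immersion A f" "c \<in> A" "open S" "S \<subseteq> snd c ` fst c"
  shows "hypersurface_patch S (in_chart f c)"
proof
  show "open S" by fact
  show "smooth_on S (in_chart f c)"
    using assms(1,2,4) unfolding smooth_immersion_def by (meson smooth_on_subset)
  show "inj (\<lambda>v. dir_deriv v (in_chart f c) u)" if "u \<in> S" for u
    using assms(1,2,4) that unfolding smooth_immersion_def dir_deriv_def by auto
qed

lemma casorati_ideal_patch:
  assumes "smooth_immersion A f" "casorati_ideal A f" "c \<in> A" "open S"
    "S \<subseteq> snd c ` fst c"
  shows "casorati_patch S (in_chart f c)"
proof -
  interpret hypersurface_patch S "in_chart f c"
    by (rule smooth_immersion_patch[OF assms(1,3-5)])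
  show ?thesis
  proof
    fix u assume u: "u \<in> S"
    then have "normalized_scalar_curvature fff u = delta_casorati_2 (in_chart f c) u"
      using assms(2,3,5) unfolding casorati_ideal_def induced_metric_def by blast
    from casorati_ideal_sff[OF u this]
    show "\<exists>l e. met u e e = 1 \<and> (\<forall>x y. sff u x y = l * (met u x y + met u e x * met u e y))"
      by metis
  qed
qed

text \<open>Balls supply the convexity used by the constancy arguments. The last property carries
  open sets of the manifold into coordinates.\<close>

lemma coordinate_ball:
  fixes A :: "('a::{t2_space, second_countable_topology}, 'n::finite) chart set"
  assumes "smooth_atlas A" "c \<in> A" "x \<in> fst c"
  obtains B V where "open B" "convex B" "B \<subseteq> snd c ` fst c" "open V" "x \<in> V" "snd c x \<in> B"
    "\<And>y. y \<in> V \<Longrightarrow> snd c y \<in> B \<and> inv_into (fst c) (snd c) (snd c y) = y"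
    "\<And>u. u \<in> B \<Longrightarrow> inv_into (fst c) (snd c) u \<in> V"
    "\<And>W. open W \<Longrightarrow> open (B \<inter> inv_into (fst c) (snd c) -` W)"
proof -
  let ?i = "inv_into (fst c) (snd c)"
  have ch: "open (fst c)" "open (snd c ` fst c)" "homeomorphism (fst c) (snd c ` fst c) (snd c) ?i"
    using assms(1,2) unfolding smooth_atlas_def chart_def by auto
  have hom: "continuous_on (fst c) (snd c)" "continuous_on (snd c ` fst c) ?i"
    "\<And>y. y \<in> fst c \<Longrightarrow> ?i (snd c y) = y" "\<And>u. u \<in> snd c ` fst c \<Longrightarrow> ?i u \<in> fst c \<and> snd c (?i u) = u"
    using ch(3) by (auto simp: homeomorphism_def)
  obtain r where r: "r > 0" "ball (snd c x) r \<subseteq> snd c ` fst c"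
    using ch(2) assms(3) open_contains_ball by blast
  let ?B = "ball (snd c x) r"
  show thesis
  proof (rule that[of ?B "fst c \<inter> snd c -` ?B"])
    show "open (fst c \<inter> snd c -` ?B)"
      by (rule continuous_open_preimage[OF hom(1) ch(1) open_ball])
    show "open (?B \<inter> ?i -` W)" if "open W" for W
      by (rule continuous_open_preimage[OF continuous_on_subset[OF hom(2) r(2)] open_ball that])
    show "?i u \<in> fst c \<inter> snd c -` ?B" if "u \<in> ?B" for u
      using hom(4)[of u] r(2) that by auto
  qed (use r hom(3) assms(3) in auto)
qed

text \<open>If \<open>T p\<close> and \<open>T0 p\<close> differ, the preimage \<open>p'\<close> of
  \<open>T p\<close> under \<open>T0\<close> differs from \<open>p\<close> but has the same
  distances to all points of \<open>Q\<close>. So \<open>Q\<close> lies in the perpendicular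
  bisector of \<open>p\<close> and \<open>p'\<close>, a hyperplane.\<close>

lemma euclidean_isometry_eq:
  assumes T: "euclidean_isometry T" and T0: "euclidean_isometry T0"
    and agree: "\<And>q. q \<in> Q \<Longrightarrow> T q = T0 q"
    and spans: "\<And>n b. n \<noteq> 0 \<Longrightarrow> \<exists>q\<in>Q. n \<bullet> q \<noteq> b"
  shows "T = T0"
proof
  fix p
  show "T p = T0 p"
  proof (rule ccontr)
    assume ne: "T p \<noteq> T0 p"
    obtain p' where p': "T0 p' = T p" using T0 unfolding euclidean_isometry_def by (metis surjD)
    then have "p' - p \<noteq> 0" using ne by auto
    moreover have "(p' - p) \<bullet> q = (p' \<bullet> p' - p \<bullet> p) / 2" if "q \<in> Q" for q
    proof -
      have "dist q p = dist (T q) (T p)" using T by (simp add: euclidean_isometry_def)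
      also have "\<dots> = dist (T0 q) (T0 p')" by (simp add: agree[OF that] p')
      also have "\<dots> = dist q p'" using T0 by (simp add: euclidean_isometry_def)
      finally have "(q - p) \<bullet> (q - p) = (q - p') \<bullet> (q - p')"
        by (simp add: dist_norm norm_eq)
      then show ?thesis by (simp add: inner_diff_left inner_diff_right inner_commute)
    qed
    ultimately show False using spans by blast
  qed
qed

context
  fixes A :: "('a::{t2_space, second_countable_topology}, 3) chart set" and f :: "'a \<Rightarrow> real ^ 4"
  assumes atlas: "smooth_atlas A" and conn: "connected (UNIV :: 'a set)"
    and imm: "smooth_immersion A f" and nongeo: "\<not> totally_geodesic A f"
    and ideal: "casorati_ideal A f"
begin

text \<open>A chart-free substitute for the vanishing of \<open>lam\<close>, whose sign changes with
  the orientation of the chart. Its negation is also the spanning condition of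
  \<open>euclidean_isometry_eq\<close>.\<close>

definition flat_at :: "'a \<Rightarrow> bool" where
  "flat_at x \<longleftrightarrow> (\<exists>V n b. open V \<and> x \<in> V \<and> n \<noteq> 0 \<and> (\<forall>y\<in>V. n \<bullet> f y = b))"

lemma chart_exists: "\<exists>c\<in>A. x \<in> fst c"
  using atlas unfolding smooth_atlas_def by blast

lemma flat_at_imp_lam_zero:
  assumes c: "c \<in> A" "x \<in> fst c" and x: "flat_at x"
  shows "hypersurface_patch.lam (in_chart f c) (snd c x) = 0"
proof -
  obtain B V where B: "open B" "convex B" "B \<subseteq> snd c ` fst c" "open V" "x \<in> V" "snd c x \<in> B"
    "\<And>y. y \<in> V \<Longrightarrow> snd c y \<in> B \<and> inv_into (fst c) (snd c) (snd c y) = y"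
    "\<And>W. open W \<Longrightarrow> open (B \<inter> inv_into (fst c) (snd c) -` W)"
    by (rule coordinate_ball[OF atlas c]) (rule that)
  interpret casorati_patch B "in_chart f c"
    by (rule casorati_ideal_patch[OF imm ideal c(1) B(1,3)])
  obtain W n b where W: "open W" "x \<in> W" "n \<noteq> 0" "\<And>y. y \<in> W \<Longrightarrow> n \<bullet> f y = b"
    using x unfolding flat_at_def by metis
  show ?thesis
    by (rule hyperplane_imp_lam_zero[OF B(8)[OF W(1)] _ _ W(3), of _ b])
      (use B W in \<open>auto simp: in_chart_def\<close>)
qed

lemma lam_zero_imp_flat:
  assumes c: "c \<in> A" "x \<in> fst c" and l0: "hypersurface_patch.lam (in_chart f c) (snd c x) = 0"
  obtains V where "open V" "x \<in> V" "\<And>y. y \<in> V \<Longrightarrow> flat_at y"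
proof -
  obtain B V where B: "open B" "convex B" "B \<subseteq> snd c ` fst c" "open V" "x \<in> V" "snd c x \<in> B"
    "\<And>y. y \<in> V \<Longrightarrow> snd c y \<in> B \<and> inv_into (fst c) (snd c) (snd c y) = y"
    by (rule coordinate_ball[OF atlas c]) (rule that)
  interpret casorati_patch B "in_chart f c"
    by (rule casorati_ideal_patch[OF imm ideal c(1) B(1,3)])
  obtain n b where n: "n \<noteq> 0" "\<And>v. v \<in> B \<Longrightarrow> n \<bullet> in_chart f c v = b"
    by (rule lam_zero_imp_hyperplane[OF B(2,6) l0]) (rule that)
  have "n \<bullet> f y = b" if "y \<in> V" for y
    using n(2)[of "snd c y"] B(7)[OF that] by (simp add: in_chart_def)
  then show thesis using that[OF B(4,5)] B(4) n(1) unfolding flat_at_def by blast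
qed

text \<open>The flat points form an open set by definition, and so do the others, since a nonzero
  value of \<open>lam\<close> excludes zeros in a whole coordinate ball. By connectedness all points
  would be flat, which is the excluded totally geodesic case.\<close>

lemma not_flat: "\<not> flat_at x"
proof -
  have "open {x. flat_at x}"
    unfolding flat_at_def open_subopen[of "{x. _ x}"] by blast
  moreover have "open (- {x. flat_at x})"
  proof (subst open_subopen, intro ballI)
    fix x assume x: "x \<in> - {x. flat_at x}"
    obtain c where c: "c \<in> A" "x \<in> fst c" using chart_exists by blast
    obtain B V where B: "open B" "convex B" "B \<subseteq> snd c ` fst c" "open V" "x \<in> V" "snd c x \<in> B"
      "\<And>y. y \<in> V \<Longrightarrow> snd c y \<in> B \<and> inv_into (fst c) (snd c) (snd c y) = y"
      "\<And>u. u \<in> B \<Longrightarrow> inv_into (fst c) (snd c) u \<in> V"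
      by (rule coordinate_ball[OF atlas c]) (rule that)
    interpret casorati_patch B "in_chart f c"
      by (rule casorati_ideal_patch[OF imm ideal c(1) B(1,3)])
    have "lam (snd c x) \<noteq> 0" using lam_zero_imp_flat[OF c] x by blast
    have "\<not> flat_at y" if "y \<in> V" "y \<in> fst c" for y
    proof
      assume "flat_at y"
      then have "lam (snd c y) = 0" by (rule flat_at_imp_lam_zero[OF c(1) that(2)])
      then show False
        using lam_zero_or_nonzero[OF convex_connected[OF B(2)] B(6) \<open>lam (snd c x) \<noteq> 0\<close>] B(7)[OF that(1)]
        by blast
    qed
    moreover have "open (fst c)" using atlas c(1) by (auto simp: smooth_atlas_def chart_def)
    ultimately show "\<exists>T. open T \<and> x \<in> T \<and> T \<subseteq> - {x. flat_at x}"
      using B(4,5) c(2) by (intro exI[of _ "V \<inter> fst c"]) auto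
  qed
  ultimately have "{x. flat_at x} = {} \<or> {x. flat_at x} = UNIV"
    using conn by (auto simp: connected_clopen open_closed)
  moreover have "{x. flat_at x} \<noteq> UNIV"
  proof
    assume all: "{x. flat_at x} = UNIV"
    have "second_fundamental_form (in_chart f c) u v w = 0" if c: "c \<in> A" and u: "u \<in> snd c ` fst c"
      for c u v w
    proof -
      obtain x where x: "x \<in> fst c" "u = snd c x" using u by blast
      have "open (snd c ` fst c)" using atlas c by (auto simp: smooth_atlas_def chart_def)
      then interpret casorati_patch "snd c ` fst c" "in_chart f c"
        by (rule casorati_ideal_patch[OF imm ideal c _ subset_refl])
      have "flat_at x" using all by blast
      then have "lam u = 0" using flat_at_imp_lam_zero[OF c x(1)] x(2) by simp
      then have "sff u v w = 0" using sff_zero_iff[OF u] by blast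
      then show ?thesis using second_fundamental_form_eq[OF u] by (metis mult_zero_right)
    qed
    then show False using nongeo unfolding totally_geodesic_def by blast
  qed
  ultimately show ?thesis by blast
qed

lemma local_congruence:
  assumes f': "isometric_immersion A (induced_metric f) f'"
  obtains V T where "open V" "x \<in> V" "euclidean_isometry T" "\<And>y. y \<in> V \<Longrightarrow> f' y = T (f y)"
proof -
  obtain c where c: "c \<in> A" "x \<in> fst c" using chart_exists by blast
  obtain B V where B: "open B" "convex B" "B \<subseteq> snd c ` fst c" "open V" "x \<in> V" "snd c x \<in> B"
    "\<And>y. y \<in> V \<Longrightarrow> snd c y \<in> B \<and> inv_into (fst c) (snd c) (snd c y) = y"
    by (rule coordinate_ball[OF atlas c]) (rule that)
  have imm': "smooth_immersion A f'" using f' unfolding isometric_immersion_def by blast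
  have same: "first_fundamental_form (in_chart f c) u = first_fundamental_form (in_chart f' c) u"
    if "u \<in> B" for u
  proof -
    have "u \<in> snd c ` fst c" using B(3) that by blast
    then show ?thesis using f' c(1) by (auto simp: isometric_immersion_def induced_metric_def)
  qed
  have l0: "hypersurface_patch.lam (in_chart f c) u \<noteq> 0" if u: "u \<in> B" for u
  proof -
    obtain y where y: "y \<in> fst c" "u = snd c y" using u B(3) by blast
    show ?thesis
      using lam_zero_imp_flat[OF c(1) y(1)] not_flat y(2) by metis
  qed
  obtain T where T: "euclidean_isometry T" "\<And>u. u \<in> B \<Longrightarrow> in_chart f' c u = T (in_chart f c u)"
    by (rule congruent_patches[OF casorati_ideal_patch[OF imm ideal c(1) B(1,3)]
          smooth_immersion_patch[OF imm' c(1) B(1,3)] B(2) same l0 B(6)])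
      (assumption | rule that)+
  have "f' y = T (f y)" if "y \<in> V" for y
    using T(2)[of "snd c y"] B(7)[OF that] by (simp add: in_chart_def)
  then show thesis using that B(4,5) T(1) by blast
qed

lemma rigid_ideal: "rigid A (induced_metric f) f"
  unfolding rigid_def
proof (intro conjI allI impI)
  show "isometric_immersion A (induced_metric f) f"
    using imm by (simp add: isometric_immersion_def)
  fix f' :: "'a \<Rightarrow> real ^ 4"
  assume f': "isometric_immersion A (induced_metric f) f'"
  \<comment> \<open>Types are nonempty, so a base point is available; the isometry found near it has
    to serve everywhere.\<close>
  fix x0 :: 'a
  obtain V0 T0 where V0: "open V0" "x0 \<in> V0" and T0: "euclidean_isometry T0"
    and e0: "\<And>y. y \<in> V0 \<Longrightarrow> f' y = T0 (f y)"
    by (rule local_congruence[OF f']) (rule that)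
  define Z where "Z = {x. \<exists>V. open V \<and> x \<in> V \<and> (\<forall>y\<in>V. f' y = T0 (f y))}"
  have "open Z" unfolding Z_def by (subst open_subopen) blast
  moreover have "open (- Z)"
  proof (subst open_subopen, intro ballI)
    fix x assume x: "x \<in> - Z"
    obtain V T where V: "open V" "x \<in> V" and T: "euclidean_isometry T"
      and e: "\<And>y. y \<in> V \<Longrightarrow> f' y = T (f y)"
      by (rule local_congruence[OF f']) (rule that)
    \<comment> \<open>If the neighbourhood \<open>V\<close> met \<open>Z\<close>, then
      \<open>T\<close> and \<open>T0\<close> would agree on the image of an open overlap, which lies
      in no hyperplane. Hence \<open>T = T0\<close>, and \<open>x\<close> itself would belong to
      \<open>Z\<close>.\<close>
    have "y \<notin> Z" if y: "y \<in> V" for y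
    proof
      assume "y \<in> Z"
      then obtain W where W: "open W" "y \<in> W" "\<And>y. y \<in> W \<Longrightarrow> f' y = T0 (f y)"
        unfolding Z_def by blast
      have "T = T0"
      proof (rule euclidean_isometry_eq[OF T T0])
        show "T q = T0 q" if "q \<in> f ` (V \<inter> W)" for q using that e W(3) by force
        show "\<exists>q\<in>f ` (V \<inter> W). n \<bullet> q \<noteq> b" if "n \<noteq> 0" for n b
          using not_flat[of y] that W(1,2) V(1) y unfolding flat_at_def
          by (metis IntI image_eqI open_Int)
      qed
      then have "x \<in> Z" unfolding Z_def using V e by blast
      then show False using x by blast
    qed
    then show "\<exists>T. open T \<and> x \<in> T \<and> T \<subseteq> - Z" using V by blast
  qed
  moreover have "x0 \<in> Z" unfolding Z_def using V0 e0 by blast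
  ultimately have "Z = UNIV" using conn by (auto simp: connected_clopen open_closed)
  then have "f' = T0 \<circ> f" unfolding Z_def by (auto simp: fun_eq_iff)
  then show "\<exists>T. euclidean_isometry T \<and> f' = T \<circ> f" using T0 by blast
qed

end

theorem theorem5p5:
  fixes A :: "('a::{t2_space, second_countable_topology}, 3) chart set"
    and f :: "'a \<Rightarrow> real ^ 4"
  assumes "smooth_atlas A"
    and "connected (UNIV :: 'a set)"
    and "smooth_immersion A f"
    and "\<not> totally_geodesic A f"
    and "casorati_ideal A f"
  shows "rigid A (induced_metric f) f"
  using assms by (rule rigid_ideal)

end
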